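(* Let $-\frac18<s<\frac14$. Then for any $R>0$ and $T>0$ there exists a constant $C=C(R,T)>0$ such that for any real-valued initial data $u_0\in\mathcal{S}(\mathbb{R})$ satisfying $\|u_0\|_{H^s}\le R$, the unique solution $u\in C([0,T];\mathcal{S}(\mathbb{R}))$ of $$\partial_t u+\partial_x^3u\pm\partial_x(u^3)=0,\qquad u(0)=u_0,$$ (for either choice of the sign, i.e. focusing or defocusing) satisfies $$\|u\|_{L^\infty_{[0,T]}H^s_x}\le C\,\|u_0\|_{H^s}.$$
   Context: The equation is the modified Korteweg–de Vries (mKdV) equation on $\mathbb{R}$; $u=u(x,t)$ is real-valued, with $(x,t)\in\mathbb{R}\times\mathbb{R}$. $\mathcal{S}(\mathbb{R})$ is the Schwartz space and $\|\phi\|_{H^s}=\|(1+|\xi|^2)^{s/2}\hat\phi\|_{L^2}$ is the usual inhomogeneous Sobolev norm. Existence and uniqueness of the solution in $C([0,T];\mathcal{S}(\mathbb{R}))$ for Schwartz data is a known background fact. *)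

theory Defs
  imports "HOL-Probability.Essential_Supremum"
begin

definition schwartz :: "(real \<Rightarrow> real) \<Rightarrow> bool" where
  "schwartz f \<longleftrightarrow>
     (\<forall>l x. (deriv ^^ l) f differentiable (at x)) \<and>
     (\<forall>k l. bounded (range (\<lambda>x. x ^ k * (deriv ^^ l) f x)))"

definition schwartz_seminorm :: "nat \<Rightarrow> nat \<Rightarrow> (real \<Rightarrow> real) \<Rightarrow> real" where
  "schwartz_seminorm k l f = (SUP x. \<bar>x ^ k * (deriv ^^ l) f x\<bar>)"

text \<open>Functions of space and time are curried with time first: \<open>u t\<close> is the spatial profile
  at time \<open>t\<close>.\<close>

definition continuous_into_schwartz :: "real set \<Rightarrow> (real \<Rightarrow> real \<Rightarrow> real) \<Rightarrow> bool" where
  "continuous_into_schwartz I u \<longleftrightarrow>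
     (\<forall>t\<in>I. schwartz (u t)) \<and>
     (\<forall>k l. \<forall>t0\<in>I.
        ((\<lambda>t. schwartz_seminorm k l (\<lambda>x. u t x - u t0 x)) \<longlongrightarrow> 0) (at t0 within I))"

text \<open>The Fourier transform without a normalising factor in front of the integral. All integrals
  below converge for Schwartz functions, the only functions they are applied to.\<close>

definition fourier :: "(real \<Rightarrow> real) \<Rightarrow> real \<Rightarrow> complex" where
  "fourier f \<xi> = (LINT x|lborel. exp (- (\<i> * of_real (x * \<xi>))) * of_real (f x))"

definition L2_norm :: "(real \<Rightarrow> complex) \<Rightarrow> real" where
  "L2_norm g = sqrt (LINT \<xi>|lborel. (norm (g \<xi>))\<^sup>2)"

definition Hs_norm :: "real \<Rightarrow> (real \<Rightarrow> real) \<Rightarrow> real" where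
  "Hs_norm s f = L2_norm (\<lambda>\<xi>. of_real ((1 + \<bar>\<xi>\<bar>\<^sup>2) powr (s / 2)) * fourier f \<xi>)"

definition Linf_Hs_norm :: "real \<Rightarrow> real \<Rightarrow> (real \<Rightarrow> real \<Rightarrow> real) \<Rightarrow> ereal" where
  "Linf_Hs_norm T s u = esssup (lebesgue_on {0..T}) (\<lambda>t. ereal (Hs_norm s (u t)))"

text \<open>\<open>\<sigma> = 1\<close> is the focusing and \<open>\<sigma> = -1\<close> the defocusing equation. The time derivative is
  taken within \<open>{0..T}\<close>, so it is one-sided at the endpoints.\<close>

definition mkdv_solution ::
  "real \<Rightarrow> real \<Rightarrow> (real \<Rightarrow> real) \<Rightarrow> (real \<Rightarrow> real \<Rightarrow> real) \<Rightarrow> bool" where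
  "mkdv_solution \<sigma> T u0 u \<longleftrightarrow>
     continuous_into_schwartz {0..T} u \<and>
     (\<forall>t\<in>{0..T}. \<forall>x. \<exists>ut.
        ((\<lambda>\<tau>. u \<tau> x) has_real_derivative ut) (at t within {0..T}) \<and>
        ut + (deriv ^^ 3) (u t) x + \<sigma> * deriv (\<lambda>y. (u t y) ^ 3) x = 0) \<and>
     u 0 = u0"

end

theory Submission
  imports Defs "HOL-Probability.Probability"
begin

text \<open>
  The equation is completely integrable. For every \<open>\<kappa> \<ge> 2\<close> it has a conserved quantity that sees the
  solution at frequencies of size \<open>\<kappa>\<close>, and a superposition of these quantities over \<open>\<kappa>\<close> is comparable
  to the square of an \<open>H\<^sup>s\<close> norm.

  With \<open>U = sqrt 2 * u\<close> the equation reads \<open>U_t = - U_xxx - 3/2 \<sigma> U\<^sup>2 U_x\<close>. Let \<open>\<phi>\<close> be the small bounded solution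
  of \<open>\<phi>' = 2 \<kappa> S(\<phi>) - U\<close>, where \<open>S\<close> is the sine in the focusing and the hyperbolic sine in the defocusing
  case. It is the Pruefer angle of the Zakharov-Shabat system at the spectral parameter \<open>\<i>\<kappa>\<close>. Let \<open>h\<close> be the
  primitive of \<open>S\<close> with \<open>h(0) = 0\<close>. The charge \<open>\<integral>h(\<phi>)\<close> is conserved, because \<open>\<phi>_t\<close> is an explicit expression
  \<open>q\<close> and \<open>S(\<phi>) q\<close> is an exact derivative (\<open>charge_conserved\<close>).

  In the variable \<open>\<phi>\<close> the charge is visibly coercive: \<open>h(\<phi>)\<close> is comparable to \<open>\<phi>\<^sup>2\<close>. Moreover \<open>\<phi>\<close> is comparable
  in \<open>L\<^sup>2\<close> to \<open>v = (2\<kappa> - d/dx)^(-1) U\<close>, since \<open>\<phi> - v\<close> is \<open>2\<kappa> (2\<kappa> - d/dx)^(-1)\<close> applied to \<open>\<phi> - S(\<phi>)\<close>, which is at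
  most \<open>\<bar>\<phi>\<bar>/4\<close> (\<open>L2_angle_linear\<close>). By Plancherel, \<open>2 \<pi> \<integral>v\<^sup>2\<close> is the integral of \<open>\<bar>F(\<xi>)\<bar>\<^sup>2 / (4\<kappa>\<^sup>2 + \<xi>\<^sup>2)\<close>, where
  \<open>F\<close> is the Fourier transform of \<open>U\<close>. Hence these integrals at two times are comparable, uniformly in
  \<open>\<kappa> \<ge> \<kappa>0\<close> (\<open>resolvent_comparison\<close>). For \<open>s < 0\<close> the weight \<open>(4\<kappa>0\<^sup>2 + \<xi>\<^sup>2)^s\<close> is a superposition of the functions
  \<open>1 / (4\<kappa>\<^sup>2 + \<xi>\<^sup>2)\<close> with \<open>\<kappa> \<ge> \<kappa>0\<close> (\<open>subordination\<close>), which gives the bound on the \<open>H\<^sup>s\<close> norm.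

  For \<open>s > 0\<close> the same argument runs with \<open>\<integral>U\<^sup>2 - 8 \<kappa>\<^sup>2 \<integral>h(\<phi>)\<close>, a difference of conserved quantities which is
  comparable to \<open>\<integral>v_x\<^sup>2\<close> up to an error of size \<open>(\<integral>U\<^sup>2)\<^sup>3 / \<kappa>\<^sup>2\<close> (\<open>higher_charge_bounds\<close>); for \<open>s = 0\<close> the
  conservation of \<open>\<integral>U\<^sup>2\<close> is enough.

  The angle exists as soon as \<open>\<bar>v\<bar> \<le> 1/4\<close>. This holds once \<open>\<kappa>0\<close> is large in terms of a negative-order norm of
  the solution (\<open>resolvent_small\<close>). At later times that norm is controlled by the conservation of \<open>\<integral>U\<^sup>2\<close> if
  \<open>s \<ge> 0\<close>, and by a continuity argument in time if \<open>s < 0\<close> (\<open>norm_preserved_bootstrap\<close>).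
\<close>

section \<open>Functions with quadratic decay\<close>

abbreviation L2sq :: "(real \<Rightarrow> real) \<Rightarrow> real" where
  "L2sq f \<equiv> (LINT x|lborel. (f x)\<^sup>2)"

text \<open>A bound by a multiple of \<open>1 / (1 + x\<^sup>2)\<close> gives integrability and limits 0, it
  survives products, and by \<open>bounded_solution_decay\<close> it passes from the right-hand side of a
  differential equation to its bounded solution.\<close>

definition decaying :: "(real \<Rightarrow> real) \<Rightarrow> bool" where
  "decaying f \<longleftrightarrow> continuous_on UNIV f \<and> (\<exists>K. \<forall>x. \<bar>f x\<bar>
      \<le> K / (1 + x\<^sup>2))"

lemma one_plus_square_pos [simp]: "0 < 1 + (x::real)\<^sup>2"
  by (smt (verit) zero_le_power2)

lemma one_plus_square_nonneg [simp]: "0 \<le> 1 + (x::real)\<^sup>2"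
  by (rule less_imp_le) simp

lemma quotient_one_plus_square_le: "0 \<le> K \<Longrightarrow> K / (1 + (x::real)\<^sup>2) \<le> K"
  by (simp add: divide_le_eq mult_le_cancel_left1)

lemma decayingI: "continuous_on UNIV f \<Longrightarrow>
    (\<And>x. \<bar>f x\<bar> \<le> K / (1 + x\<^sup>2)) \<Longrightarrow> decaying f"
  unfolding decaying_def by blast

lemma decaying_continuous: "decaying f \<Longrightarrow> continuous_on UNIV f"
  by (simp add: decaying_def)

lemma decaying_measurable: "decaying f \<Longrightarrow> f \<in> borel_measurable borel"
  by (intro borel_measurable_continuous_onI decaying_continuous)

lemma decayingE:
  assumes "decaying f"
  obtains K where "0 < K" "\<And>x. \<bar>f x\<bar> \<le> K / (1 + x\<^sup>2)" "\<And>x. \<bar>f x\<bar>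
      \<le> K"
proof -
  obtain K where K: "\<And>x. \<bar>f x\<bar> \<le> K / (1 + x\<^sup>2)"
    using assms by (auto simp: decaying_def)
  let ?K = "\<bar>K\<bar> + 1"
  have *: "\<bar>f x\<bar> \<le> ?K / (1 + x\<^sup>2)" for x
    by (rule order_trans[OF K]) (intro divide_right_mono, auto)
  show ?thesis
    by (rule that[of ?K]) (use * order_trans[OF * quotient_one_plus_square_le[of ?K]] in auto)
qed

lemma decaying_mono:
  assumes "decaying g" "continuous_on UNIV f" "\<And>x. \<bar>f x\<bar> \<le> c * \<bar>g x\<bar>" "0 \<le> c"
  shows "decaying f"
proof -
  obtain K where K: "\<And>x. \<bar>g x\<bar> \<le> K / (1 + x\<^sup>2)"
    using assms(1) by (auto simp: decaying_def)
  show ?thesis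
    by (rule decayingI[of _ "c * K"], fact)
      (metis assms(3,4) K mult_left_mono order_trans times_divide_eq_right)
qed

lemma decaying_add: "decaying f \<Longrightarrow> decaying g \<Longrightarrow> decaying (\<lambda>x. f x + g x)"
proof -
  assume f: "decaying f" and g: "decaying g"
  obtain K where K: "\<And>x. \<bar>f x\<bar> \<le> K / (1 + x\<^sup>2)" using f by (auto simp: decaying_def)
  obtain L where L: "\<And>x. \<bar>g x\<bar> \<le> L / (1 + x\<^sup>2)" using g by (auto simp: decaying_def)
  show ?thesis
  proof (rule decayingI[of _ "K + L"])
    show "\<bar>f x + g x\<bar> \<le> (K + L) / (1 + x\<^sup>2)" for x
      using K[of x] L[of x] by (simp add: add_divide_distrib)
  qed (intro continuous_on_add decaying_continuous f g)
qed

lemma decaying_mult_bounded: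
  assumes "decaying f" "continuous_on UNIV g" "\<And>x. \<bar>g x\<bar> \<le> L"
  shows "decaying (\<lambda>x. g x * f x)"
proof (rule decaying_mono[OF assms(1), of _ "\<bar>L\<bar>"])
  show "\<bar>g x * f x\<bar> \<le> \<bar>L\<bar> * \<bar>f x\<bar>" for x
    using order_trans[OF assms(3) abs_ge_self, of x] by (simp add: abs_mult mult_right_mono)
qed (use assms in \<open>simp_all add: continuous_on_mult decaying_continuous\<close>)

lemma decaying_cmult: "decaying f \<Longrightarrow> decaying (\<lambda>x. c * f x)"
  by (rule decaying_mult_bounded[where L="\<bar>c\<bar>"]) auto

lemma decaying_minus: "decaying f \<Longrightarrow> decaying (\<lambda>x. - f x)"
  using decaying_cmult[of f "-1"] by simp

lemma decaying_diff: "decaying f \<Longrightarrow> decaying g \<Longrightarrow>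
    decaying (\<lambda>x. f x - g x)"
  using decaying_add[of f "\<lambda>x. - g x"] decaying_minus[of g] by simp

lemma decaying_mult:
  assumes "decaying f" "decaying g"
  shows "decaying (\<lambda>x. g x * f x)"
  using assms by (metis decayingE decaying_continuous decaying_mult_bounded)

lemma decaying_power: "decaying f \<Longrightarrow> 0 < n \<Longrightarrow> decaying (\<lambda>x. f x ^ n)"
proof (induction n)
  case (Suc n)
  then show ?case
    by (cases "n = 0") (auto intro: decaying_mult[of "\<lambda>x. f x ^ n" f])
qed simp

lemma decaying_abs: "decaying f \<Longrightarrow> decaying (\<lambda>x. \<bar>f x\<bar>)"
  by (rule decaying_mono[of f _ 1]) (simp_all add: continuous_on_rabs decaying_continuous)

lemma integrable_one_plus_square: "integrable lborel (\<lambda>x::real. K / (1 + x\<^sup>2))"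
proof -
  have "integrable lborel (\<lambda>x::real. inverse (1 + x\<^sup>2))"
    using integrable_inverse_1_plus_square by (simp add: set_integrable_def)
  from integrable_mult_right[OF this, of K] show ?thesis
    by (simp add: divide_inverse)
qed

lemma integral_one_plus_square: "(LINT x::real|lborel. K / (1 + x\<^sup>2)) = K * pi"
proof -
  have "(LINT x::real|lborel. inverse (1 + x\<^sup>2)) = pi"
    using LBINT_inverse_1_plus_square
    by (simp add: interval_lebesgue_integral_def set_lebesgue_integral_def)
  then show ?thesis by (simp add: divide_inverse)
qed

lemma decaying_integrable: "decaying f \<Longrightarrow> integrable lborel f"
proof -
  assume f: "decaying f"
  obtain K where K: "\<And>x. \<bar>f x\<bar> \<le> K / (1 + x\<^sup>2)" using f by (auto simp: decaying_def)
  show ?thesis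
    by (rule Bochner_Integration.integrable_bound[OF integrable_one_plus_square[of K]])
      (use f decaying_measurable order_trans[OF K abs_ge_self] in auto)
qed

lemma tendsto_quotient_one_plus_square:
  "((\<lambda>x. K / (1 + (x::real)\<^sup>2)) \<longlongrightarrow> 0) at_top" "((\<lambda>x. K / (1
      + (x::real)\<^sup>2)) \<longlongrightarrow> 0) at_bot"
proof -
  have 1: "filterlim (\<lambda>x::real. 1 + x\<^sup>2) at_top at_top"
    by (intro filterlim_tendsto_add_at_top[OF tendsto_const] filterlim_pow_at_top filterlim_ident) auto
  show "((\<lambda>x. K / (1 + (x::real)\<^sup>2)) \<longlongrightarrow> 0) at_top"
    by (rule tendsto_divide_0[OF tendsto_const])
      (rule filterlim_mono[OF 1 at_top_le_at_infinity order_refl])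
  then show "((\<lambda>x. K / (1 + (x::real)\<^sup>2)) \<longlongrightarrow> 0) at_bot"
    by (subst filterlim_at_bot_mirror) simp
qed

lemma decaying_tendsto:
  assumes "decaying f"
  shows "(f \<longlongrightarrow> 0) at_top" "(f \<longlongrightarrow> 0) at_bot"
proof -
  obtain K where K: "\<And>x. \<bar>f x\<bar> \<le> K / (1 + x\<^sup>2)" using assms
      by (auto simp: decaying_def)
  show "(f \<longlongrightarrow> 0) at_top"
    by (rule Lim_null_comparison[OF _ tendsto_quotient_one_plus_square(1)[of K]]) (simp add: K)
  show "(f \<longlongrightarrow> 0) at_bot"
    by (rule Lim_null_comparison[OF _ tendsto_quotient_one_plus_square(2)[of K]]) (simp add: K)
qed

lemma integral_derivative_tendsto:
  fixes F f :: "real \<Rightarrow> 'a::euclidean_space"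
  assumes F: "\<And>x. (F has_vector_derivative f x) (at x)" and c: "continuous_on UNIV f"
    and i: "integrable lborel f" and l: "(F \<longlongrightarrow> A) at_bot" "(F \<longlongrightarrow> B)
        at_top"
  shows "(LINT x|lborel. f x) = B - A"
proof -
  have "(LBINT x=-\<infinity>..\<infinity>. f x) = B - A"
  proof (rule interval_integral_FTC_integrable)
    show "((F \<circ> real_of_ereal) \<longlongrightarrow> A) (at_right (- \<infinity>))"
      using l(1) by (simp add: ereal_tendsto_simps)
    show "((F \<circ> real_of_ereal) \<longlongrightarrow> B) (at_left \<infinity>)"
      using l(2) by (simp add: ereal_tendsto_simps)
  qed (use assms in \<open>auto simp: continuous_on_eq_continuous_at set_integrable_def\<close>)
  then show ?thesis
    by (simp add: interval_lebesgue_integral_def set_lebesgue_integral_def)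
qed

lemma decaying_integral_derivative:
  assumes F: "\<And>x. (F has_real_derivative f x) (at x)" and "decaying F" "decaying f"
  shows "(LINT x|lborel. f x) = 0"
  using integral_derivative_tendsto[of F f 0 0] assms decaying_tendsto[of F]
  by (simp add: has_real_derivative_iff_has_vector_derivative decaying_continuous decaying_integrable)

lemma DERIV_continuous_on_UNIV:
  "(\<And>x. (f has_real_derivative f' x) (at x)) \<Longrightarrow> continuous_on UNIV f"
  by (meson DERIV_isCont continuous_at_imp_continuous_on)

section \<open>Bounded solutions of linear equations with exponential growth\<close>

text \<open>Where \<open>g\<close> is positive it grows exponentially, which a function bounded above cannot do.
  Only a differential inequality enters, so it applies to equations whose coefficient depends on the
  solution.\<close>

lemma growth_comparison:
  fixes g g' :: "real \<Rightarrow> real"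
  assumes d: "\<And>x. (g has_real_derivative g' x) (at x)"
    and bd: "\<And>x. g x \<le> L"
    and gr: "\<And>x. 0 < g x \<Longrightarrow> g x \<le> g' x"
  shows "g x \<le> 0"
proof (rule ccontr)
  assume "\<not> g x \<le> 0"
  then have pos: "0 < g x" by simp
  have ge: "g x \<le> g y" if "x \<le> y" for y
  proof (rule ccontr)
    assume ny: "\<not> g x \<le> g y"
    have cont: "continuous_on {x..y} g"
      by (meson DERIV_isCont continuous_at_imp_continuous_on d)
    define A where "A = {x..y} \<inter> g -` {g x..}"
    have "closed A" unfolding A_def
      by (rule continuous_closed_preimage[OF cont]) auto
    moreover have "x \<in> A" using that by (simp add: A_def)
    moreover have bA: "bdd_above A" by (auto simp: A_def intro: bdd_above.I[of _ y])
    ultimately have s: "Sup A \<in> A" using closed_contains_Sup by blast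
    then have sy: "Sup A \<le> y" "g x \<le> g (Sup A)" "x \<le> Sup A" by (auto simp: A_def)
    then have "Sup A \<noteq> y" using ny by auto
    then have sly: "Sup A < y" using sy by simp
    have "0 < g' (Sup A)" using gr[of "Sup A"] sy pos by linarith
    then obtain e where e: "0 < e" "\<And>h. 0 < h \<Longrightarrow> h < e \<Longrightarrow>
        g (Sup A) < g (Sup A + h)"
      using DERIV_pos_inc_right[OF d] by blast
    define h where "h = min (e / 2) (y - Sup A)"
    have h: "0 < h" "h < e" "Sup A + h \<le> y" using e(1) sly by (auto simp: h_def min_def)
    then have "Sup A + h \<in> A" using e(2)[of h] sy by (auto simp: A_def)
    then have "Sup A + h \<le> Sup A" using bA cSup_upper by blast
    then show False using h by simp
  qed
  have lin: "g x + g x * (y - x) \<le> g y" if xy: "x < y" for y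
  proof -
    obtain z where z: "x < z" "z < y" "g y - g x = (y - x) * g' z"
      using MVT2[of x y g g', OF xy d] by blast
    have "g x \<le> g' z" using gr[of z] ge[of z] z pos by linarith
    then have "(y - x) * g x \<le> (y - x) * g' z" using xy by (intro mult_left_mono) auto
    then show ?thesis using z by (simp add: algebra_simps)
  qed
  define y where "y = x + (\<bar>L\<bar> + 1) / g x"
  have "g x + g x * ((\<bar>L\<bar> + 1) / g x) \<le> L"
    using lin[of y] bd[of y] pos by (simp add: y_def)
  then show False using pos by simp
qed

lemma DERIV_quotient_one_plus_square:
  "((\<lambda>x. K / (1 + x\<^sup>2)) has_real_derivative - (2 * x * K / (1 + x\<^sup>2)\<^sup>2)) (at x)"
  by (rule derivative_eq_intros refl | simp add: add_nonneg_eq_0_iff)+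
    (simp add: power2_eq_square divide_simps)

text \<open>The barrier \<open>K / (1 + x\<^sup>2)\<close> has a derivative at most its own size. Since \<open>c
  \<ge> 2\<close>, the difference of \<open>d\<close> and the barrier satisfies
  \<open>growth_comparison\<close>.\<close>

lemma bounded_solution_decay_upper:
  fixes d d' c :: "real \<Rightarrow> real"
  assumes d: "\<And>x. (d has_real_derivative d' x) (at x)" and bd: "\<And>x. \<bar>d x\<bar> \<le> L"
    and c: "\<And>x. 2 \<le> c x" and e: "\<And>x. \<bar>d' x - c x * d x\<bar> \<le> K / (1 + x\<^sup>2)"
  shows "d x \<le> K / (1 + x\<^sup>2)"
proof -
  have K: "0 \<le> K"
    using e[of 0] by simp
  let ?B = "\<lambda>x::real. K / (1 + x\<^sup>2)"
  let ?B' = "\<lambda>x::real. - (2 * x * K / (1 + x\<^sup>2)\<^sup>2)"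
  have B: "0 \<le> ?B x" for x using K by simp
  have B': "\<bar>?B' x\<bar> \<le> ?B x" for x
  proof -
    have "2 * \<bar>x\<bar> \<le> 1 + x\<^sup>2"
      using zero_le_power2[of "\<bar>x\<bar> - 1"] by (simp add: power2_eq_square algebra_simps)
    then have "2 * \<bar>x\<bar> * K / (1 + x\<^sup>2)\<^sup>2
        \<le> (1 + x\<^sup>2) * K / (1 + x\<^sup>2)\<^sup>2"
      using K by (intro divide_right_mono mult_right_mono) auto
    also have "\<dots> = ?B x" by (simp add: power2_eq_square)
    finally show ?thesis using K by (simp add: abs_mult)
  qed
  have "d x - ?B x \<le> 0"
  proof (rule growth_comparison[where g="\<lambda>x. d x - ?B x" and g'="\<lambda>x. d' x - ?B' x" and L=L])
    show "((\<lambda>x. d x - ?B x) has_real_derivative d' x - ?B' x) (at x)" for x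
      by (intro DERIV_diff d DERIV_quotient_one_plus_square)
    show "d x - ?B x \<le> L" for x using bd[of x] B[of x] by linarith
    show "d x - ?B x \<le> d' x - ?B' x" if "0 < d x - ?B x" for x
    proof -
      have "2 * d x \<le> c x * d x" using c[of x] that B[of x] by (intro mult_right_mono) linarith+
      then show ?thesis using e[of x] that B[of x] B'[of x] by linarith
    qed
  qed
  then show ?thesis by simp
qed

lemma bounded_solution_decay:
  fixes d d' c :: "real \<Rightarrow> real"
  assumes d: "\<And>x. (d has_real_derivative d' x) (at x)" and bd: "\<And>x. \<bar>d x\<bar> \<le> L"
    and c: "\<And>x. 2 \<le> c x" and e: "\<And>x. \<bar>d' x - c x * d x\<bar> \<le> K / (1 + x\<^sup>2)"
  shows "\<bar>d x\<bar> \<le> K / (1 + x\<^sup>2)"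
proof -
  have "- d x \<le> K / (1 + x\<^sup>2)"
  proof (rule bounded_solution_decay_upper[of "\<lambda>x. - d x" "\<lambda>x. - d' x" L c K])
    show "\<bar>- d' x - c x * - d x\<bar> \<le> K / (1 + x\<^sup>2)" for x
      using e[of x] by (simp add: abs_minus_commute)
  qed (use assms in \<open>auto intro: DERIV_minus\<close>)
  moreover have "d x \<le> K / (1 + x\<^sup>2)"
    by (rule bounded_solution_decay_upper[OF d bd c e])
  ultimately show ?thesis by linarith
qed

lemma bounded_solution_bound:
  fixes d f :: "real \<Rightarrow> real"
  assumes d: "\<And>x. (d has_real_derivative a * d x - f x) (at x)" and bd: "\<And>x. \<bar>d x\<bar> \<le> L"
    and a: "1 < a" and f: "\<And>x. \<bar>f x\<bar> \<le> M"
  shows "\<bar>d x\<bar> \<le> M / (a - 1)"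
proof -
  have M: "0 \<le> M" using f[of 0] by linarith
  then have M': "0 \<le> M / (a - 1)" using a by simp
  have up: "d x - M / (a - 1) \<le> 0" if d: "\<And>x. (d has_real_derivative a * d x - f x)
      (at x)" and bd: "\<And>x. \<bar>d x\<bar> \<le> L"
    and f: "\<And>x. \<bar>f x\<bar> \<le> M" for d f x
  proof (rule growth_comparison[where g="\<lambda>x. d x - M / (a - 1)" and g'="\<lambda>x. a * d x
      - f x" and L=L])
    show "((\<lambda>x. d x - M / (a - 1)) has_real_derivative a * d x - f x) (at x)" for x
      using DERIV_diff[OF d DERIV_const] by simp
    show "d x - M / (a - 1) \<le> L" for x using bd[of x] M' by linarith
    show "d x - M / (a - 1) \<le> a * d x - f x" if "0 < d x - M / (a - 1)" for x
    proof -
      have "M \<le> (a - 1) * d x" using that a by (simp add: field_simps)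
      then show ?thesis using f[of x] M' by (simp add: algebra_simps)
    qed
  qed
  have "- d x - M / (a - 1) \<le> 0"
    by (rule up[of "\<lambda>x. - d x" "\<lambda>x. - f x"]) (use bd f DERIV_minus[OF d] in auto)
  with up[OF d bd f] show ?thesis by (simp add: abs_le_iff)
qed

section \<open>Inverting a - d/dx on bounded functions\<close>

lemma antiderivative_exists:
  fixes f :: "real \<Rightarrow> real"
  assumes "continuous_on UNIV f"
  obtains F where "\<And>x. (F has_real_derivative f x) (at x)"
  using einterval_antiderivative[of "-\<infinity>" "\<infinity>" f] assms
  by (auto simp: continuous_on_eq_continuous_at has_real_derivative_iff_has_vector_derivative)

text \<open>The solution is \<open>exp (a x) * (J - I x)\<close>, where \<open>I\<close> is an antiderivative of
  \<open>exp (- a x) * f x\<close> and \<open>J\<close> its limit at \<open>+\<infinity>\<close>. An increasing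
  \<open>P\<close> and a decreasing \<open>Q\<close> enclose \<open>I\<close>; taking \<open>J\<close> as the
  supremum of \<open>P\<close> replaces the improper integral and yields the bound on the solution at
  once.\<close>

lemma bounded_solution_exists:
  fixes f :: "real \<Rightarrow> real"
  assumes a: "0 < a" and f: "continuous_on UNIV f" "\<And>x. \<bar>f x\<bar> \<le> L"
  obtains v where "\<And>x. (v has_real_derivative a * v x - f x) (at x)" "\<And>x. \<bar>v x\<bar> \<le> L / a"
proof -
  have "continuous_on UNIV (\<lambda>x. exp (- a * x) * f x)"
    by (intro continuous_intros f)
  then obtain I where I: "\<And>x. (I has_real_derivative exp (- a * x) * f x) (at x)"
    using antiderivative_exists by blast
  define P where "P x = I x - (L / a) * exp (- a * x)" for x
  define Q where "Q x = I x + (L / a) * exp (- a * x)" for x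
  have L: "0 \<le> L" using f(2)[of 0] by linarith
  have dP: "(P has_real_derivative exp (- a * x) * (f x + L)) (at x)" for x
    unfolding P_def by (rule derivative_eq_intros I refl | use a in \<open>simp add: algebra_simps\<close>)+
  have dQ: "(Q has_real_derivative exp (- a * x) * (f x - L)) (at x)" for x
    unfolding Q_def by (rule derivative_eq_intros I refl | use a in \<open>simp add: algebra_simps\<close>)+
  have fL: "- L \<le> f x" "f x \<le> L" for x using f(2)[of x] by linarith+
  have P_mono: "P x \<le> P y" if "x \<le> y" for x y
  proof (rule DERIV_nonneg_imp_nondecreasing[OF that])
    fix z
    have "0 \<le> exp (- a * z) * (f z + L)" using fL(1)[of z] by (intro mult_nonneg_nonneg) auto
    then show "\<exists>y. DERIV P z :> y \<and> 0 \<le> y" using dP[of z] by (intro exI conjI)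
  qed
  have Q_mono: "Q y \<le> Q x" if "x \<le> y" for x y
  proof (rule DERIV_nonpos_imp_nonincreasing[OF that])
    fix z
    have "exp (- a * z) * (f z - L) \<le> 0" using fL(2)[of z] by (intro mult_nonneg_nonpos) auto
    then show "\<exists>y. DERIV Q z :> y \<and> y \<le> 0" using dQ[of z] by (intro exI conjI)
  qed
  have PQ: "P x \<le> Q x" for x
    using L a by (simp add: P_def Q_def)
  have PQ': "P x \<le> Q y" for x y
    using P_mono[of x y] Q_mono[of y x] PQ[of x] PQ[of y] by linarith
  define J where "J = (SUP x. P x)"
  have PJ: "P x \<le> J" and JQ: "J \<le> Q x" for x
    unfolding J_def using PQ' by (auto intro!: cSUP_upper cSUP_least bdd_aboveI2[of _ _ "Q 0"])
  define v where "v x = exp (a * x) * (J - I x)" for x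
  have "(v has_real_derivative a * v x - f x) (at x)" for x
  proof -
    have "exp (a * x) * exp (- (a * x)) = 1" by (simp flip: exp_add)
    then have e: "f x * (exp (a * x) * exp (- (a * x))) = f x" by simp
    show ?thesis unfolding v_def
      by (rule derivative_eq_intros I refl)+ (use e in \<open>simp add: algebra_simps\<close>)
  qed
  moreover have "\<bar>v x\<bar> \<le> L / a" for x
  proof -
    have "\<bar>J - I x\<bar> \<le> (L / a) * exp (- a * x)"
      using PJ[of x] JQ[of x] by (simp add: P_def Q_def abs_le_iff)
    then have "exp (a * x) * \<bar>J - I x\<bar> \<le> exp (a * x) * ((L / a) * exp (- a * x))"
      by (rule mult_left_mono) simp
    also have "\<dots> = (L / a) * (exp (a * x) * exp (- (a * x)))" by simp
    also have "\<dots> = L / a" by (simp flip: exp_add)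
    finally show ?thesis by (simp add: v_def abs_mult)
  qed
  ultimately show ?thesis by (rule that)
qed

section \<open>Sine and hyperbolic sine near 0\<close>

text \<open>One notation for both signs of the nonlinearity: in either case \<open>sn' = cs\<close> and
  \<open>cs' = - \<sigma> * sn\<close>.\<close>

definition sn :: "real \<Rightarrow> real \<Rightarrow> real" where
  "sn \<sigma> y = (if \<sigma> = 1 then sin y else sinh y)"

definition cs :: "real \<Rightarrow> real \<Rightarrow> real" where
  "cs \<sigma> y = (if \<sigma> = 1 then cos y else cosh y)"

text \<open>The primitive of \<open>sn\<close> that vanishes at 0. The factor \<open>\<sigma>\<close> makes it
  nonnegative for both signs.\<close>

definition vers :: "real \<Rightarrow> real \<Rightarrow> real" where
  "vers \<sigma> y = \<sigma> * (1 - cs \<sigma> y)"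

lemma sn_0 [simp]: "sn \<sigma> 0 = 0" by (simp add: sn_def)
lemma cs_0 [simp]: "cs \<sigma> 0 = 1" by (simp add: cs_def)
lemma vers_0 [simp]: "vers \<sigma> 0 = 0" by (simp add: vers_def)

lemma DERIV_sn [derivative_intros]:
  "(f has_real_derivative D) (at x within A) \<Longrightarrow>
      ((\<lambda>x. sn \<sigma> (f x)) has_real_derivative cs \<sigma> (f x) * D) (at x within A)"
  unfolding sn_def cs_def by (cases "\<sigma> = 1") (auto intro!: derivative_eq_intros)

lemma DERIV_cs [derivative_intros]:
  "\<sigma> \<in> {1, -1} \<Longrightarrow> (f has_real_derivative D) (at x within A) \<Longrightarrow>
      ((\<lambda>x. cs \<sigma> (f x)) has_real_derivative - \<sigma> * sn \<sigma> (f x) * D) (at x within A)"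
  unfolding sn_def cs_def by (auto intro!: derivative_eq_intros)

lemma DERIV_vers [derivative_intros]:
  "\<sigma> \<in> {1, -1} \<Longrightarrow> (f has_real_derivative D) (at x within A) \<Longrightarrow>
      ((\<lambda>x. vers \<sigma> (f x)) has_real_derivative sn \<sigma> (f x) * D) (at x within A)"
  unfolding sn_def cs_def vers_def by (auto intro!: derivative_eq_intros)

lemma cs_sn_squared: "\<sigma> \<in> {1, -1} \<Longrightarrow>
    (cs \<sigma> y)\<^sup>2 = 1 - \<sigma> * (sn \<sigma> y)\<^sup>2"
  by (auto simp: cs_def sn_def cos_squared_eq cosh_square_eq)

lemma sn_squared_vers: "\<sigma> \<in> {1, -1} \<Longrightarrow>
    (sn \<sigma> y)\<^sup>2 = 2 * vers \<sigma> y - \<sigma> * (vers \<sigma> y)\<^sup>2"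
  using cs_sn_squared[of \<sigma> y] by (auto simp: vers_def power2_eq_square algebra_simps)

text \<open>On the interval \<open>[-1/2, 1/2]\<close> this bound makes \<open>sn\<close> a perturbation of the
  identity with relative error 1/4; the estimates for \<open>sn\<close> and \<open>vers\<close> follow from it
  by the mean value theorem.\<close>

lemma abs_cs_minus_1_le:
  assumes "\<bar>y\<bar> \<le> 1/2"
  shows "\<bar>cs \<sigma> y - 1\<bar> \<le> 1/4"
proof (cases "\<sigma> = 1")
  case True
  have "cos y = 1 - 2 * (sin (y / 2))\<^sup>2" using cos_double_sin[of "y / 2"] by simp
  moreover have "(sin (y / 2))\<^sup>2 \<le> (y / 2)\<^sup>2"
    using abs_sin_x_le_abs_x[of "y / 2"] by (simp only: abs_le_square_iff)
  moreover have "(y / 2)\<^sup>2 \<le> (1/4)\<^sup>2"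
    using assms by (subst abs_le_square_iff[symmetric]) auto
  ultimately show ?thesis using True by (simp add: cs_def power2_eq_square abs_if)
next
  case False
  define e where "e = exp \<bar>y\<bar>"
  have e1: "1 \<le> e" by (simp add: e_def)
  have "e\<^sup>2 \<le> exp 1"
    using assms by (simp add: e_def power2_eq_square flip: exp_add)
  also have "\<dots> \<le> 2\<^sup>2" using exp_le by simp
  finally have e2: "e \<le> 2" by (rule power2_le_imp_le) simp
  have "cosh y = (e + inverse e) / 2"
    by (cases "0 \<le> y") (simp_all add: e_def cosh_def flip: exp_minus)
  moreover have "e + inverse e \<le> 5 / 2"
  proof -
    have "(e - 2) * (e - 1 / 2) \<le> 0" using e1 e2 by (intro mult_nonpos_nonneg) auto
    then have "e * e + 1 \<le> 5 / 2 * e" by (simp add: left_diff_distrib right_diff_distrib)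
    then have "(e * e + 1) * inverse e \<le> 5 / 2 * e * inverse e" using e1 by (intro mult_right_mono) auto
    moreover have "(e * e + 1) * inverse e = e + inverse e" "5 / 2 * e * inverse e = 5 / 2"
      using e1 by (simp_all add: distrib_right mult.assoc)
    ultimately show ?thesis by simp
  qed
  moreover have "1 \<le> cosh y" by (rule cosh_real_ge_1)
  ultimately show ?thesis using False by (simp add: cs_def)
qed

lemma sn_minus: "sn \<sigma> (- y) = - sn \<sigma> y" by (simp add: sn_def)
lemma cs_minus: "cs \<sigma> (- y) = cs \<sigma> y" by (simp add: cs_def)
lemma vers_minus: "vers \<sigma> (- y) = vers \<sigma> y" by (simp add: vers_def cs_minus)

lemma sn_mvt:
  assumes "\<bar>a\<bar> \<le> 1/2" "\<bar>b\<bar> \<le> 1/2"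
  obtains z where "\<bar>z\<bar> \<le> 1/2" "sn \<sigma> a - sn \<sigma> b = cs \<sigma> z * (a - b)"
proof -
  consider "a < b" | "a = b" | "b < a" by linarith
  then show ?thesis
  proof cases
    case 1
    obtain z where "a < z" "z < b" "sn \<sigma> b - sn \<sigma> a = (b - a) * cs \<sigma> z"
      using MVT2[OF 1, of "sn \<sigma>" "cs \<sigma>"] DERIV_sn[OF DERIV_ident] by auto
    then show ?thesis using assms by (intro that[of z]) (auto simp: algebra_simps)
  next
    case 2 then show ?thesis using that[of a] assms by simp
  next
    case 3
    obtain z where "b < z" "z < a" "sn \<sigma> a - sn \<sigma> b = (a - b) * cs \<sigma> z"
      using MVT2[OF 3, of "sn \<sigma>" "cs \<sigma>"] DERIV_sn[OF DERIV_ident] by auto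
    then show ?thesis using assms by (intro that[of z]) (auto simp: algebra_simps)
  qed
qed

lemma sn_bounds:
  assumes "0 \<le> y" "y \<le> 1/2"
  shows "3/4 * y \<le> sn \<sigma> y" "sn \<sigma> y \<le> 5/4 * y"
proof -
  obtain z where z: "\<bar>z\<bar> \<le> 1/2" "sn \<sigma> y = cs \<sigma> z * y"
    using sn_mvt[of y 0 \<sigma>] assms by auto
  have cs: "3/4 \<le> cs \<sigma> z" "cs \<sigma> z \<le> 5/4" using abs_cs_minus_1_le[OF z(1), of \<sigma>]
      by linarith+
  show "3/4 * y \<le> sn \<sigma> y" "sn \<sigma> y \<le> 5/4 * y"
    unfolding z(2) by (rule mult_right_mono[OF cs(1) assms(1)], rule mult_right_mono[OF cs(2) assms(1)])
qed

lemma abs_sn_le: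
  assumes "\<bar>y\<bar> \<le> 1/2"
  shows "\<bar>sn \<sigma> y\<bar> \<le> 5/4 * \<bar>y\<bar>" "\<bar>y - sn \<sigma> y\<bar>
      \<le> 1/4 * \<bar>y\<bar>" "3/4 * \<bar>y\<bar> \<le> \<bar>sn \<sigma> y\<bar>"
  using sn_bounds[of y \<sigma>] sn_bounds[of "- y" \<sigma>] assms
      by (auto simp: sn_minus abs_if split: if_splits)

lemma vers_bounds_nonneg:
  assumes \<sigma>: "\<sigma> \<in> {1, -1}" and y: "0 \<le> y" "y \<le> 1/2"
  shows "3/8 * y\<^sup>2 \<le> vers \<sigma> y" "vers \<sigma> y \<le> 5/8 * y\<^sup>2"
proof -
  have "vers \<sigma> 0 - 3/8 * 0\<^sup>2 \<le> vers \<sigma> y - 3/8 * y\<^sup>2"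
  proof (rule DERIV_nonneg_imp_nondecreasing[OF y(1)])
    fix z assume z: "0 \<le> z" "z \<le> y"
    have "((\<lambda>y. vers \<sigma> y - 3/8 * y\<^sup>2) has_real_derivative sn \<sigma> z - 3/4 * z) (at z)"
      using \<sigma> by (auto intro!: derivative_eq_intros)
    then show "\<exists>d. ((\<lambda>y. vers \<sigma> y - 3/8 * y\<^sup>2) has_real_derivative d) (at z)
        \<and> 0 \<le> d"
      using sn_bounds[of z \<sigma>] z y by auto
  qed
  then show "3/8 * y\<^sup>2 \<le> vers \<sigma> y" by simp
  have "vers \<sigma> y - 5/8 * y\<^sup>2 \<le> vers \<sigma> 0 - 5/8 * 0\<^sup>2"
  proof (rule DERIV_nonpos_imp_nonincreasing[OF y(1)])
    fix z assume z: "0 \<le> z" "z \<le> y"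
    have "((\<lambda>y. vers \<sigma> y - 5/8 * y\<^sup>2) has_real_derivative sn \<sigma> z - 5/4 * z) (at z)"
      using \<sigma> by (auto intro!: derivative_eq_intros)
    then show "\<exists>d. ((\<lambda>y. vers \<sigma> y - 5/8 * y\<^sup>2) has_real_derivative d) (at z)
        \<and> d \<le> 0"
      using sn_bounds[of z \<sigma>] z y by auto
  qed
  then show "vers \<sigma> y \<le> 5/8 * y\<^sup>2" by simp
qed

lemma vers_bounds:
  assumes "\<sigma> \<in> {1, -1}" "\<bar>y\<bar> \<le> 1/2"
  shows "3/8 * y\<^sup>2 \<le> vers \<sigma> y" "vers \<sigma> y \<le> 5/8 * y\<^sup>2"
  using vers_bounds_nonneg[OF assms(1), of "\<bar>y\<bar>"] assms(2) vers_minus[of \<sigma> y]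
  by (auto simp: abs_if split: if_splits)

lemma sn_diff_le:
  assumes "\<bar>a\<bar> \<le> 1/2" "\<bar>b\<bar> \<le> 1/2"
  shows "\<bar>(a - sn \<sigma> a) - (b - sn \<sigma> b)\<bar> \<le> 1/4 * \<bar>a - b\<bar>"
proof -
  obtain z where z: "\<bar>z\<bar> \<le> 1/2" "sn \<sigma> a - sn \<sigma> b = cs \<sigma> z * (a - b)"
    using sn_mvt[OF assms] by blast
  have "(a - sn \<sigma> a) - (b - sn \<sigma> b) = (1 - cs \<sigma> z) * (a - b)"
    using z(2) by (simp add: algebra_simps)
  moreover have "\<bar>1 - cs \<sigma> z\<bar> * \<bar>a - b\<bar> \<le> 1/4 * \<bar>a - b\<bar>"
    using abs_cs_minus_1_le[OF z(1), of \<sigma>]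
    by (intro mult_right_mono) (simp_all add: abs_minus_commute)
  ultimately show ?thesis by (simp only: abs_mult)
qed

lemma continuous_on_sn [continuous_intros]: "continuous_on A (f :: real \<Rightarrow> real)
    \<Longrightarrow> continuous_on A (\<lambda>x. sn \<sigma> (f x))"
  unfolding sn_def by (cases "\<sigma> = 1") (simp_all add: continuous_on_sin continuous_on_sinh)

lemma continuous_on_cs [continuous_intros]: "continuous_on A (f :: real \<Rightarrow> real)
    \<Longrightarrow> continuous_on A (\<lambda>x. cs \<sigma> (f x))"
  unfolding cs_def by (cases "\<sigma> = 1") (simp_all add: continuous_on_cos continuous_on_cosh)

lemma continuous_on_vers [continuous_intros]: "continuous_on A (f :: real \<Rightarrow> real)
    \<Longrightarrow> continuous_on A (\<lambda>x. vers \<sigma> (f x))"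
  unfolding vers_def by (intro continuous_intros)

section \<open>The angle of a potential\<close>

text \<open>The angle is the fixed point of \<open>\<phi> \<mapsto> v + Z\<close>, where \<open>Z\<close> is the
  bounded solution of \<open>Z' = 2\<kappa> Z - 2\<kappa> (\<phi> - sn \<sigma> \<phi>)\<close>. On functions
  bounded by 1/2 this is a contraction, because \<open>\<phi> - sn \<sigma> \<phi>\<close> has Lipschitz
  constant 1/4 there and solving for \<open>Z\<close> costs a factor of at most \<open>2\<kappa> / (2\<kappa> -
  1) \<le> 4/3\<close>.\<close>

lemma angle_exists:
  fixes U v :: "real \<Rightarrow> real"
  assumes k: "2 \<le> \<kappa>" and v: "\<And>x. (v has_real_derivative 2 * \<kappa> * v x - U x)
      (at x)" "\<And>x. \<bar>v x\<bar> \<le> 1/4"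
  obtains \<phi> where "\<And>x. (\<phi> has_real_derivative 2 * \<kappa> * sn \<sigma> (\<phi> x) - U x)
      (at x)" "\<And>x. \<bar>\<phi> x\<bar> \<le> 1/2"
proof -
  define a where "a = 2 * \<kappa>"
  have a: "4 \<le> a" using k by (simp add: a_def)
  define N where "N f Z \<longleftrightarrow> (\<forall>x. (Z has_real_derivative a * Z x - a * (f x
      - sn \<sigma> (f x))) (at x))
    \<and> (\<forall>x. \<bar>Z x\<bar> \<le> 1/4)" for f Z :: "real \<Rightarrow> real"
  define B where "B = (cball 0 (1/2) :: (real \<Rightarrow>\<^sub>C real) set)"
  have Bb: "\<bar>apply_bcontfun f x\<bar> \<le> 1/2" if "f \<in> B" for f x
    using norm_bounded[of f x] that by (simp add: B_def)
  have ex: "\<exists>Z. N (apply_bcontfun f) Z" if f: "f \<in> B" for f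
  proof -
    have ct: "continuous_on UNIV (\<lambda>x. a * (f x - sn \<sigma> (f x)))"
      by (intro continuous_intros) auto
    have bd: "\<bar>a * (f x - sn \<sigma> (f x))\<bar> \<le> a / 4" for x
    proof -
      have "\<bar>f x - sn \<sigma> (f x)\<bar> \<le> 1/4"
        using abs_sn_le(2)[OF Bb[OF f], of x \<sigma>] Bb[OF f, of x] by linarith
      then have "a * \<bar>f x - sn \<sigma> (f x)\<bar> \<le> a * (1/4)" using a by (intro mult_left_mono) auto
      then show ?thesis using a by (simp add: abs_mult)
    qed
    have "0 < a" using a by simp
    from bounded_solution_exists[OF this ct bd]
    obtain Z where Z: "\<And>x. (Z has_real_derivative a * Z x - a * (f x - sn \<sigma> (f x))) (at x)"
        "\<And>x. \<bar>Z x\<bar> \<le> a / 4 / a"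
      by blast
    have "\<bar>Z x\<bar> \<le> 1/4" for x using Z(2)[of x] a by (simp split: if_splits)
    then have "N (apply_bcontfun f) Z" using Z(1) by (simp add: N_def)
    then show ?thesis by blast
  qed
  then obtain ZZ where ZZ: "\<And>f. f \<in> B \<Longrightarrow> N (apply_bcontfun f) (ZZ f)" by metis
  define T where "T f = Bcontfun (\<lambda>x. v x + ZZ f x)" for f
  have T: "apply_bcontfun (T f) x = v x + ZZ f x" if "f \<in> B" for f x
  proof -
    have "continuous_on UNIV (\<lambda>x. v x + ZZ f x)"
      using ZZ[OF that] v(1) unfolding N_def
      by (intro continuous_on_add DERIV_continuous_on_UNIV) blast+
    moreover have "norm (v x + ZZ f x) \<le> 1" for x
    proof -
      have "\<bar>ZZ f x\<bar> \<le> 1/4" using ZZ[OF that] by (auto simp: N_def)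
      then show ?thesis using v(2)[of x] unfolding real_norm_def by linarith
    qed
    ultimately have "(\<lambda>x. v x + ZZ f x) \<in> bcontfun" by (rule bcontfun_normI)
    then show ?thesis by (simp add: T_def Bcontfun_inverse)
  qed
  have TB: "T f \<in> B" if "f \<in> B" for f
  proof -
    have "norm (T f) \<le> 1/2"
    proof (rule norm_bound)
      fix x
      have "\<bar>ZZ f x\<bar> \<le> 1/4" using ZZ[OF that] by (auto simp: N_def)
      then show "norm (apply_bcontfun (T f) x) \<le> 1/2"
        using v(2)[of x] unfolding T[OF that] real_norm_def by linarith
    qed
    then show ?thesis by (simp add: B_def)
  qed
  have contr: "dist (T f) (T g) \<le> 1/2 * dist f g" if f: "f \<in> B" and g: "g \<in> B" for f g
  proof (rule dist_bound)
    fix x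
    let ?w = "\<lambda>x. a * (f x - sn \<sigma> (f x)) - a * (g x - sn \<sigma> (g x))"
    have "\<bar>ZZ f x - ZZ g x\<bar> \<le> (a * (1/4 * dist f g)) / (a - 1)"
    proof (rule bounded_solution_bound[where d="\<lambda>x. ZZ f x - ZZ g x" and f="?w" and L="1/2"])
      show "((\<lambda>x. ZZ f x - ZZ g x) has_real_derivative a * (ZZ f x - ZZ g x) - ?w x) (at x)" for x
      proof -
        have "((\<lambda>x. ZZ f x - ZZ g x) has_real_derivative
            (a * ZZ f x - a * (f x - sn \<sigma> (f x))) - (a * ZZ g x - a * (g x - sn \<sigma> (g x)))) (at x)"
          using ZZ[OF f] ZZ[OF g] by (intro DERIV_diff) (auto simp: N_def)
        then show ?thesis by (simp only: algebra_simps)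
      qed
      show "\<bar>ZZ f x - ZZ g x\<bar> \<le> 1/2" for x
      proof -
        have "\<bar>ZZ f x\<bar> \<le> 1/4" "\<bar>ZZ g x\<bar> \<le> 1/4" using ZZ[OF f] ZZ[OF g]
            by (auto simp: N_def)
        then show ?thesis by linarith
      qed
      show "1 < a" using a by simp
      show "\<bar>?w x\<bar> \<le> a * (1/4 * dist f g)" for x
      proof -
        have "\<bar>f x - g x\<bar> \<le> dist f g" using dist_bounded[of f x g] by (simp add: dist_real_def)
        then have "\<bar>(f x - sn \<sigma> (f x)) - (g x - sn \<sigma> (g x))\<bar> \<le> 1/4 * dist f g"
          by (intro order_trans[OF sn_diff_le[OF Bb[OF f, of x] Bb[OF g, of x],
              of \<sigma>]] mult_left_mono) auto
        then have "a * \<bar>(f x - sn \<sigma> (f x)) - (g x - sn \<sigma> (g x))\<bar>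
            \<le> a * (1/4 * dist f g)"
          using a by (intro mult_left_mono) auto
        moreover have "?w x = a * ((f x - sn \<sigma> (f x)) - (g x - sn \<sigma> (g x)))"
            by (simp add: algebra_simps)
        ultimately show ?thesis using a by (simp only: abs_mult abs_of_nonneg)
      qed
    qed
    also have "\<dots> \<le> 1/2 * dist f g"
    proof -
      have "a / (4 * (a - 1)) \<le> 1/2" using a by (simp add: divide_le_eq)
      then have "a / (4 * (a - 1)) * dist f g \<le> 1/2 * dist f g" by (intro mult_right_mono) auto
      then show ?thesis by simp
    qed
    finally show "dist (apply_bcontfun (T f) x) (apply_bcontfun (T g) x) \<le> 1/2 * dist f g"
      by (simp add: T f g dist_real_def)
  qed
  have "closed B" "B \<noteq> {}" by (auto simp: B_def)
  then have "\<exists>!f\<in>B. T f = f"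
    using Banach_fix[of B "1/2" T] TB contr by (auto simp: complete_eq_closed)
  then obtain f where f: "f \<in> B" "T f = f" by blast
  have fx: "v x + ZZ f x = f x" for x using T[OF f(1), of x] f(2) by simp
  have "(f has_real_derivative 2 * \<kappa> * sn \<sigma> (f x) - U x) (at x)" for x
  proof -
    have "((\<lambda>x. v x + ZZ f x) has_real_derivative (2 * \<kappa> * v x - U x)
        + (a * ZZ f x - a * (f x - sn \<sigma> (f x)))) (at x)"
      using ZZ[OF f(1)] v(1) by (intro DERIV_add) (auto simp: N_def)
    moreover have "(2 * \<kappa> * v x - U x) + (a * ZZ f x - a * (f x - sn \<sigma> (f x)))
      = a * (v x + ZZ f x) - a * f x + a * sn \<sigma> (f x) - U x"
      by (simp only: a_def algebra_simps)
    moreover have "\<dots> = 2 * \<kappa> * sn \<sigma> (f x) - U x" unfolding fx by (simp add: a_def)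
    ultimately show ?thesis unfolding fx by (simp only:)
  qed
  then show ?thesis using that Bb[OF f(1)] by blast
qed

section \<open>Energy estimates at a fixed time\<close>

lemma two_mult_le_sum_squares: "2 * (a * b) \<le> a\<^sup>2 + (b::real)\<^sup>2"
  using zero_le_power2[of "a - b"] by (simp add: power2_eq_square algebra_simps)

lemma decaying_square_integrable: "decaying f \<Longrightarrow> integrable lborel (\<lambda>x. (f x)\<^sup>2)"
  by (intro decaying_integrable decaying_power) auto

text \<open>Multiply the equation by \<open>e\<close> and integrate: the left-hand side is an exact derivative,
  so \<open>\<integral>e\<^sup>2 = \<integral>e r\<close>.\<close>

lemma resolvent_L2_bound:
  assumes e: "\<And>x. (e has_real_derivative a * e x - a * r x) (at x)" and a: "0 < a"
    and dec: "decaying e" "decaying r"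
  shows "L2sq e \<le> (LINT x|lborel. (r x)\<^sup>2)"
proof -
  have "((\<lambda>x. (e x)\<^sup>2) has_real_derivative 2 * a * ((e x)\<^sup>2 - e x * r x)) (at x)" for x
    by (rule derivative_eq_intros e refl)+ (simp add: power2_eq_square algebra_simps)
  moreover have i: "decaying (\<lambda>x. (e x)\<^sup>2)" "decaying (\<lambda>x.
      e x * r x)" "decaying (\<lambda>x. (r x)\<^sup>2)"
    using dec by (auto intro: decaying_mult decaying_power)
  moreover have "decaying (\<lambda>x. 2 * a * ((e x)\<^sup>2 - e x * r x))"
    by (intro decaying_cmult decaying_diff i)
  ultimately have "(LINT x|lborel. 2 * a * ((e x)\<^sup>2 - e x * r x)) = 0"
    by (intro decaying_integral_derivative)
  then have eq: "L2sq e = (LINT x|lborel. e x * r x)"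
    using a i[THEN decaying_integrable] by simp
  have "2 * (LINT x|lborel. e x * r x) = (LINT x|lborel. 2 * (e x * r x))" by simp
  also have "\<dots> \<le> (LINT x|lborel. (e x)\<^sup>2 + (r x)\<^sup>2)"
    using i[THEN decaying_integrable] two_mult_le_sum_squares
    by (intro integral_mono Bochner_Integration.integrable_add integrable_mult_right) auto
  also have "\<dots> = L2sq e + (LINT x|lborel. (r x)\<^sup>2)"
    using i[THEN decaying_integrable] by (intro Bochner_Integration.integral_add)
  finally show ?thesis using eq by simp
qed

lemma L2_triangle:
  assumes "decaying f" "decaying g"
  shows "L2sq f \<le> 2 * L2sq g + 2 * (LINT x|lborel. (f x - g x)\<^sup>2)"
proof -
  note i = assms[THEN decaying_square_integrable] decaying_square_integrable[OF decaying_diff[OF assms]]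
  have "L2sq f \<le> (LINT x|lborel. 2 * (g x)\<^sup>2 + 2 * (f x - g x)\<^sup>2)"
  proof (rule integral_mono)
    show "(f x)\<^sup>2 \<le> 2 * (g x)\<^sup>2 + 2 * (f x - g x)\<^sup>2" for x
      using zero_le_power2[of "f x - 2 * g x"] by (simp add: power2_eq_square algebra_simps)
  qed (use i in auto)
  then show ?thesis using i by simp
qed

lemma L2_comparable:
  assumes dec: "decaying f" "decaying g"
    and e: "(LINT x|lborel. (f x - g x)\<^sup>2) \<le> L2sq r"
    and r: "decaying r" "\<And>x. \<bar>r x\<bar> \<le> 1/4 * \<bar>f x\<bar>"
  shows "L2sq f \<le> 3 * L2sq g" "L2sq g \<le> 3 * L2sq f"
proof -
  have "L2sq r \<le> (LINT x|lborel. 1/16 * (f x)\<^sup>2)"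
  proof (rule integral_mono)
    show "(r x)\<^sup>2 \<le> 1/16 * (f x)\<^sup>2" for x
    proof -
      have "(\<bar>r x\<bar>)\<^sup>2 \<le> (1/4 * \<bar>f x\<bar>)\<^sup>2" using r(2)
          by (intro power_mono) auto
      then show ?thesis by (simp add: power2_eq_square)
    qed
  qed (use decaying_square_integrable dec r(1) in auto)
  then have "(LINT x|lborel. (f x - g x)\<^sup>2) \<le> 1/16 * L2sq f" using e by simp
  moreover have "0 \<le> L2sq f" "0 \<le> L2sq g" by simp_all
  ultimately show "L2sq f \<le> 3 * L2sq g" "L2sq g \<le> 3 * L2sq f"
    using L2_triangle[OF dec] L2_triangle[OF dec(2,1)] unfolding power2_commute[of "g _"] by linarith+
qed

text \<open>For \<open>\<sigma> = 1\<close>, \<open>tan (\<phi>/2)\<close> is the quotient \<open>\<psi>2 /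
  \<psi>1\<close> for the solution of the Zakharov-Shabat system \<open>\<psi>1' = - \<kappa> \<psi>1 + (U/2)
  \<psi>2\<close>, \<open>\<psi>2' = - (U/2) \<psi>1 + \<kappa> \<psi>2\<close> that decays at
  \<open>+\<infinity>\<close>. For \<open>\<sigma> = -1\<close> the hyperbolic tangent takes the place of the
  tangent, up to signs.\<close>

definition is_angle :: "real \<Rightarrow> real \<Rightarrow> (real \<Rightarrow> real) \<Rightarrow> (real
    \<Rightarrow> real) \<Rightarrow> bool" where
  "is_angle \<sigma> \<kappa> U \<phi> \<longleftrightarrow> (\<forall>x.
      (\<phi> has_real_derivative 2 * \<kappa> * sn \<sigma> (\<phi> x) - U x) (at x))
      \<and> (\<forall>x. \<bar>\<phi> x\<bar> \<le> 1/2)"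

lemma is_angle_DERIV: "is_angle \<sigma> \<kappa> U \<phi> \<Longrightarrow>
    (\<phi> has_real_derivative 2 * \<kappa> * sn \<sigma> (\<phi> x) - U x) (at x)"
  and is_angle_bound: "is_angle \<sigma> \<kappa> U \<phi> \<Longrightarrow> \<bar>\<phi> x\<bar> \<le> 1/2"
  by (auto simp: is_angle_def)

lemma is_angle_continuous: "is_angle \<sigma> \<kappa> U \<phi> \<Longrightarrow> continuous_on UNIV \<phi>"
  by (rule DERIV_continuous_on_UNIV[OF is_angle_DERIV])

text \<open>The quotient \<open>sn \<sigma> \<phi> / \<phi>\<close> is at least 3/4, so \<open>\<phi>\<close>
  solves a linear equation with coefficient at least 3.\<close>

lemma is_angle_decay:
  assumes k: "2 \<le> \<kappa>" and \<phi>: "is_angle \<sigma> \<kappa> U \<phi>" and U: "\<And>x.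
      \<bar>U x\<bar> \<le> K / (1 + x\<^sup>2)"
  shows "\<bar>\<phi> x\<bar> \<le> K / (1 + x\<^sup>2)"
proof (rule bounded_solution_decay[where d=\<phi>])
  let ?c = "\<lambda>x. if \<phi> x = 0 then 2 else 2 * \<kappa> * (sn \<sigma> (\<phi> x) / \<phi> x)"
  show "2 \<le> ?c x" for x
  proof (cases "\<phi> x = 0")
    case False
    obtain z where z: "\<bar>z\<bar> \<le> 1/2" "sn \<sigma> (\<phi> x) = cs \<sigma> z * \<phi> x"
      using sn_mvt[of "\<phi> x" 0 \<sigma>] is_angle_bound[OF \<phi>, of x] by auto
    have "3/4 \<le> cs \<sigma> z" using abs_cs_minus_1_le[OF z(1), of \<sigma>] by linarith
    then have "3/4 \<le> sn \<sigma> (\<phi> x) / \<phi> x" using False unfolding z(2) by simp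
    then have "2 * (3/4) \<le> \<kappa> * (sn \<sigma> (\<phi> x) / \<phi> x)" using k by (intro mult_mono) auto
    then have "2 \<le> 2 * (\<kappa> * (sn \<sigma> (\<phi> x) / \<phi> x))" by linarith
    then show ?thesis using False by (simp only: if_False mult.assoc)
  qed simp
  show "\<bar>\<phi> x\<bar> \<le> 1/2" for x using \<phi> by (rule is_angle_bound)
  show "\<bar>2 * \<kappa> * sn \<sigma> (\<phi> x) - U x - ?c x * \<phi> x\<bar>
      \<le> K / (1 + x\<^sup>2)" for x
    using U[of x] by (cases "\<phi> x = 0") auto
qed (use \<phi> in \<open>auto simp: is_angle_def\<close>)

lemma is_angle_decaying:
  assumes "2 \<le> \<kappa>" "is_angle \<sigma> \<kappa> U \<phi>" "decaying U"
  shows "decaying \<phi>"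
proof -
  obtain K where "\<And>x. \<bar>U x\<bar> \<le> K / (1 + x\<^sup>2)" using assms(3) decayingE by blast
  from is_angle_decay[OF assms(1,2) this] show ?thesis
    by (intro decayingI[of _ K] is_angle_continuous[OF assms(2)])
qed

lemma decaying_resolvent:
  assumes a: "2 \<le> a" and v: "\<And>x. (v has_real_derivative a * v x - U x)
      (at x)" "\<And>x. \<bar>v x\<bar> \<le> L"
    and U: "decaying U"
  shows "decaying v"
proof -
  obtain K where K: "\<And>x. \<bar>U x\<bar> \<le> K / (1 + x\<^sup>2)" using U decayingE by blast
  have "\<bar>v x\<bar> \<le> K / (1 + x\<^sup>2)" for x
    by (rule bounded_solution_decay[OF v, where c="\<lambda>_. a"]) (use a K in auto)
  then show ?thesis by (intro decayingI[of _ K] DERIV_continuous_on_UNIV[OF v(1)])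
qed

lemma decaying_sn: "decaying \<phi> \<Longrightarrow> (\<And>x. \<bar>\<phi> x\<bar>
    \<le> 1/2) \<Longrightarrow> decaying (\<lambda>x. sn \<sigma> (\<phi> x))"
  by (rule decaying_mono[of \<phi> _ "5/4"])
    (simp_all add: abs_sn_le(1)[simplified] continuous_on_sn decaying_continuous)

lemma decaying_vers:
  assumes "\<sigma> \<in> {1, -1}" "decaying \<phi>" "\<And>x. \<bar>\<phi> x\<bar> \<le> 1/2"
  shows "decaying (\<lambda>x. vers \<sigma> (\<phi> x))"
proof (rule decaying_mono[of "\<lambda>x. (\<phi> x)\<^sup>2" _ "5/8"])
  show "\<bar>vers \<sigma> (\<phi> x)\<bar> \<le> 5/8 * \<bar>(\<phi> x)\<^sup>2\<bar>" for x
    using vers_bounds[OF assms(1) assms(3), of x] zero_le_power2[of "\<phi> x"] by (simp add: abs_le_iff)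
qed (use assms in \<open>auto intro: decaying_power continuous_on_vers decaying_continuous\<close>)

text \<open>Up to sign, \<open>\<kappa>\<close> times the charge is the logarithm of the transmission
  coefficient of the Zakharov-Shabat system at the spectral parameter \<open>\<i>\<kappa>\<close>.\<close>

definition charge :: "real \<Rightarrow> (real \<Rightarrow> real) \<Rightarrow> real" where
  "charge \<sigma> \<phi> = (LINT x|lborel. vers \<sigma> (\<phi> x))"

text \<open>The function \<open>v\<close> solves the linearisation of the angle equation at 0. It has an
  explicit Fourier transform, and the angle \<open>\<phi>\<close> has a conserved charge; the estimates here
  pass from one to the other.\<close>

locale angle =
  fixes \<sigma> \<kappa> :: real and U U' v \<phi> :: "real \<Rightarrow> real"
  assumes \<sigma>: "\<sigma> \<in> {1, -1}" and \<kappa>: "2 \<le> \<kappa>"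
    and U: "decaying U" and U': "\<And>x. (U has_real_derivative U' x) (at x)" "decaying U'"
    and v: "\<And>x. (v has_real_derivative 2 * \<kappa> * v x - U x) (at x)" "decaying v"
    and \<phi>: "is_angle \<sigma> \<kappa> U \<phi>"
begin

definition "\<phi>x x = 2 * \<kappa> * sn \<sigma> (\<phi> x) - U x"
definition "vx x = 2 * \<kappa> * v x - U x"

lemma D\<phi>: "(\<phi> has_real_derivative \<phi>x x) (at x)" using is_angle_DERIV[OF \<phi>]
    by (simp add: \<phi>x_def)
lemma Dv: "(v has_real_derivative vx x) (at x)" using v(1) by (simp add: vx_def)
lemma b\<phi>: "\<bar>\<phi> x\<bar> \<le> 1/2" using \<phi> by (rule is_angle_bound)
lemma dec\<phi>: "decaying \<phi>" using \<kappa> \<phi> U by (rule is_angle_decaying)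
lemma dec_sn: "decaying (\<lambda>x. sn \<sigma> (\<phi> x))" using dec\<phi> b\<phi> by (rule decaying_sn)
lemma dec_vers: "decaying (\<lambda>x. vers \<sigma> (\<phi> x))" using \<sigma> dec\<phi> b\<phi>
    by (rule decaying_vers)
lemma dec\<phi>x: "decaying \<phi>x" unfolding \<phi>x_def by (intro decaying_diff decaying_cmult dec_sn U)
lemma decvx: "decaying vx" unfolding vx_def by (intro decaying_diff decaying_cmult v U)

lemma D\<phi>x: "(\<phi>x has_real_derivative 2 * \<kappa> * cs \<sigma> (\<phi> x) * \<phi>x x - U' x) (at x)"
  unfolding \<phi>x_def[abs_def] by (rule derivative_eq_intros D\<phi>[unfolded \<phi>x_def] U' refl)+ simp

lemma Dvx: "(vx has_real_derivative 2 * \<kappa> * vx x - U' x) (at x)"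
  unfolding vx_def[abs_def] by (rule derivative_eq_intros v U' refl)+ simp

text \<open>The difference \<open>e = \<phi> - v\<close> solves \<open>e' = 2\<kappa> e - 2\<kappa> r\<close>
  with \<open>r = \<phi> - sn \<sigma> \<phi>\<close>, and \<open>\<bar>r\<bar> \<le>
  \<bar>\<phi>\<bar>/4\<close>.\<close>

lemma L2_angle_linear:
  "L2sq \<phi> \<le> 3 * (LINT x|lborel. (v x)\<^sup>2)"
  "L2sq v \<le> 3 * (LINT x|lborel. (\<phi> x)\<^sup>2)"
proof -
  let ?r = "\<lambda>x. \<phi> x - sn \<sigma> (\<phi> x)"
  have r: "decaying ?r" by (intro decaying_diff dec\<phi> dec_sn)
  have "(LINT x|lborel. (\<phi> x - v x)\<^sup>2) \<le> (LINT x|lborel. (?r x)\<^sup>2)"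
  proof (rule resolvent_L2_bound[where a = "2 * \<kappa>"])
    show "((\<lambda>x. \<phi> x - v x) has_real_derivative 2 * \<kappa> * (\<phi> x - v x)
        - 2 * \<kappa> * ?r x) (at x)" for x
      by (rule derivative_eq_intros D\<phi> Dv refl)+ (simp add: \<phi>x_def vx_def algebra_simps)
  qed (use \<kappa> r decaying_diff[OF dec\<phi> v(2)] in auto)
  from L2_comparable[OF dec\<phi> v(2) this r abs_sn_le(2)[OF b\<phi>]]
  show "L2sq \<phi> \<le> 3 * (LINT x|lborel. (v x)\<^sup>2)"
    "L2sq v \<le> 3 * (LINT x|lborel. (\<phi> x)\<^sup>2)" by blast+
qed

text \<open>The same argument for the differentiated equation, whose inhomogeneity is \<open>(1 - cs \<sigma>
  \<phi>) * \<phi>x\<close>.\<close>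

lemma L2_angle_linear_derivative:
  "L2sq \<phi>x \<le> 3 * (LINT x|lborel. (vx x)\<^sup>2)"
  "L2sq vx \<le> 3 * (LINT x|lborel. (\<phi>x x)\<^sup>2)"
proof -
  let ?r = "\<lambda>x. (1 - cs \<sigma> (\<phi> x)) * \<phi>x x"
  have c: "\<bar>1 - cs \<sigma> (\<phi> x)\<bar> \<le> 1/4" for x
    using abs_cs_minus_1_le[OF b\<phi>, of \<sigma> x] by (simp add: abs_minus_commute)
  then have br: "\<bar>?r x\<bar> \<le> 1/4 * \<bar>\<phi>x x\<bar>" for x
    unfolding abs_mult by (rule mult_right_mono) simp
  have r: "decaying ?r"
    using dec\<phi>x _ c
    by (rule decaying_mult_bounded) (intro continuous_on_diff continuous_on_const continuous_on_cs
        decaying_continuous dec\<phi>)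
  have "(LINT x|lborel. (\<phi>x x - vx x)\<^sup>2) \<le> (LINT x|lborel. (?r x)\<^sup>2)"
  proof (rule resolvent_L2_bound[where a = "2 * \<kappa>"])
    show "((\<lambda>x. \<phi>x x - vx x) has_real_derivative 2 * \<kappa> * (\<phi>x x - vx x)
        - 2 * \<kappa> * ?r x) (at x)" for x
      by (rule derivative_eq_intros D\<phi>x Dvx refl)+ (simp add: algebra_simps)
  qed (use \<kappa> r decaying_diff[OF dec\<phi>x decvx] in auto)
  from L2_comparable[OF dec\<phi>x decvx this r br]
  show "L2sq \<phi>x \<le> 3 * (LINT x|lborel. (vx x)\<^sup>2)"
    "L2sq vx \<le> 3 * (LINT x|lborel. (\<phi>x x)\<^sup>2)" by blast+
qed

lemma charge_bounds:
  "3/8 * L2sq \<phi> \<le> charge \<sigma> \<phi>" "charge \<sigma> \<phi>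
      \<le> 5/8 * (LINT x|lborel. (\<phi> x)\<^sup>2)"
proof -
  note i = decaying_square_integrable[OF dec\<phi>] decaying_integrable[OF dec_vers]
  have "(LINT x|lborel. 3/8 * (\<phi> x)\<^sup>2) \<le> charge \<sigma> \<phi>" "charge \<sigma> \<phi>
      \<le> (LINT x|lborel. 5/8 * (\<phi> x)\<^sup>2)"
    unfolding charge_def using i vers_bounds[OF \<sigma> b\<phi>]
    by (intro integral_mono; simp)+
  then show "3/8 * L2sq \<phi> \<le> charge \<sigma> \<phi>" "charge \<sigma> \<phi>
      \<le> 5/8 * (LINT x|lborel. (\<phi> x)\<^sup>2)"
    by simp_all
qed

text \<open>Square \<open>U = 2\<kappa> sn \<sigma> \<phi> - \<phi>x\<close>; the cross term is an exact
  derivative.\<close>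

lemma mass_identity:
  "L2sq U = 4 * \<kappa>\<^sup>2 * (LINT x|lborel. (sn \<sigma> (\<phi> x))\<^sup>2)
      + (LINT x|lborel. (\<phi>x x)\<^sup>2)"
proof -
  have d: "decaying (\<lambda>x. sn \<sigma> (\<phi> x) * \<phi>x x)"
      by (rule decaying_mult[OF dec\<phi>x dec_sn])
  have "((\<lambda>x. vers \<sigma> (\<phi> x)) has_real_derivative sn \<sigma> (\<phi> x) * \<phi>x x)
      (at x)" for x
    by (rule DERIV_vers[OF \<sigma> D\<phi>])
  from decaying_integral_derivative[OF this dec_vers d]
  have z: "(LINT x|lborel. sn \<sigma> (\<phi> x) * \<phi>x x) = 0" .
  note i = decaying_integrable[OF d] decaying_square_integrable[OF dec_sn] decaying_square_integrable[OF
      dec\<phi>x]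
  have "(U x)\<^sup>2 = 4 * \<kappa>\<^sup>2 * (sn \<sigma> (\<phi> x))\<^sup>2
      + (\<phi>x x)\<^sup>2 - 4 * \<kappa> * (sn \<sigma> (\<phi> x) * \<phi>x x)" for x
    by (simp add: \<phi>x_def power2_eq_square algebra_simps)
  then have "L2sq U = (LINT x|lborel. 4 * \<kappa>\<^sup>2 * (sn \<sigma> (\<phi> x))\<^sup>2
      + (\<phi>x x)\<^sup>2 - 4 * \<kappa> * (sn \<sigma> (\<phi> x) * \<phi>x x))"
    by simp
  also have "\<dots> = 4 * \<kappa>\<^sup>2 * (LINT x|lborel. (sn \<sigma> (\<phi> x))\<^sup>2)
      + (LINT x|lborel. (\<phi>x x)\<^sup>2)"
    using i z by simp
  finally show ?thesis .
qed

definition "mass = (LINT x|lborel. (U x)\<^sup>2)"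

lemma mass_nonneg: "0 \<le> mass" by (simp add: mass_def)

lemma kappa_angle_le_mass: "\<kappa>\<^sup>2 * L2sq \<phi> \<le> mass"
proof -
  have "(LINT x|lborel. 9/16 * (\<phi> x)\<^sup>2) \<le> (LINT x|lborel. (sn \<sigma> (\<phi> x))\<^sup>2)"
  proof (rule integral_mono)
    show "9/16 * (\<phi> x)\<^sup>2 \<le> (sn \<sigma> (\<phi> x))\<^sup>2" for x
    proof -
      have "(3/4 * \<bar>\<phi> x\<bar>)\<^sup>2 \<le> \<bar>sn \<sigma> (\<phi> x)\<bar>\<^sup>2"
          using abs_sn_le(3)[OF b\<phi>] by (intro power_mono) auto
      then show ?thesis by (simp add: power2_eq_square)
    qed
  qed (use decaying_square_integrable dec\<phi> dec_sn in auto)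
  then have "\<kappa>\<^sup>2 * (9/16 * L2sq \<phi>) \<le> \<kappa>\<^sup>2 * (LINT x|lborel.
      (sn \<sigma> (\<phi> x))\<^sup>2)"
    by (intro mult_left_mono) auto
  then have "4 * (9/16) * (\<kappa>\<^sup>2 * L2sq \<phi>)
      \<le> 4 * \<kappa>\<^sup>2 * (LINT x|lborel. (sn \<sigma> (\<phi> x))\<^sup>2)"
    by simp
  moreover have "0 \<le> \<kappa>\<^sup>2 * (LINT x|lborel. (\<phi> x)\<^sup>2)" "0
      \<le> (LINT x|lborel. (\<phi>x x)\<^sup>2)" by auto
  ultimately show ?thesis using mass_identity unfolding mass_def by linarith
qed

text \<open>Integrate the derivative \<open>16 * mass * \<phi> * \<phi>x\<close> of \<open>8 * mass *
  \<phi>\<^sup>2\<close> from \<open>x\<close> to \<open>+\<infinity>\<close> and split the product by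
  \<open>2ab \<le> a\<^sup>2 + b\<^sup>2\<close>. The factor \<open>mass\<close> is the one that
  \<open>quartic_bound\<close> supplies.\<close>

lemma angle_sup_bound:
  "8 * mass * (\<phi> x)\<^sup>2 \<le> L2sq \<phi>x + 64 * mass\<^sup>2 * (LINT x|lborel. (\<phi> x)\<^sup>2)"
proof -
  let ?g = "\<lambda>y. (\<phi>x y)\<^sup>2 + 64 * mass\<^sup>2 * (\<phi> y)\<^sup>2"
  have dg: "decaying ?g" by (intro decaying_add decaying_cmult decaying_power dec\<phi> dec\<phi>x) auto
  obtain G where G: "\<And>x. (G has_real_derivative ?g x) (at x)"
    using antiderivative_exists[OF decaying_continuous[OF dg]] by blast
  have g0: "0 \<le> ?g y" for y by simp
  have D: "((\<lambda>y. 8 * mass * (\<phi> y)\<^sup>2) has_real_derivative 16 * mass * \<phi> y * \<phi>x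
      y) (at y)" for y
    by (rule derivative_eq_intros D\<phi> refl)+ simp
  have le: "- ?g y \<le> 16 * mass * \<phi> y * \<phi>x y" for y
    using zero_le_power2[of "\<phi>x y + 8 * mass * \<phi> y"] by (simp add: power2_eq_square algebra_simps)
  have mono: "8 * mass * (\<phi> x)\<^sup>2 + G x \<le> 8 * mass * (\<phi> y)\<^sup>2 + G y"
      if "x \<le> y" for y
  proof (rule DERIV_nonneg_imp_nondecreasing[OF that])
    fix z
    show "\<exists>d. ((\<lambda>y. 8 * mass * (\<phi> y)\<^sup>2 + G y) has_real_derivative d) (at z)
        \<and> 0 \<le> d"
      using DERIV_add[OF D G, of z] le[of z] by (intro exI conjI) auto
  qed
  have Gb: "G y - G x \<le> (LINT x|lborel. ?g x)" if "x \<le> y" for y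
  proof -
    have "(LBINT z=x..y. ?g z) = G y - G x"
      by (rule interval_integral_FTC_finite)
        (use that G dg in \<open>auto simp: min_def max_def
            has_real_derivative_iff_has_vector_derivative[symmetric]
          intro: continuous_on_subset[OF decaying_continuous] DERIV_subset\<close>)
    then have "G y - G x = (LINT z:{x..y}|lborel. ?g z)"
      using that by (simp add: interval_integral_Icc)
    also have "\<dots> \<le> (LINT z|lborel. ?g z)"
      unfolding set_lebesgue_integral_def
    proof (rule integral_mono)
      show "integrable lborel (\<lambda>z. indicator {x..y} z *\<^sub>R ?g z)"
        using integrable_mult_indicator[OF _ decaying_integrable[OF dg], of "{x..y}"] by simp
    qed (use decaying_integrable[OF dg] in \<open>auto simp: indicator_def\<close>)
    finally show ?thesis .
  qed
  have "8 * mass * (\<phi> x)\<^sup>2 - (LINT x|lborel. ?g x) \<le> 8 * mass * (\<phi> y)\<^sup>2"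
      if "x \<le> y" for y
    using mono[OF that] Gb[OF that] by linarith
  with eventually_ge_at_top[of x] have ev: "\<forall>\<^sub>F y in at_top. 8 * mass * (\<phi> x)\<^sup>2
      - (LINT x|lborel. ?g x) \<le> 8 * mass * (\<phi> y)\<^sup>2"
    by (rule eventually_mono)
  have "((\<lambda>y. 8 * mass * (\<phi> y)\<^sup>2) \<longlongrightarrow> 0) at_top"
    by (intro decaying_tendsto decaying_cmult decaying_power dec\<phi>) auto
  from tendsto_lowerbound[OF this ev] have "8 * mass * (\<phi> x)\<^sup>2 - (LINT x|lborel. ?g x) \<le> 0"
      by simp
  moreover have "(LINT x|lborel. ?g x) = L2sq \<phi>x + 64 * mass\<^sup>2 * (LINT x|lborel. (\<phi> x)\<^sup>2)"
    using decaying_square_integrable[OF dec\<phi>] decaying_square_integrable[OF dec\<phi>x] by simp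
  ultimately show ?thesis by simp
qed

text \<open>Since \<open>vers\<^sup>2 \<le> \<phi>\<^sup>4\<close> and \<open>\<kappa>\<^sup>2
  \<integral>\<phi>\<^sup>2 \<le> mass\<close>, the left-hand side is at most \<open>4 * mass\<close> times the
  supremum of \<open>\<phi>\<^sup>2\<close>.\<close>

lemma quartic_bound:
  "4 * \<kappa>\<^sup>2 * (LINT x|lborel. (vers \<sigma> (\<phi> x))\<^sup>2)
    \<le> 1/2 * L2sq \<phi>x + 32 * mass ^ 3 / \<kappa>\<^sup>2"
proof -
  define I where "I = (LINT x|lborel. (\<phi> x)\<^sup>2)"
  define J where "J = (LINT x|lborel. (\<phi>x x)\<^sup>2)"
  have I: "0 \<le> I" and J: "0 \<le> J" by (simp_all add: I_def J_def)
  have IM: "\<kappa>\<^sup>2 * I \<le> mass" using kappa_angle_le_mass by (simp add: I_def)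
  have pw: "4 * mass * (\<phi> x)\<^sup>2 \<le> 1/2 * J + 32 * mass\<^sup>2 * I" for x
    using angle_sup_bound[of x] by (simp add: I_def J_def)
  have vv: "(vers \<sigma> (\<phi> x))\<^sup>2 \<le> (\<phi> x)\<^sup>2 * (\<phi> x)\<^sup>2" for x
  proof -
    have "0 \<le> vers \<sigma> (\<phi> x)" "vers \<sigma> (\<phi> x) \<le> (\<phi> x)\<^sup>2"
      using vers_bounds[OF \<sigma> b\<phi>, of x] zero_le_power2[of "\<phi> x"] by linarith+
    then show ?thesis unfolding power2_eq_square[of "vers \<sigma> (\<phi> x)"] by (intro mult_mono) auto
  qed
  define B where "B = (SUP x. (\<phi> x)\<^sup>2)"
  have "bdd_above (range (\<lambda>x. (\<phi> x)\<^sup>2))"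
    using power_mono[OF b\<phi> abs_ge_zero, of _ 2] by (intro bdd_aboveI[of _ "(1/2)\<^sup>2"]) auto
  then have B: "(\<phi> x)\<^sup>2 \<le> B" for x unfolding B_def by (rule cSUP_upper[rotated]) simp
  have B0: "0 \<le> B" using order_trans[OF zero_le_power2 B] .
  have c: "4 * mass * B \<le> 1/2 * J + 32 * mass\<^sup>2 * I"
  proof (cases "mass = 0")
    case False
    then have m: "0 < mass" using mass_nonneg by simp
    have "B \<le> (1/2 * J + 32 * mass\<^sup>2 * I) / (4 * mass)"
      unfolding B_def using pw m by (intro cSUP_least) (auto simp: pos_le_divide_eq mult.commute)
    then show ?thesis using m by (simp add: pos_le_divide_eq mult_ac)
  qed (use J in simp)
  have "(LINT x|lborel. (vers \<sigma> (\<phi> x))\<^sup>2) \<le> (LINT x|lborel. B * (\<phi> x)\<^sup>2)"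
  proof (rule integral_mono)
    show "(vers \<sigma> (\<phi> x))\<^sup>2 \<le> B * (\<phi> x)\<^sup>2" for x
      using order_trans[OF vv mult_right_mono[OF B zero_le_power2]] .
  qed (use decaying_square_integrable dec\<phi> dec_vers in auto)
  then have "4 * \<kappa>\<^sup>2 * (LINT x|lborel. (vers \<sigma> (\<phi> x))\<^sup>2)
      \<le> 4 * \<kappa>\<^sup>2 * (B * I)"
    by (intro mult_left_mono) (auto simp: I_def)
  also have "\<dots> = 4 * B * (\<kappa>\<^sup>2 * I)" by simp
  also have "\<dots> \<le> 4 * B * mass" using IM B0 by (intro mult_left_mono) auto
  also have "\<dots> \<le> 1/2 * J + 32 * mass\<^sup>2 * I" using c by (simp add: mult_ac)
  also have "\<dots> \<le> 1/2 * J + 32 * mass\<^sup>2 * (mass / \<kappa>\<^sup>2)"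
    using IM \<kappa> by (intro add_left_mono mult_left_mono) (auto simp: pos_le_divide_eq mult.commute)
  finally show ?thesis by (simp add: J_def power3_eq_cube power2_eq_square)
qed

text \<open>Because \<open>sn\<^sup>2 = 2 vers - \<sigma> vers\<^sup>2\<close>, the mass identity says that
  \<open>mass - 8\<kappa>\<^sup>2 charge\<close> equals \<open>\<integral>\<phi>x\<^sup>2\<close> up to the
  quartic term. In the focusing case that term has the wrong sign and must be absorbed.\<close>

lemma higher_charge_bounds:
  "L2sq \<phi>x \<le> 2 * (mass - 8 * \<kappa>\<^sup>2 * charge \<sigma> \<phi>)
      + 64 * mass ^ 3 / \<kappa>\<^sup>2"
  "2 * (mass - 8 * \<kappa>\<^sup>2 * charge \<sigma> \<phi>)
      \<le> 3 * L2sq \<phi>x + 64 * mass ^ 3 / \<kappa>\<^sup>2"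
proof -
  let ?Q = "LINT x|lborel. (vers \<sigma> (\<phi> x))\<^sup>2"
  have "(LINT x|lborel. (sn \<sigma> (\<phi> x))\<^sup>2)
      = (LINT x|lborel. 2 * vers \<sigma> (\<phi> x) - \<sigma> * (vers \<sigma> (\<phi> x))\<^sup>2)"
    by (simp add: sn_squared_vers[OF \<sigma>])
  also have "\<dots> = 2 * charge \<sigma> \<phi> - \<sigma> * ?Q"
    using decaying_integrable[OF dec_vers] decaying_square_integrable[OF dec_vers] by (simp add: charge_def)
  finally have sn2: "(LINT x|lborel. (sn \<sigma> (\<phi> x))\<^sup>2)
      = 2 * charge \<sigma> \<phi> - \<sigma> * ?Q" .
  have "mass - 8 * \<kappa>\<^sup>2 * charge \<sigma> \<phi>
      = L2sq \<phi>x - \<sigma> * (4 * \<kappa>\<^sup>2 * ?Q)"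
    using mass_identity unfolding mass_def sn2 by (simp add: algebra_simps)
  moreover have "\<bar>\<sigma> * (4 * \<kappa>\<^sup>2 * ?Q)\<bar> = 4 * \<kappa>\<^sup>2 * ?Q"
    using \<sigma> by (auto simp: abs_mult)
  ultimately have *: "L2sq \<phi>x \<le> 2 * (mass - 8 * \<kappa>\<^sup>2 * charge \<sigma> \<phi>)
      + 64 * mass ^ 3 / \<kappa>\<^sup>2
    \<and> 2 * (mass - 8 * \<kappa>\<^sup>2 * charge \<sigma> \<phi>)
        \<le> 3 * L2sq \<phi>x + 64 * mass ^ 3 / \<kappa>\<^sup>2"
    using quartic_bound unfolding abs_le_iff by argo
  show "L2sq \<phi>x \<le> 2 * (mass - 8 * \<kappa>\<^sup>2 * charge \<sigma> \<phi>)
      + 64 * mass ^ 3 / \<kappa>\<^sup>2"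
    "2 * (mass - 8 * \<kappa>\<^sup>2 * charge \<sigma> \<phi>)
        \<le> 3 * L2sq \<phi>x + 64 * mass ^ 3 / \<kappa>\<^sup>2"
    using * by blast+
qed

end

section \<open>Fourier inversion and the Plancherel formula\<close>

abbreviation spectrum :: "(real \<Rightarrow> real) \<Rightarrow> real \<Rightarrow> real" where
  "spectrum f \<xi> \<equiv> (norm (fourier f \<xi>))\<^sup>2"

lemma measurable_cis [measurable]:
  assumes "f \<in> borel_measurable M"
  shows "(\<lambda>x. cis (f x)) \<in> borel_measurable M"
proof -
  have "cis \<in> borel_measurable borel"
    by (intro borel_measurable_continuous_onI continuous_on_cis continuous_on_id)
  from measurable_compose[OF assms this] show ?thesis .
qed

lemma lborel_pair_integrable:
  fixes F :: "real \<times> real \<Rightarrow> 'a::{banach,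
      second_countable_topology}" and a b :: "real \<Rightarrow> real"
  assumes a: "integrable lborel a" and b: "integrable lborel b"
    and F: "F \<in> borel_measurable (lborel \<Otimes>\<^sub>M lborel)" "\<And>x y. norm (F (x, y))
        \<le> \<bar>a x\<bar> * \<bar>b y\<bar>"
  shows "integrable (lborel \<Otimes>\<^sub>M lborel) F"
proof -
  note [measurable] = borel_measurable_integrable[OF a] borel_measurable_integrable[OF b]
  have "integrable (lborel \<Otimes>\<^sub>M lborel) (\<lambda>p. a (fst p) * b (snd p))"
  proof (rule lborel_pair.Fubini_integrable)
    show "integrable lborel (\<lambda>x. LINT y|lborel. norm (a (fst (x, y)) * b (snd (x, y))))"
      using a by (simp add: abs_mult)
    show "AE x in lborel. integrable lborel (\<lambda>y. a (fst (x, y)) * b (snd (x, y)))"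
      using b by simp
  qed measurable
  then show ?thesis
    by (rule Bochner_Integration.integrable_bound) (use F in \<open>auto simp: abs_mult
        split_paired_all\<close>)
qed

lemma fourier_eq: "fourier f \<xi> = (LINT x|lborel. f x *\<^sub>R cis (- (x * \<xi>)))"
  unfolding fourier_def by (intro Bochner_Integration.integral_cong refl)
      (simp add: cis_conv_exp scaleR_conv_of_real mult.commute)

lemma fourier_integrable:
  assumes "integrable lborel f"
  shows "integrable lborel (\<lambda>x. f x *\<^sub>R cis (- (x * \<xi>)))"
  by (rule Bochner_Integration.integrable_bound[OF assms])
    (use borel_measurable_integrable[OF assms] in \<open>simp_all\<close>)

lemma norm_fourier_le: "norm (fourier f \<xi>) \<le> (LINT x|lborel. \<bar>f x\<bar>)"
  unfolding fourier_eq
  by (rule order_trans[OF integral_norm_bound]) simp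

lemma fourier_measurable [measurable]:
  assumes [measurable]: "f \<in> borel_measurable borel"
  shows "fourier f \<in> borel_measurable borel"
proof -
  have "(\<lambda>(\<xi>, x). f x *\<^sub>R cis (- (x * \<xi>))) \<in> borel_measurable (borel
      \<Otimes>\<^sub>M lborel)"
    by measurable
  then show ?thesis
    unfolding fourier_eq[abs_def] by (rule lborel.borel_measurable_lebesgue_integral)
qed

lemma fourier_lincomb:
  assumes "integrable lborel f" "integrable lborel g"
  shows "fourier (\<lambda>x. a * f x - b * g x) \<xi> = a * fourier f \<xi> - b * fourier g \<xi>"
proof -
  note i = fourier_integrable[OF assms(1), of \<xi>] fourier_integrable[OF assms(2), of \<xi>]
  have "fourier (\<lambda>x. a * f x - b * g x) \<xi> =
      (LINT x|lborel. a *\<^sub>R (f x *\<^sub>R cis (- (x * \<xi>)))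
          - b *\<^sub>R (g x *\<^sub>R cis (- (x * \<xi>))))"
    unfolding fourier_eq by (simp add: scaleR_diff_left)
  also have "\<dots> = (LINT x|lborel. a *\<^sub>R (f x *\<^sub>R cis (- (x * \<xi>))))
      - (LINT x|lborel. b *\<^sub>R (g x *\<^sub>R cis (- (x * \<xi>))))"
    by (intro Bochner_Integration.integral_diff integrable_scaleR_right i)
  also have "\<dots> = a *\<^sub>R fourier f \<xi> - b *\<^sub>R fourier g \<xi>"
    unfolding fourier_eq by (simp only: integral_scaleR_right)
  finally show ?thesis by (simp add: scaleR_conv_of_real)
qed

lemma fourier_derivative:
  assumes f: "\<And>x. (f has_real_derivative f' x) (at x)" and dec: "decaying f" "decaying f'"
  shows "fourier f' \<xi> = \<i> * \<xi> * fourier f \<xi>"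
proof -
  let ?e = "\<lambda>x. cis (- (x * \<xi>))"
  have D: "((\<lambda>x. f x *\<^sub>R ?e x) has_vector_derivative f' x *\<^sub>R ?e x
      - (\<i> * \<xi>) * (f x *\<^sub>R ?e x)) (at x)" for x
  proof -
    have "((\<lambda>x. exp (x *\<^sub>R (- \<i> * \<xi>))) has_vector_derivative (- \<i> * \<xi>) * exp (x
        *\<^sub>R (- \<i> * \<xi>))) (at x)"
      by (rule exp_scaleR_has_vector_derivative_left)
    then have e: "(?e has_vector_derivative (- \<i> * \<xi>) * ?e x) (at x)"
      by (simp add: cis_conv_exp scaleR_conv_of_real mult_ac)
    show ?thesis
      by (rule has_vector_derivative_eq_rhs[OF has_vector_derivative_scaleR[OF f e]])
        (simp add: scaleR_conv_of_real algebra_simps)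
  qed
  note i = fourier_integrable[OF decaying_integrable[OF dec(1)],
      of \<xi>] fourier_integrable[OF decaying_integrable[OF dec(2)], of \<xi>]
  have n: "norm (f x *\<^sub>R ?e x) = \<bar>f x\<bar>" for x by simp
  have "(LINT x|lborel. f' x *\<^sub>R ?e x - (\<i> * \<xi>) * (f x *\<^sub>R ?e x)) = 0 - 0"
  proof (rule integral_derivative_tendsto[OF D])
    show "continuous_on UNIV (\<lambda>x. f' x *\<^sub>R ?e x - (\<i> * \<xi>) * (f x *\<^sub>R ?e x))"
      by (intro continuous_intros decaying_continuous dec)
    show "integrable lborel (\<lambda>x. f' x *\<^sub>R ?e x - (\<i> * \<xi>) * (f x *\<^sub>R ?e x))"
      using i by (intro Bochner_Integration.integrable_diff integrable_mult_right)
    show "((\<lambda>x. f x *\<^sub>R ?e x) \<longlongrightarrow> 0) at_bot" "((\<lambda>x.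
        f x *\<^sub>R ?e x) \<longlongrightarrow> 0) at_top"
      using decaying_tendsto[OF dec(1)] by (auto intro: tendsto_norm_zero_cancel simp: n tendsto_rabs_zero_iff)
  qed
  also have "(LINT x|lborel. f' x *\<^sub>R ?e x - (\<i> * \<xi>) * (f x *\<^sub>R ?e x))
      = (LINT x|lborel. f' x *\<^sub>R ?e x) - (LINT x|lborel. (\<i> * \<xi>) * (f x *\<^sub>R ?e x))"
    by (intro Bochner_Integration.integral_diff integrable_mult_right i)
  also have "(LINT x|lborel. (\<i> * \<xi>) * (f x *\<^sub>R ?e x))
      = (\<i> * \<xi>) * (LINT x|lborel. f x *\<^sub>R ?e x)"
    by (rule integral_mult_right_zero)
  finally show ?thesis unfolding fourier_eq by simp
qed

lemma gaussian_integral: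
  "(LINT \<xi>|lborel. exp (- \<xi>\<^sup>2 / 2) *\<^sub>R cis (\<xi> * y))
      = sqrt (2 * pi) * exp (- y\<^sup>2 / 2)"
proof -
  have "char std_normal_distribution y = (LINT x|lborel. std_normal_density x *\<^sub>R iexp (y * x))"
    unfolding char_def by (subst integral_density) (auto intro!: borel_measurable_continuous_onI
        continuous_intros)
  also have "\<dots> = (LINT x|lborel. (1 / sqrt (2 * pi)) *\<^sub>R (exp (- x\<^sup>2 / 2) *\<^sub>R cis (x
      * y)))"
    by (intro Bochner_Integration.integral_cong refl)
      (simp add: std_normal_density_def cis_conv_exp scaleR_conv_of_real mult_ac)
  also have "\<dots> = (1 / sqrt (2 * pi)) *\<^sub>R (LINT x|lborel.
      exp (- x\<^sup>2 / 2) *\<^sub>R cis (x * y))"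
    by (rule integral_scaleR_right)
  finally have eq: "complex_of_real (exp (- (y\<^sup>2) / 2))
      = (1 / sqrt (2 * pi)) *\<^sub>R (LINT x|lborel. exp (- x\<^sup>2 / 2) *\<^sub>R cis (x * y))"
    by (simp add: char_std_normal_distribution)
  have "sqrt (2 * pi) *\<^sub>R complex_of_real (exp (- (y\<^sup>2) / 2))
      = (LINT x|lborel. exp (- x\<^sup>2 / 2) *\<^sub>R cis (x * y))"
    unfolding eq scaleR_scaleR by simp
  then show ?thesis by (simp only: scaleR_conv_of_real of_real_mult)
qed

lemma gaussian_integrable: "integrable lborel (\<lambda>\<xi>::real. exp (- \<xi>\<^sup>2 / 2))"
proof -
  have "integrable lborel (\<lambda>x. sqrt (2 * pi) * std_normal_density x)"
    by (intro integrable_mult_right integrable_normal_density) simp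
  then show ?thesis by (simp add: std_normal_density_def)
qed

lemma gaussian_integrable_scaled: "e \<noteq> 0 \<Longrightarrow>
    integrable lborel (\<lambda>\<xi>::real. exp (- (e * \<xi>)\<^sup>2 / 2))"
  using lborel_integrable_real_affine[OF gaussian_integrable, of e 0] by simp

lemma gaussian_integral_1: "(LINT \<xi>|lborel. exp (- (\<xi>::real)\<^sup>2 / 2)) = sqrt (2 * pi)"
proof -
  have "complex_of_real (LINT \<xi>|lborel. exp (- \<xi>\<^sup>2 / 2)) = complex_of_real (sqrt (2 * pi))"
    using gaussian_integral[of 0] by (simp add: scaleR_conv_of_real flip: integral_complex_of_real)
  then show ?thesis by (simp only: of_real_eq_iff)
qed

text \<open>By Fubini and the transform of the Gaussian, a Gaussian cutoff in frequency is a Gaussian average in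
  space.\<close>

lemma fourier_gauss_mean:
  assumes f: "decaying f" and e: "0 < e"
  shows "(LINT \<xi>|lborel. exp (- (e * \<xi>)\<^sup>2 / 2) *\<^sub>R (cis (x * \<xi>) * fourier f \<xi>))
    = of_real (sqrt (2 * pi) * (LINT z|lborel. f (x + e * z) * exp (- z\<^sup>2 / 2)))"
proof -
  let ?g = "\<lambda>\<xi>. exp (- (e * \<xi>)\<^sup>2 / 2)"
  let ?F = "\<lambda>\<xi> y. ?g \<xi> *\<^sub>R (cis (x * \<xi>) * (f y *\<^sub>R cis (- (y * \<xi>))))"
  have [measurable]: "f \<in> borel_measurable borel" using f by (rule decaying_measurable)
  have int: "integrable (lborel \<Otimes>\<^sub>M lborel) (\<lambda>(\<xi>, y). ?F \<xi> y)"
  proof (rule lborel_pair_integrable)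
    show "integrable lborel ?g" using gaussian_integrable_scaled[of e] e by simp
    show "integrable lborel f" using f by (rule decaying_integrable)
    show "(\<lambda>(\<xi>, y). ?F \<xi> y) \<in> borel_measurable (lborel \<Otimes>\<^sub>M lborel)"
        by measurable
  qed (simp add: norm_mult abs_mult)
  have "(LINT \<xi>|lborel. ?g \<xi> *\<^sub>R (cis (x * \<xi>) * fourier f \<xi>))
      = (LINT \<xi>|lborel. (LINT y|lborel. ?F \<xi> y))"
    unfolding fourier_eq by (simp only: integral_scaleR_right integral_mult_right_zero)
  also have "\<dots> = (LINT y|lborel. (LINT \<xi>|lborel. ?F \<xi> y))"
    by (rule lborel_pair.Fubini_integral[OF int, symmetric])
  also have "\<dots> = (LINT y|lborel. complex_of_real (f y * sqrt (2 * pi) / e * exp (- ((x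
      - y) / e)\<^sup>2 / 2)))"
  proof (rule Bochner_Integration.integral_cong[OF refl])
    fix y
    show "(LINT \<xi>|lborel. ?F \<xi> y) = of_real (f y * sqrt (2 * pi) / e * exp (- ((x
        - y) / e)\<^sup>2 / 2))"
    proof -
    have "(LINT \<xi>|lborel. ?F \<xi> y) = (LINT \<xi>|lborel.
        f y *\<^sub>R (?g \<xi> *\<^sub>R cis (\<xi> * (x - y))))"
      by (intro Bochner_Integration.integral_cong refl)
          (simp add: cis_mult scaleR_conv_of_real mult_ac right_diff_distrib)
    also have "\<dots> = f y *\<^sub>R (LINT \<xi>|lborel. (?g \<xi> *\<^sub>R cis (\<xi> * (x - y))))"
      by (rule integral_scaleR_right)
    also have "(LINT \<xi>|lborel. (?g \<xi> *\<^sub>R cis (\<xi> * (x - y)))) =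
        (1 / e) *\<^sub>R (LINT \<xi>|lborel. exp (- \<xi>\<^sup>2 / 2) *\<^sub>R cis (\<xi> * ((x - y) / e)))"
      using lborel_integral_real_affine[of "1 / e" "\<lambda>\<xi>. ?g \<xi> *\<^sub>R cis (\<xi> * (x
          - y))" 0] e by simp
    finally show ?thesis
      unfolding gaussian_integral by (simp add: scaleR_conv_of_real)
    qed
  qed
  also have "(LINT y|lborel. complex_of_real (f y * sqrt (2 * pi) / e * exp (- ((x - y) / e)\<^sup>2 / 2)))
      = of_real (LINT y|lborel. f y * sqrt (2 * pi) / e * exp (- ((x - y) / e)\<^sup>2 / 2))"
    by (rule integral_complex_of_real)
  also have "(LINT y|lborel. f y * sqrt (2 * pi) / e * exp (- ((x - y) / e)\<^sup>2 / 2))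
      = e * (LINT z|lborel. f (x + e * z) * sqrt (2 * pi) / e * exp (- z\<^sup>2 / 2))"
    using lborel_integral_real_affine[of e "\<lambda>y. f y * sqrt (2 * pi) / e * exp (- ((x
        - y) / e)\<^sup>2 / 2)" x] e by simp
  also have "\<dots> = sqrt (2 * pi) * (LINT z|lborel. f (x + e * z) * exp (- z\<^sup>2 / 2))"
    unfolding integral_mult_right_zero[symmetric] using e by (intro Bochner_Integration.integral_cong) auto
  finally show ?thesis .
qed

text \<open>Let the width of the Gaussian average tend to 0.\<close>

theorem fourier_inversion:
  assumes f: "decaying f" and i: "integrable lborel (fourier f)"
  shows "(LINT \<xi>|lborel. cis (x * \<xi>) * fourier f \<xi>) = of_real (2 * pi * f x)"
proof -
  let ?e = "\<lambda>n. inverse (real (Suc n))"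
  have [measurable]: "f \<in> borel_measurable borel" using f by (rule decaying_measurable)
  obtain K where K: "\<And>x. \<bar>f x\<bar> \<le> K" using f decayingE by blast
  have e0: "?e \<longlonglongrightarrow> 0" by (rule LIMSEQ_inverse_real_of_nat)
  have cm [measurable]: "(\<lambda>\<xi>. cis (x * \<xi>)) \<in> borel_measurable borel"
    by (intro borel_measurable_continuous_onI continuous_intros)
  have "(\<lambda>n. LINT \<xi>|lborel. exp (- (?e n * \<xi>)\<^sup>2 / 2) *\<^sub>R (cis (x * \<xi>) *
      fourier f \<xi>))
      \<longlonglongrightarrow> (LINT \<xi>|lborel. cis (x * \<xi>) * fourier f \<xi>)"
  proof (rule integral_dominated_convergence[where w="\<lambda>\<xi>. norm (fourier f \<xi>)"])
    show "AE \<xi> in lborel. (\<lambda>n. exp (- (?e n * \<xi>)\<^sup>2 / 2) *\<^sub>R (cis (x * \<xi>) *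
        fourier f \<xi>)) \<longlonglongrightarrow> cis (x * \<xi>) * fourier f \<xi>"
    proof (rule AE_I2)
      fix \<xi> :: real
      have "(\<lambda>n. exp (- (?e n * \<xi>)\<^sup>2 / 2)) \<longlonglongrightarrow> exp (- (0 *
          \<xi>)\<^sup>2 / 2)"
        by (intro tendsto_intros e0) auto
      then have "(\<lambda>n. exp (- (?e n * \<xi>)\<^sup>2 / 2)) \<longlonglongrightarrow> 1" by simp
      from tendsto_scaleR[OF this tendsto_const]
      show "(\<lambda>n. exp (- (?e n * \<xi>)\<^sup>2 / 2) *\<^sub>R (cis (x * \<xi>) * fourier f \<xi>))
          \<longlonglongrightarrow> cis (x * \<xi>) * fourier f \<xi>" by simp
    qed
    show "AE \<xi> in lborel. norm (exp (- (?e n * \<xi>)\<^sup>2 / 2) *\<^sub>R (cis (x * \<xi>) * fourier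
        f \<xi>)) \<le> norm (fourier f \<xi>)" for n
      by (auto simp: norm_mult intro!: mult_left_le_one_le)
  qed (use i in auto)
  moreover have "(\<lambda>n. of_real (sqrt (2 * pi) * (LINT z|lborel. f (x
      + ?e n * z) * exp (- z\<^sup>2 / 2))))
      \<longlonglongrightarrow> complex_of_real (sqrt (2 * pi) * (LINT z|lborel. f x * exp (- z\<^sup>2 / 2)))"
  proof (intro tendsto_of_real tendsto_mult_left integral_dominated_convergence[where w="\<lambda>z.
      K * exp (- z\<^sup>2 / 2)"])
    show "AE z in lborel. (\<lambda>n. f (x + ?e n * z) * exp (- z\<^sup>2 / 2)) \<longlonglongrightarrow> f
        x * exp (- z\<^sup>2 / 2)"
    proof (rule AE_I2)
      fix z :: real
      have "(\<lambda>n. x + ?e n * z) \<longlonglongrightarrow> x + 0 * z" by (intro tendsto_intros e0)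
      moreover have "isCont f x" using decaying_continuous[OF f] by (simp add: continuous_on_eq_continuous_at)
      ultimately have "(\<lambda>n. f (x + ?e n * z)) \<longlonglongrightarrow> f x"
          by (intro isCont_tendsto_compose[of x f]) auto
      then show "(\<lambda>n. f (x + ?e n * z) * exp (- z\<^sup>2 / 2)) \<longlonglongrightarrow> f x * exp
          (- z\<^sup>2 / 2)" by (intro tendsto_intros)
    qed
    show "AE z in lborel. norm (f (x + ?e n * z) * exp (- z\<^sup>2 / 2)) \<le> K * exp (- z\<^sup>2 / 2)" for n
      using K by (auto simp: abs_mult)
    show "integrable lborel (\<lambda>z. K * exp (- z\<^sup>2 / 2))"
      using gaussian_integrable by simp
  qed measurable
  moreover have "(\<lambda>n. LINT \<xi>|lborel. exp (- (?e n * \<xi>)\<^sup>2 / 2) *\<^sub>R (cis (x *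
      \<xi>) * fourier f \<xi>))
     = (\<lambda>n. of_real (sqrt (2 * pi) * (LINT z|lborel. f (x + ?e n * z) * exp (- z\<^sup>2 / 2))))"
    by (intro ext fourier_gauss_mean[OF f]) simp
  ultimately have "(LINT \<xi>|lborel. cis (x * \<xi>) * fourier f \<xi>)
      = complex_of_real (sqrt (2 * pi) * (LINT z|lborel. f x * exp (- z\<^sup>2 / 2)))"
    using LIMSEQ_unique by (metis (no_types, lifting))
  also have "(LINT z|lborel. f x * exp (- z\<^sup>2 / 2)) = f x * sqrt (2 * pi)"
    by (simp only: integral_mult_right_zero gaussian_integral_1)
  also have "sqrt (2 * pi) * (f x * sqrt (2 * pi)) = 2 * pi * f x" by simp
  finally show ?thesis .
qed

text \<open>Insert the inversion formula for one of the two factors \<open>f\<close> and exchange the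
  integrals.\<close>

theorem plancherel:
  assumes f: "decaying f" and i: "integrable lborel (fourier f)"
  shows "2 * pi * L2sq f = (LINT \<xi>|lborel. (norm (fourier f \<xi>))\<^sup>2)"
proof -
  let ?F = "\<lambda>x \<xi>. f x *\<^sub>R (cis (x * \<xi>) * fourier f \<xi>)"
  have [measurable]: "f \<in> borel_measurable borel" using f by (rule decaying_measurable)
  have int: "integrable (lborel \<Otimes>\<^sub>M lborel) (\<lambda>(x, \<xi>). ?F x \<xi>)"
  proof (rule lborel_pair_integrable)
    show "integrable lborel f" using f by (rule decaying_integrable)
    show "integrable lborel (\<lambda>\<xi>. norm (fourier f \<xi>))" using i by (rule integrable_norm)
    show "(\<lambda>(x, \<xi>). ?F x \<xi>) \<in> borel_measurable (lborel \<Otimes>\<^sub>M lborel)"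
        by measurable
  qed (simp add: norm_mult)
  have "complex_of_real (2 * pi * L2sq f) = (LINT x|lborel. f x *\<^sub>R of_real (2 * pi * f x))"
    unfolding integral_complex_of_real[symmetric] integral_mult_right_zero[symmetric]
    by (intro Bochner_Integration.integral_cong refl) (simp add: power2_eq_square scaleR_conv_of_real mult_ac)
  also have "\<dots> = (LINT x|lborel. (LINT \<xi>|lborel. ?F x \<xi>))"
    unfolding fourier_inversion[OF f i, symmetric] by (simp only: integral_scaleR_right)
  also have "\<dots> = (LINT \<xi>|lborel. (LINT x|lborel. ?F x \<xi>))"
    by (rule lborel_pair.Fubini_integral[OF int, symmetric])
  also have "\<dots> = (LINT \<xi>|lborel. complex_of_real ((norm (fourier f \<xi>))\<^sup>2))"
  proof (rule Bochner_Integration.integral_cong[OF refl])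
    fix \<xi>
    have "(LINT x|lborel. f x *\<^sub>R cis (x * \<xi>))
        = (LINT x|lborel. cnj (f x *\<^sub>R cis (- (x * \<xi>))))"
      by (simp add: scaleR_conv_of_real cis_cnj)
    also have "\<dots> = cnj (fourier f \<xi>)" unfolding fourier_eq by (rule Bochner_Integration.integral_cnj)
    finally have c: "(LINT x|lborel. f x *\<^sub>R cis (x * \<xi>)) = cnj (fourier f \<xi>)" .
    have "(LINT x|lborel. ?F x \<xi>) = (LINT x|lborel. (f x *\<^sub>R cis (x * \<xi>)) * fourier f \<xi>)"
        by simp
    also have "\<dots> = cnj (fourier f \<xi>) * fourier f \<xi>" unfolding c[symmetric]
        by (rule integral_mult_left_zero)
    finally show "(LINT x|lborel. ?F x \<xi>) = of_real ((norm (fourier f \<xi>))\<^sup>2)"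
      by (simp only: complex_norm_square mult.commute)
  qed
  also have "(LINT \<xi>|lborel. complex_of_real ((norm (fourier f \<xi>))\<^sup>2))
      = of_real (LINT \<xi>|lborel. (norm (fourier f \<xi>))\<^sup>2)"
    by (rule integral_complex_of_real)
  finally show ?thesis by (simp only: of_real_eq_iff)
qed

lemma fourier_sup_bound:
  assumes f: "decaying f" and i: "integrable lborel (fourier f)"
  shows "2 * pi * \<bar>f x\<bar> \<le> (LINT \<xi>|lborel. norm (fourier f \<xi>))"
proof -
  have "2 * pi * \<bar>f x\<bar> = norm (complex_of_real (2 * pi * f x))"
    unfolding norm_of_real by (simp add: abs_mult)
  also have "\<dots> \<le> (LINT \<xi>|lborel. norm (fourier f \<xi>))"
    unfolding fourier_inversion[OF f i, of x, symmetric]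
    by (rule order_trans[OF integral_norm_bound]) (simp add: norm_mult)
  finally show ?thesis .
qed

text \<open>\<open>(1 + \<xi>\<^sup>2) * fourier f \<xi>\<close> is the transform of \<open>f -
  f''\<close>.\<close>

lemma fourier_decay:
  assumes f: "\<And>x. (f has_real_derivative f' x) (at x)" "\<And>x. (f' has_real_derivative f'' x) (at x)"
    and dec: "decaying f" "decaying f'" "decaying f''"
  shows "norm (fourier f \<xi>) \<le> (LINT x|lborel. \<bar>f x\<bar> + \<bar>f'' x\<bar>) / (1
      + \<xi>\<^sup>2)"
proof -
  have "norm (fourier f'' \<xi>) = \<xi>\<^sup>2 * norm (fourier f \<xi>)"
    unfolding fourier_derivative[OF f(2) dec(2,3)] fourier_derivative[OF f(1) dec(1,2)]
    by (simp add: norm_mult power2_eq_square)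
  then have "(1 + \<xi>\<^sup>2) * norm (fourier f \<xi>) = norm (fourier f \<xi>) + norm (fourier f'' \<xi>)"
    by (simp add: distrib_right)
  also have "\<dots> \<le> (LINT x|lborel. \<bar>f x\<bar>) + (LINT x|lborel. \<bar>f'' x\<bar>)"
    by (intro add_mono norm_fourier_le)
  also have "\<dots> = (LINT x|lborel. \<bar>f x\<bar> + \<bar>f'' x\<bar>)"
    using dec decaying_integrable by (auto intro!: Bochner_Integration.integral_add[symmetric] integrable_abs)
  finally show ?thesis by (simp add: pos_le_divide_eq mult.commute)
qed

section \<open>Power weights as superpositions of resolvents\<close>

lemma set_integrable_lborel_of_has_integral:
  fixes f :: "real \<Rightarrow> real"
  assumes i: "f integrable_on S" and S: "S \<in> sets borel" and f: "f \<in> borel_measurable borel" and nn: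
      "\<And>x. x \<in> S \<Longrightarrow> 0 \<le> f x"
  shows "integrable lborel (\<lambda>x. indicator S x * f x)"
proof -
  have "f absolutely_integrable_on S"
    by (intro nonnegative_absolutely_integrable_1 i nn)
  then have "integrable lebesgue (\<lambda>x. indicator S x * f x)"
    by (simp add: set_integrable_def)
  moreover have "(\<lambda>x. indicator S x * f x) \<in> borel_measurable lborel"
    using S f by simp
  ultimately show ?thesis by (simp add: integrable_completion)
qed

lemma integrable_powr_at_infinity:
  assumes "e < -1" shows "integrable lborel (\<lambda>x::real. indicator {1..} x * x powr e)"
  by (intro set_integrable_lborel_of_has_integral has_integral_integrable[OF has_integral_powr_to_inf[OF
      assms]]) auto

lemma integrable_powr_at_0:
  assumes "-1 < e" shows "integrable lborel (\<lambda>x::real. indicator {0..1} x * x powr e)"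
  using integrable_on_powr_from_0[of e 1] assms
  by (intro set_integrable_lborel_of_has_integral) auto

lemma integrable_bracket_powr: "integrable lborel (\<lambda>\<xi>::real. (1 + \<xi>\<^sup>2) powr (-3/4))"
proof -
  let ?p = "\<lambda>x::real. indicator {1..} x * x powr (-3/2)"
  have p: "integrable lborel ?p" by (rule integrable_powr_at_infinity) simp
  have p': "integrable lborel (\<lambda>x. ?p (- x))"
    using lborel_integrable_real_affine[OF p, of "-1" 0] by simp
  have "integrable lborel (\<lambda>x. indicator {-1..1} x + ?p x + ?p (- x))"
    by (intro Bochner_Integration.integrable_add p p') simp
  then show ?thesis
  proof (rule Bochner_Integration.integrable_bound)
    have "(1 + x\<^sup>2) powr (-3/4) \<le> indicator {-1..1} x + ?p x + ?p (- x)" for x :: real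
    proof -
      have big: "(1 + y\<^sup>2) powr (-3/4) \<le> y powr (-3/2)" if "1 \<le> y" for y :: real
      proof -
        have "(1 + y\<^sup>2) powr (-3/4) \<le> (y\<^sup>2) powr (-3/4)" using that by (intro powr_mono2') auto
        also have "(y\<^sup>2) powr (-3/4) = y powr (-3/2)"
          using that by (simp add: powr_powr flip: powr_numeral)
        finally show ?thesis .
      qed
      have "(1 + x\<^sup>2) powr (-3/4) \<le> 1 powr (-3/4)" by (intro powr_mono2') auto
      then have small: "(1 + x\<^sup>2) powr (-3/4) \<le> 1" by simp
      consider "1 \<le> x" | "x \<le> -1" | "x \<in> {-1..1}" by fastforce
      then show ?thesis
      proof cases
        case 1 then show ?thesis using big[of x] by (auto simp: indicator_def)
      next
        case 2 then show ?thesis using big[of "- x"] by (auto simp: indicator_def)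
      next
        case 3 then show ?thesis using small by (auto simp: indicator_def)
      qed
    qed
    then show "AE x in lborel. norm ((1 + x\<^sup>2) powr (-3/4))
        \<le> norm (indicator {-1..1} x + ?p x + ?p (- x))"
      by (intro AE_I2) (simp add: order_trans[OF _ abs_ge_self])
  qed simp
qed

text \<open>The exponent is what remains of \<open>- s - 1 < - 7/8\<close> in \<open>resolvent_small\<close>
  after 1/8 of it has been spent on a negative power of \<open>\<kappa>0\<close>.\<close>

definition bracket_mass :: real where
  "bracket_mass = (LINT \<xi>|lborel. (1 + \<xi>\<^sup>2) powr (-3/4))"

definition subordination_const :: "real \<Rightarrow> ennreal" where
  "subordination_const r = (\<integral>\<^sup>+\<tau>. ennreal (indicator {0<..} \<tau> * (\<tau> powr r /
      (4 * \<tau> + 1))) \<partial>lborel)"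

lemma subordination_const_finite:
  assumes "-1 < r" "r < 0" shows "subordination_const r < \<infinity>"
proof -
  have i: "integrable lborel (\<lambda>\<tau>. indicator {0..1} \<tau> * \<tau> powr r
      + indicator {1..} \<tau> * \<tau> powr (r - 1))"
    using assms by (intro Bochner_Integration.integrable_add integrable_powr_at_0
        integrable_powr_at_infinity) auto
  have "subordination_const r \<le> (\<integral>\<^sup>+\<tau>.
      ennreal (indicator {0..1} \<tau> * \<tau> powr r + indicator {1..} \<tau> * \<tau> powr (r
      - 1)) \<partial>lborel)"
    unfolding subordination_const_def
  proof (intro nn_integral_mono ennreal_leI)
    fix \<tau> :: real
    have 1: "\<tau> powr r / (4 * \<tau> + 1) \<le> \<tau> powr r" if "0 < \<tau>"
      using that by (simp add: divide_le_eq mult_le_cancel_left1)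
    have 2: "\<tau> powr r / (4 * \<tau> + 1) \<le> \<tau> powr (r - 1)" if "1 \<le> \<tau>"
    proof -
      have "\<tau> powr r / (4 * \<tau> + 1) \<le> \<tau> powr r / \<tau>" using that
          by (intro divide_left_mono) auto
      then show ?thesis using that by (simp add: powr_diff)
    qed
    show "indicator {0<..} \<tau> * (\<tau> powr r / (4 * \<tau> + 1))
        \<le> indicator {0..1} \<tau> * \<tau> powr r + indicator {1..} \<tau> * \<tau> powr (r - 1)"
      using 1 2 by (cases "\<tau> \<le> 1") (auto simp: indicator_def add_increasing2)
  qed
  also have "\<dots> < \<infinity>"
    using integrableD(2)[OF i] by (simp add: less_top)
  finally show ?thesis .
qed

lemma subordination_const_pos: "subordination_const r \<noteq> 0"
proof
  assume "subordination_const r = 0"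
  then have "AE \<tau> in lborel. ennreal (indicator {0<..} \<tau> * (\<tau> powr r / (4 * \<tau> + 1))) = 0"
    unfolding subordination_const_def by (subst (asm) nn_integral_0_iff_AE) auto
  then have "AE \<tau> in lborel. \<tau> \<notin> {0<..<1::real}"
    by eventually_elim (auto simp: indicator_def ennreal_eq_0_iff divide_le_0_iff)
  then have "emeasure lborel {0<..<1::real} = 0"
    by (subst (asm) AE_iff_measurable[of "{0<..<1}"]) auto
  then show False by simp
qed

text \<open>Substitute \<open>a * \<tau>\<close> for \<open>\<tau>\<close>.\<close>

lemma subordination:
  assumes a: "0 < a"
  shows "(\<integral>\<^sup>+\<tau>. ennreal (indicator {0<..} \<tau> * (\<tau> powr r / (4 * \<tau>
      + a))) \<partial>lborel) = ennreal (a powr r) * subordination_const r"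
proof -
  have "(\<integral>\<^sup>+\<tau>. ennreal (indicator {0<..} \<tau> * (\<tau> powr r / (4 * \<tau>
      + a))) \<partial>lborel)
      = ennreal a * (\<integral>\<^sup>+\<tau>. ennreal (indicator {0<..} (0 + a * \<tau>) * ((0
          + a * \<tau>) powr r / (4 * (0 + a * \<tau>) + a))) \<partial>lborel)"
    using a by (subst nn_integral_real_affine[where c=a and t=0]) auto
  also have "\<dots> = ennreal a * (\<integral>\<^sup>+\<tau>. ennreal (a powr (r
      - 1)) * ennreal (indicator {0<..} \<tau> * (\<tau> powr r / (4 * \<tau> + 1))) \<partial>lborel)"
  proof (intro arg_cong2[of _ _ _ _ "(*)"] refl nn_integral_cong)
    fix \<tau> :: real
    have "indicator {0<..} (0 + a * \<tau>) * ((0 + a * \<tau>) powr r / (4 * (0 + a * \<tau>) + a))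
      = a powr (r - 1) * (indicator {0<..} \<tau> * (\<tau> powr r / (4 * \<tau> + 1)))"
    proof (cases "0 < \<tau>")
      case True
      have "4 * (a * \<tau>) + a = a * (4 * \<tau> + 1)" by (simp add: algebra_simps)
      then show ?thesis using True a by (simp add: indicator_def powr_mult powr_diff)
    qed (use a in \<open>auto simp: indicator_def zero_less_mult_iff\<close>)
    then show "ennreal (indicator {0<..} (0 + a * \<tau>) * ((0 + a * \<tau>) powr r / (4 * (0 + a * \<tau>)
        + a)))
      = ennreal (a powr (r - 1)) * ennreal (indicator {0<..} \<tau> * (\<tau> powr r / (4 * \<tau> + 1)))"
      by (simp flip: ennreal_mult')
  qed
  also have "\<dots> = ennreal a * (ennreal (a powr (r - 1)) * subordination_const r)"
    unfolding subordination_const_def by (subst nn_integral_cmult) auto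
  also have "\<dots> = ennreal (a * a powr (r - 1)) * subordination_const r"
    using a by (simp add: ennreal_mult mult.assoc)
  also have "a * a powr (r - 1) = a powr r" using a by (simp add: powr_diff)
  finally show ?thesis .
qed

lemma subordination_scaled:
  assumes "0 < a"
  shows "(\<integral>\<^sup>+\<tau>. ennreal (indicator {0<..} \<tau> * \<tau> powr r) * (h * ennreal (1 /
      (4 * \<tau> + a))) \<partial>lborel)
    = h * (ennreal (a powr r) * subordination_const r)"
proof -
  have "ennreal (indicator {0<..} \<tau> * \<tau> powr r) * (h * ennreal (1 / (4 * \<tau> + a)))
    = h * ennreal (indicator {0<..} \<tau> * (\<tau> powr r / (4 * \<tau> + a)))" for \<tau>
  proof (cases "0 < \<tau>")
    case True
    then have "ennreal (indicator {0<..} \<tau> * \<tau> powr r) * ennreal (1 / (4 * \<tau> + a))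
      = ennreal (indicator {0<..} \<tau> * (\<tau> powr r / (4 * \<tau> + a)))"
      using assms by (subst ennreal_mult[symmetric]) auto
    then show ?thesis by (metis mult.left_commute)
  qed simp
  then show ?thesis by (simp add: nn_integral_cmult subordination[OF assms,
      symmetric] del: times_divide_eq_right)
qed

text \<open>By \<open>subordination\<close>, the weight \<open>m powr r\<close> is a superposition of the
  weights \<open>1 / (4\<tau> + m)\<close>, so the hypothesis may be integrated against \<open>\<tau> powr
  r\<close>. The term with \<open>E\<close> has the shape of a resolvent so that its integral is finite
  too.\<close>

lemma subordinated_comparison:
  fixes F G :: "real \<Rightarrow> ennreal" and m :: "real \<Rightarrow> real"
  assumes [measurable]: "F \<in> borel_measurable borel" "G \<in> borel_measurable borel" "m \<in>
      borel_measurable borel"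
    and m: "\<And>\<xi>. 0 < m \<xi>" and b: "0 < b" and r: "-1 < r" "r < 0"
    and le: "\<And>\<tau>. 0 < \<tau> \<Longrightarrow>
        (\<integral>\<^sup>+\<xi>. F \<xi> * ennreal (1 / (4 * \<tau> + m \<xi>)) \<partial>lborel)
      \<le> C * (\<integral>\<^sup>+\<xi>. G \<xi> * ennreal (1 / (4 * \<tau> + m \<xi>)) \<partial>lborel)
          + E * ennreal (1 / (4 * \<tau> + b))"
  shows "(\<integral>\<^sup>+\<xi>. F \<xi> * ennreal (m \<xi> powr r) \<partial>lborel)
      \<le> C * (\<integral>\<^sup>+\<xi>. G \<xi> * ennreal (m \<xi> powr r) \<partial>lborel)
          + E * ennreal (b powr r)"
proof -
  let ?c = "subordination_const r"
  let ?w = "\<lambda>\<tau>. ennreal (indicator {0<..} \<tau> * \<tau> powr r)"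
  have swap: "(\<integral>\<^sup>+\<tau>. ?w \<tau> * (\<integral>\<^sup>+\<xi>.
      H \<xi> * ennreal (1 / (4 * \<tau> + m \<xi>)) \<partial>lborel) \<partial>lborel)
      = ?c * (\<integral>\<^sup>+\<xi>. H \<xi> * ennreal (m \<xi> powr r) \<partial>lborel)" if
          [measurable]: "H \<in> borel_measurable borel" for H
  proof -
    have "(\<integral>\<^sup>+\<tau>. ?w \<tau> * (\<integral>\<^sup>+\<xi>.
        H \<xi> * ennreal (1 / (4 * \<tau> + m \<xi>)) \<partial>lborel) \<partial>lborel)
      = (\<integral>\<^sup>+\<tau>. (\<integral>\<^sup>+\<xi>.
          ?w \<tau> * (H \<xi> * ennreal (1 / (4 * \<tau> + m \<xi>))) \<partial>lborel) \<partial>lborel)"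
      by (intro nn_integral_cong nn_integral_cmult[symmetric]) measurable
    also have "\<dots> = (\<integral>\<^sup>+\<xi>. (\<integral>\<^sup>+\<tau>.
        ?w \<tau> * (H \<xi> * ennreal (1 / (4 * \<tau> + m \<xi>))) \<partial>lborel) \<partial>lborel)"
      by (rule lborel_pair.Fubini') measurable
    also have "\<dots> = (\<integral>\<^sup>+\<xi>. H \<xi> * (ennreal (m \<xi> powr r) * ?c) \<partial>lborel)"
      by (intro nn_integral_cong subordination_scaled m)
    also have "\<dots> = (\<integral>\<^sup>+\<xi>. ?c * (H \<xi> * ennreal (m \<xi> powr r))
        \<partial>lborel)" by (simp add: mult_ac)
    also have "\<dots> = ?c * (\<integral>\<^sup>+\<xi>.
        H \<xi> * ennreal (m \<xi> powr r) \<partial>lborel)" by (rule nn_integral_cmult) measurable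
    finally show ?thesis .
  qed
  have "?c * (\<integral>\<^sup>+\<xi>. F \<xi> * ennreal (m \<xi> powr r) \<partial>lborel)
    = (\<integral>\<^sup>+\<tau>. ?w \<tau> * (\<integral>\<^sup>+\<xi>. F \<xi> * ennreal (1 / (4 * \<tau>
        + m \<xi>)) \<partial>lborel) \<partial>lborel)"
    by (rule swap[symmetric]) measurable
  also have "\<dots> \<le> (\<integral>\<^sup>+\<tau>. C * (?w \<tau> * (\<integral>\<^sup>+\<xi>.
      G \<xi> * ennreal (1 / (4 * \<tau> + m \<xi>)) \<partial>lborel))
      + ?w \<tau> * (E * ennreal (1 / (4 * \<tau> + b))) \<partial>lborel)"
  proof (rule nn_integral_mono)
    fix \<tau> :: real
    show "?w \<tau> * (\<integral>\<^sup>+\<xi>. F \<xi> * ennreal (1 / (4 * \<tau>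
        + m \<xi>)) \<partial>lborel)
      \<le> C * (?w \<tau> * (\<integral>\<^sup>+\<xi>. G \<xi> * ennreal (1 / (4 * \<tau>
          + m \<xi>)) \<partial>lborel)) + ?w \<tau> * (E * ennreal (1 / (4 * \<tau> + b)))"
    proof (cases "0 < \<tau>")
      case True
      from mult_left_mono[OF le[OF True], of "?w \<tau>"] show ?thesis
        by (simp add: distrib_left mult_ac)
    qed simp
  qed
  also have "\<dots> = C * (\<integral>\<^sup>+\<tau>. ?w \<tau> * (\<integral>\<^sup>+\<xi>.
      G \<xi> * ennreal (1 / (4 * \<tau> + m \<xi>)) \<partial>lborel) \<partial>lborel)
      + (\<integral>\<^sup>+\<tau>. ?w \<tau> * (E * ennreal (1 / (4 * \<tau> + b))) \<partial>lborel)"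
    by (subst nn_integral_add, measurable, subst nn_integral_cmult, measurable)
  also have "\<dots> = C * (?c * (\<integral>\<^sup>+\<xi>.
      G \<xi> * ennreal (m \<xi> powr r) \<partial>lborel)) + E * (ennreal (b powr r) * ?c)"
    unfolding subordination_scaled[OF b] by (subst swap) measurable
  also have "\<dots> = ?c * (C * (\<integral>\<^sup>+\<xi>.
      G \<xi> * ennreal (m \<xi> powr r) \<partial>lborel) + E * ennreal (b powr r))"
    by (simp add: distrib_left mult_ac)
  finally show ?thesis
    using subordination_const_pos[of r] subordination_const_finite[OF r]
    by (simp add: ennreal_mult_le_mult_iff)
qed

section \<open>The resolvent on the Fourier side\<close>

lemma integrable_weighted_square:
  fixes F :: "real \<Rightarrow> complex" and w :: "real \<Rightarrow> real"
  assumes [measurable]: "F \<in> borel_measurable borel" "w \<in> borel_measurable borel"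
    and F: "\<And>\<xi>. norm (F \<xi>) \<le> K / (1 + \<xi>\<^sup>2)" and w: "\<And>\<xi>.
        \<bar>w \<xi>\<bar> \<le> c * (1 + \<xi>\<^sup>2)"
  shows "integrable lborel (\<lambda>\<xi>. w \<xi> * (norm (F \<xi>))\<^sup>2)"
proof (rule Bochner_Integration.integrable_bound[OF integrable_one_plus_square[of "c * K\<^sup>2"]])
  have "\<bar>w \<xi>\<bar> * (norm (F \<xi>))\<^sup>2 \<le> c * K\<^sup>2 / (1 + \<xi>\<^sup>2)" for \<xi>
  proof -
    have "\<bar>w \<xi>\<bar> * (norm (F \<xi>))\<^sup>2
        \<le> (c * (1 + \<xi>\<^sup>2)) * (K / (1 + \<xi>\<^sup>2))\<^sup>2"
      using F[of \<xi>] w[of \<xi>] by (intro mult_mono power_mono) auto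
    also have "\<dots> = c * K\<^sup>2 / (1 + \<xi>\<^sup>2)"
    proof -
      have "1 + \<xi>\<^sup>2 \<noteq> 0" using one_plus_square_pos[of \<xi>] by linarith
      then show ?thesis by (simp add: power2_eq_square)
    qed
    finally show ?thesis .
  qed
  then show "AE \<xi> in lborel. norm (w \<xi> * (norm (F \<xi>))\<^sup>2)
      \<le> norm (c * K\<^sup>2 / (1 + \<xi>\<^sup>2))"
    by (intro AE_I2) (simp only: real_norm_def abs_mult abs_power2 order_trans[OF _ abs_ge_self])
qed measurable

text \<open>For the bounded solution \<open>v\<close> of \<open>v' = 2\<kappa> v - U\<close>, these are
  \<open>2\<pi>\<close> times \<open>\<integral>v\<^sup>2\<close> and \<open>\<integral>(v')\<^sup>2\<close> on
  the Fourier side.\<close>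

abbreviation low_energy :: "real \<Rightarrow> (real \<Rightarrow> real) \<Rightarrow> real" where
  "low_energy \<kappa> U \<equiv> (LINT \<xi>|lborel. spectrum U \<xi> / (4 * \<kappa>\<^sup>2
      + \<xi>\<^sup>2))"

abbreviation high_energy :: "real \<Rightarrow> (real \<Rightarrow> real) \<Rightarrow> real" where
  "high_energy \<kappa> U \<equiv> (LINT \<xi>|lborel. \<xi>\<^sup>2 * spectrum U \<xi> / (4 *
      \<kappa>\<^sup>2 + \<xi>\<^sup>2))"

locale potential =
  fixes U U' U'' :: "real \<Rightarrow> real"
  assumes dU: "\<And>x. (U has_real_derivative U' x) (at x)" "\<And>x. (U' has_real_derivative U'' x) (at x)"
    and decU: "decaying U" "decaying U'" "decaying U''"
begin

lemma fourier_meas [measurable]: "fourier U \<in> borel_measurable borel"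
  by (rule fourier_measurable[OF decaying_measurable[OF decU(1)]])

lemma fourier_bound:
  obtains K where "\<And>\<xi>. norm (fourier U \<xi>) \<le> K / (1 + \<xi>\<^sup>2)"
  using fourier_decay[OF dU decU] by blast

lemma fourier_quadratic_bound:
  assumes "\<And>x. \<bar>U x\<bar> \<le> \<epsilon> / (1 + x\<^sup>2)" "\<And>x. \<bar>U'' x\<bar>
      \<le> \<epsilon> / (1 + x\<^sup>2)"
  shows "norm (fourier U \<xi>) \<le> (2 * pi * \<epsilon>) / (1 + \<xi>\<^sup>2)"
proof -
  have "(LINT x|lborel. \<bar>U x\<bar> + \<bar>U'' x\<bar>)
      \<le> (LINT x|lborel. (2 * \<epsilon>) / (1 + x\<^sup>2))"
  proof (rule integral_mono[OF decaying_integrable integrable_one_plus_square])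
    show "decaying (\<lambda>x. \<bar>U x\<bar> + \<bar>U'' x\<bar>)" by (intro decaying_add decaying_abs decU)
    show "\<bar>U x\<bar> + \<bar>U'' x\<bar> \<le> (2 * \<epsilon>) / (1 + x\<^sup>2)" for x
      using assms(1)[of x] assms(2)[of x] by simp
  qed
  then have "(LINT x|lborel. \<bar>U x\<bar> + \<bar>U'' x\<bar>) / (1 + \<xi>\<^sup>2)
      \<le> (2 * pi * \<epsilon>) / (1 + \<xi>\<^sup>2)"
    unfolding integral_one_plus_square by (intro divide_right_mono) (auto simp: mult_ac)
  with fourier_decay[OF dU decU] show ?thesis by (rule order_trans)
qed

lemma weighted_integrable:
  assumes "w \<in> borel_measurable borel" "\<And>\<xi>. \<bar>w \<xi>\<bar> \<le> c * (1 + \<xi>\<^sup>2)"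
  shows "integrable lborel (\<lambda>\<xi>. w \<xi> * spectrum U \<xi>)"
  by (rule fourier_bound) (rule integrable_weighted_square[OF fourier_meas assms(1) _ assms(2)])

lemma fourier_integrable_U: "integrable lborel (fourier U)"
proof -
  obtain K where K: "\<And>\<xi>. norm (fourier U \<xi>) \<le> K / (1 + \<xi>\<^sup>2)" using fourier_bound
      by blast
  show ?thesis
    by (rule Bochner_Integration.integrable_bound[OF integrable_one_plus_square[of K]])
      (use order_trans[OF K abs_ge_self] in simp_all)
qed

lemma mass_fourier: "2 * pi * L2sq U = (LINT \<xi>|lborel. spectrum U \<xi>)"
  by (rule plancherel[OF decU(1) fourier_integrable_U])

context
  fixes \<kappa> :: real and v :: "real \<Rightarrow> real"
  assumes \<kappa>: "1 \<le> \<kappa>" and v: "\<And>x. (v has_real_derivative 2 * \<kappa> * v x - U x)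
      (at x)" "decaying v"
begin

lemma dec_v': "decaying (\<lambda>x. 2 * \<kappa> * v x - U x)" by (intro decaying_diff decaying_cmult v decU)

lemma fourier_resolvent: "(2 * \<kappa> - \<i> * \<xi>) * fourier v \<xi> = fourier U \<xi>"
proof -
  have "fourier (\<lambda>x. 2 * \<kappa> * v x - 1 * U x) \<xi>
      = complex_of_real (2 * \<kappa>) * fourier v \<xi> - complex_of_real 1 * fourier U \<xi>"
    by (intro fourier_lincomb decaying_integrable v decU)
  then have "fourier (\<lambda>x. 2 * \<kappa> * v x - U x) \<xi>
      = 2 * \<kappa> * fourier v \<xi> - fourier U \<xi>" by simp
  then show ?thesis using fourier_derivative[OF v dec_v', of \<xi>] by (simp add: algebra_simps)
qed

text \<open>The equation for \<open>v\<close> says that \<open>2\<kappa> - \<i>\<xi>\<close> times the transform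
  of \<open>v\<close> is the transform of \<open>U\<close>.\<close>

lemma norm_fourier_resolvent: "spectrum v \<xi> = spectrum U \<xi> / (4 * \<kappa>\<^sup>2 + \<xi>\<^sup>2)"
proof -
  have "(norm (2 * \<kappa> - \<i> * \<xi>))\<^sup>2 = 4 * \<kappa>\<^sup>2 + \<xi>\<^sup>2"
      by (simp add: cmod_power2)
  moreover have "0 < 4 * \<kappa>\<^sup>2 + \<xi>\<^sup>2" using \<kappa> by (intro add_pos_nonneg) auto
  ultimately show ?thesis
    unfolding fourier_resolvent[symmetric, of \<xi>] norm_mult power_mult_distrib by simp
qed

lemma denominator_ge: "1 \<le> 4 * \<kappa>\<^sup>2 + \<xi>\<^sup>2"
proof -
  have "1 \<le> \<kappa>\<^sup>2" using \<kappa> by (simp add: one_le_power)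
  then show ?thesis using zero_le_power2[of \<xi>] by linarith
qed

lemma norm_fourier_v_le: "norm (fourier v \<xi>) \<le> norm (fourier U \<xi>)"
proof (rule power2_le_imp_le)
  show "spectrum v \<xi> \<le> spectrum U \<xi>"
    unfolding norm_fourier_resolvent using denominator_ge[of \<xi>]
    by (simp add: divide_le_eq mult_le_cancel_left1)
qed simp

lemma fourier_meas_v [measurable]: "fourier v \<in> borel_measurable borel"
  by (rule fourier_measurable[OF decaying_measurable[OF v(2)]])

lemma fourier_integrable_v: "integrable lborel (fourier v)"
  by (rule Bochner_Integration.integrable_bound[OF fourier_integrable_U]) (simp_all add: norm_fourier_v_le)

lemma resolvent_L2_fourier:
  "2 * pi * L2sq v = low_energy \<kappa> U"
  unfolding plancherel[OF v(2) fourier_integrable_v] norm_fourier_resolvent ..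

lemma resolvent_derivative_L2_fourier:
  "2 * pi * (LINT x|lborel. (2 * \<kappa> * v x - U x)\<^sup>2) = high_energy \<kappa> U"
proof -
  have sq: "spectrum (\<lambda>x. 2 * \<kappa> * v x - U x) \<xi>
      = \<xi>\<^sup>2 * spectrum U \<xi> / (4 * \<kappa>\<^sup>2 + \<xi>\<^sup>2)" for \<xi>
    unfolding fourier_derivative[OF v dec_v', of \<xi>]
    by (simp add: norm_mult power_mult_distrib norm_fourier_resolvent)
  have "integrable lborel (fourier (\<lambda>x. 2 * \<kappa> * v x - U x))"
  proof (rule Bochner_Integration.integrable_bound[OF fourier_integrable_U])
    show "fourier (\<lambda>x. 2 * \<kappa> * v x - U x) \<in> borel_measurable lborel"
      using fourier_measurable[OF decaying_measurable[OF dec_v']] by simp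
    have "norm (fourier (\<lambda>x. 2 * \<kappa> * v x - U x) \<xi>) \<le> norm (fourier U \<xi>)" for \<xi>
    proof (rule power2_le_imp_le)
      have "\<xi>\<^sup>2 * spectrum U \<xi> \<le> (4 * \<kappa>\<^sup>2 + \<xi>\<^sup>2) * spectrum U \<xi>"
        by (intro mult_right_mono) auto
      then show "spectrum (\<lambda>x. 2 * \<kappa> * v x - U x) \<xi> \<le> spectrum U \<xi>"
        unfolding sq using denominator_ge[of \<xi>] by (subst divide_le_eq) (auto simp: mult.commute)
    qed simp
    then show "AE \<xi> in lborel. norm (fourier (\<lambda>x. 2 * \<kappa> * v x - U x) \<xi>)
        \<le> norm (fourier U \<xi>)" by simp
  qed
  from plancherel[OF dec_v' this] show ?thesis unfolding sq .
qed

text \<open>Fourier inversion bounds \<open>v\<close> by the integral of the modulus of its transform, and the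
  inequality \<open>2ab \<le> a\<^sup>2 + b\<^sup>2\<close> bounds that by the weighted norm of \<open>U\<close>
  and the integral of \<open>m powr (- s) / (4\<kappa>\<^sup>2 + \<xi>\<^sup>2)\<close>, where \<open>m =
  4\<kappa>0\<^sup>2 + \<xi>\<^sup>2\<close>. For \<open>s > -1/8\<close> this last integrand is at most
  \<open>\<kappa>0 powr (-1/4) * (1 + \<xi>\<^sup>2) powr (-3/4)\<close>, hence the smallness.\<close>

lemma resolvent_small:
  assumes s: "- (1/8) < s" "s \<le> 0" and \<kappa>0: "1 \<le> \<kappa>0" "\<kappa>0 \<le> \<kappa>"
    and B: "(LINT \<xi>|lborel. (4 * \<kappa>0\<^sup>2 + \<xi>\<^sup>2) powr s * spectrum U \<xi>)
        \<le> B" "0 \<le> B"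
    and big: "(B + 1) * bracket_mass \<le> \<kappa>0 powr (1/4)"
  shows "\<bar>v x\<bar> \<le> 1/4"
proof -
  define m where "m \<xi> = 4 * \<kappa>0\<^sup>2 + \<xi>\<^sup>2" for \<xi> :: real
  have k1: "1 \<le> \<kappa>0\<^sup>2" using \<kappa>0 by (simp add: one_le_power)
  have m1: "1 \<le> m \<xi>" and mk: "\<kappa>0\<^sup>2 \<le> m \<xi>" and mx: "1 + \<xi>\<^sup>2
      \<le> m \<xi>" for \<xi>
    using k1 zero_le_power2[of \<xi>] unfolding m_def by linarith+
  have mle: "m \<xi> \<le> 4 * \<kappa>\<^sup>2 + \<xi>\<^sup>2" for \<xi>
    using \<kappa>0 by (simp add: m_def power_mono)
  let ?S = "\<lambda>\<xi>. m \<xi> powr s * spectrum U \<xi>"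
  let ?J = "\<lambda>\<xi>::real. (1 + \<xi>\<^sup>2) powr (-3/4)"
  define q where "q = \<kappa>0 powr (-1/4)"
  have q: "0 < q" "(B + 1) * q * bracket_mass \<le> 1"
  proof -
    show "0 < q" using \<kappa>0 by (simp add: q_def)
    have "((B + 1) * bracket_mass) * q \<le> \<kappa>0 powr (1/4) * q"
      using big \<open>0 < q\<close> by (intro mult_right_mono) auto
    also have "\<dots> = 1" using \<kappa>0 by (simp add: q_def flip: powr_add)
    finally show "(B + 1) * q * bracket_mass \<le> 1" by (simp add: mult_ac)
  qed
  have iS: "integrable lborel ?S"
  proof (rule weighted_integrable[where c=1])
    show "\<bar>m \<xi> powr s\<bar> \<le> 1 * (1 + \<xi>\<^sup>2)" for \<xi>
    proof -
      have "m \<xi> powr s \<le> m \<xi> powr 0" using s m1 by (intro powr_mono) auto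
      then show ?thesis using m1[of \<xi>] by (simp add: add_increasing2)
    qed
  qed (simp add: m_def)
  have pt: "norm (fourier v \<xi>) \<le> ?S \<xi> / (2 * (B + 1)) + (B + 1) * q / 2 * ?J \<xi>" for \<xi>
  proof -
    define b where "b = 4 * \<kappa>\<^sup>2 + \<xi>\<^sup>2"
    have b: "m \<xi> \<le> b" "1 \<le> b" using mle[of \<xi>] m1[of \<xi>] by (auto simp: b_def)
    define y where "y = norm (fourier v \<xi>)"
    have y2: "spectrum U \<xi> = b * y\<^sup>2"
      using norm_fourier_resolvent[of \<xi>] b by (simp add: y_def b_def)
    have J: "1 \<le> q * ?J \<xi> * (m \<xi> powr s * b)"
    proof -
      have "m \<xi> powr s * m \<xi> \<le> m \<xi> powr s * b" using b by (intro mult_left_mono) auto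
      moreover have "m \<xi> powr s * m \<xi> = m \<xi> powr (s + 1)"
        using m1[of \<xi>] by (simp add: powr_add)
      moreover have "m \<xi> powr (7/8) \<le> m \<xi> powr (s + 1)" using s m1[of \<xi>]
          by (intro powr_mono) auto
      moreover have "m \<xi> powr (7/8) = m \<xi> powr (1/8) * m \<xi> powr (3/4)" by (simp flip: powr_add)
      moreover have "\<kappa>0 powr (1/4) * (1 + \<xi>\<^sup>2) powr (3/4)
          \<le> m \<xi> powr (1/8) * m \<xi> powr (3/4)"
      proof -
        have "\<kappa>0 powr (1/4) = (\<kappa>0\<^sup>2) powr (1/8)"
          using \<kappa>0 by (simp add: powr_powr flip: powr_numeral)
        then show ?thesis using mk[of \<xi>] mx[of \<xi>] k1 by (auto intro!: mult_mono powr_mono2)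
      qed
      ultimately have "\<kappa>0 powr (1/4) * (1 + \<xi>\<^sup>2) powr (3/4) \<le> m \<xi> powr s * b"
          by linarith
      then have "(q * ?J \<xi>) * (\<kappa>0 powr (1/4) * (1 + \<xi>\<^sup>2) powr (3/4))
          \<le> (q * ?J \<xi>) * (m \<xi> powr s * b)"
        using q by (intro mult_left_mono) auto
      moreover have "(q * ?J \<xi>) * (\<kappa>0 powr (1/4) * (1 + \<xi>\<^sup>2) powr (3/4)) = 1"
      proof -
        have 1: "q * \<kappa>0 powr (1/4) = 1" using \<kappa>0 by (simp add: q_def flip: powr_add)
        have "1 + \<xi>\<^sup>2 \<noteq> 0" using one_plus_square_pos[of \<xi>] by linarith
        then have 2: "?J \<xi> * (1 + \<xi>\<^sup>2) powr (3/4) = 1" by (simp flip: powr_add)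
        have "(q * ?J \<xi>) * (\<kappa>0 powr (1/4) * (1 + \<xi>\<^sup>2) powr (3/4))
          = (q * \<kappa>0 powr (1/4)) * (?J \<xi> * (1 + \<xi>\<^sup>2) powr (3/4))" by (simp only: mult_ac)
        then show ?thesis unfolding 1 2 by simp
      qed
      ultimately show ?thesis by simp
    qed
    define P where "P = m \<xi> powr s * b"
    define Q where "Q = q * ?J \<xi>"
    have PQ: "1 \<le> Q * P" "0 \<le> P" "0 \<le> Q" using J q b by (auto simp: P_def Q_def mult.assoc)
    have "0 \<le> (P * y / (B + 1)) * y + Q * (B + 1) - 2 * y"
    proof -
      have y0: "0 \<le> y" by (simp add: y_def)
      have B1: "0 < B + 1" using B(2) by simp
      have "1 \<le> sqrt (Q * P)" using PQ by simp
      then have "2 * y \<le> 2 * y * sqrt (Q * P)" using y0 by (simp add: mult_le_cancel_left1)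
      also have "\<dots> = 2 * ((sqrt P * y / sqrt (B + 1)) * (sqrt Q * sqrt (B + 1)))"
        using B1 by (simp add: real_sqrt_mult)
      also have "\<dots> \<le> (sqrt P * y / sqrt (B + 1))\<^sup>2 + (sqrt Q * sqrt (B + 1))\<^sup>2"
        by (rule two_mult_le_sum_squares)
      also have "\<dots> = (P * y / (B + 1)) * y + Q * (B + 1)"
        using PQ B1 by (simp add: power_mult_distrib power_divide) (simp add: power2_eq_square)
      finally show ?thesis by simp
    qed
    moreover have "?S \<xi> / (2 * (B + 1)) + (B + 1) * q / 2 * ?J \<xi>
        = ((P * y / (B + 1)) * y + Q * (B + 1)) / 2"
    proof -
      define D where "D = B + 1"
      have "?S \<xi> = P * y * y" unfolding y2 P_def by (simp add: power2_eq_square)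
      then show ?thesis unfolding D_def[symmetric] Q_def by (simp add: add_divide_distrib mult_ac)
    qed
    ultimately show ?thesis unfolding y_def[symmetric] by (simp only:) simp
  qed
  have "2 * pi * \<bar>v x\<bar> \<le> (LINT \<xi>|lborel. norm (fourier v \<xi>))"
    by (rule fourier_sup_bound[OF v(2) fourier_integrable_v])
  also have "\<dots> \<le> (LINT \<xi>|lborel. ?S \<xi> / (2 * (B + 1)) + (B + 1) * q / 2 * ?J \<xi>)"
    using integrable_norm[OF fourier_integrable_v] iS integrable_bracket_powr pt
    by (intro integral_mono) auto
  also have "\<dots> = (LINT \<xi>|lborel. ?S \<xi>) / (2 * (B + 1)) + (B + 1) * q / 2 * bracket_mass"
    using iS integrable_bracket_powr by (simp add: bracket_mass_def)
  also have "\<dots> \<le> 1/2 + 1/2"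
  proof (rule add_mono)
    show "(LINT \<xi>|lborel. ?S \<xi>) / (2 * (B + 1)) \<le> 1/2"
      using B unfolding m_def by (simp add: divide_le_eq)
    show "(B + 1) * q / 2 * bracket_mass \<le> 1/2" using q by simp
  qed
  finally have "2 * pi * \<bar>v x\<bar> \<le> 1" by simp
  moreover have "4 * \<bar>v x\<bar> \<le> 2 * pi * \<bar>v x\<bar>"
    using pi_ge_two by (intro mult_right_mono) auto
  ultimately show ?thesis by simp
qed

end

end

section \<open>Conservation laws\<close>

lemma square_le_of_abs_le: "\<bar>a\<bar> \<le> K \<Longrightarrow> a\<^sup>2 \<le> (K::real)\<^sup>2"
  using power_mono[of "\<bar>a\<bar>" K 2] by simp

lemma abs_diff_sign_le:
  assumes "\<sigma> \<in> {1, -1}"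
  shows "\<bar>- a - 3/2 * \<sigma> * b\<bar> \<le> \<bar>a\<bar> + 3/2 * \<bar>b :: real\<bar>"
proof -
  have "\<bar>3/2 * \<sigma> * b\<bar> = 3/2 * \<bar>b\<bar>" using assms by (auto simp: abs_mult)
  then show ?thesis by linarith
qed

lemma quadratic_remainder:
  fixes f f' :: "real \<Rightarrow> real"
  assumes d: "\<And>x. (f has_real_derivative f' x) (at x)"
    and l: "\<And>x y. \<bar>x\<bar> \<le> r \<Longrightarrow> \<bar>y\<bar> \<le> r \<Longrightarrow>
        \<bar>f' x - f' y\<bar> \<le> M * \<bar>x - y\<bar>" "0 \<le> M"
    and ab: "\<bar>a\<bar> \<le> r" "\<bar>b\<bar> \<le> r"
  shows "\<bar>f a - f b - f' b * (a - b)\<bar> \<le> M * (a - b)\<^sup>2"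
proof -
  let ?S = "{-r..r} \<inter> cball b \<bar>a - b\<bar>"
  have "norm ((f a - f' b * a) - (f b - f' b * b)) \<le> (M * \<bar>a - b\<bar>) * norm (a - b)"
  proof (rule field_differentiable_bound[of ?S])
    show "convex ?S" by (intro convex_Int convex_real_interval convex_cball)
    show "((\<lambda>x. f x - f' b * x) has_field_derivative f' z - f' b) (at z within ?S)" for z
      by (rule has_field_derivative_at_within) (rule derivative_eq_intros d refl | simp)+
    show "norm (f' z - f' b) \<le> M * \<bar>a - b\<bar>" if "z \<in> ?S" for z
    proof -
      have "\<bar>f' z - f' b\<bar> \<le> M * \<bar>z - b\<bar>" using that ab by (intro l) auto
      also have "\<dots> \<le> M * \<bar>a - b\<bar>"
        using that l(2) by (intro mult_left_mono) (auto simp: dist_real_def)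
      finally show ?thesis by simp
    qed
  qed (use ab in \<open>auto simp: dist_real_def\<close>)
  then show ?thesis by (simp add: algebra_simps power2_eq_square abs_mult_self_eq)
qed

text \<open>The linear part of the increment of the density \<open>e\<close> is the exact derivative of the flux
  \<open>F\<close> and integrates to 0. The rest is of smaller order than \<open>t - t0\<close>, with a bound
  integrable in \<open>x\<close>.\<close>

lemma DERIV_zero_of_flux:
  fixes e :: "real \<Rightarrow> real \<Rightarrow> real"
  assumes t0: "t0 \<in> S" and e: "\<And>t. t \<in> S \<Longrightarrow> decaying (e t)"
    and F: "\<And>x. (F has_real_derivative f x) (at x)" "decaying F" "decaying f"
    and lin: "\<And>\<epsilon>. 0 < \<epsilon> \<Longrightarrow>
        \<forall>\<^sub>F t in at t0 within S. \<forall>x. \<bar>e t x - e t0 x - (t - t0) * f x\<bar>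
        \<le> \<epsilon> * \<bar>t - t0\<bar> / (1 + x\<^sup>2)"
  shows "((\<lambda>t. LINT x|lborel. e t x) has_real_derivative 0) (at t0 within S)"
proof -
  have z: "(LINT x|lborel. f x) = 0" using F by (rule decaying_integral_derivative)
  let ?I = "\<lambda>t. LINT x|lborel. e t x"
  have "((\<lambda>t. (?I t - ?I t0) / (t - t0)) \<longlongrightarrow> 0) (at t0 within S)"
  proof (rule tendstoI)
    fix r :: real assume r: "0 < r"
    define \<epsilon> where "\<epsilon> = r / (2 * pi)"
    have \<epsilon>: "0 < \<epsilon>" using r by (simp add: \<epsilon>_def)
    have "\<forall>\<^sub>F t in at t0 within S. t \<in> S \<and> t \<noteq> t0"
        by (auto simp: eventually_at_filter)
    with lin[OF \<epsilon>] show "\<forall>\<^sub>F t in at t0 within S. dist ((?I t - ?I t0) / (t - t0)) 0 < r"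
    proof eventually_elim
      case (elim t)
      then have t: "t \<in> S" "t \<noteq> t0" by auto
      note i = decaying_integrable[OF e[OF t(1)]] decaying_integrable[OF e[OF t0]] decaying_integrable[OF F(3)]
      have "?I t - ?I t0 = (LINT x|lborel. e t x - e t0 x - (t - t0) * f x)"
        using i z by simp
      also have "\<bar>\<dots>\<bar> \<le> (LINT x|lborel. \<epsilon> * \<bar>t - t0\<bar> / (1 + x\<^sup>2))"
        using i elim(1) by (intro order_trans[OF integral_abs_bound] integral_mono
            integrable_one_plus_square integrable_abs
            Bochner_Integration.integrable_diff integrable_mult_right) auto
      also have "\<dots> = \<epsilon> * \<bar>t - t0\<bar> * pi" by (rule integral_one_plus_square)
      finally have "\<bar>?I t - ?I t0\<bar> / \<bar>t - t0\<bar> \<le> \<epsilon> * pi"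
        using t by (simp add: divide_le_eq mult_ac)
      also have "\<epsilon> * pi < r" using r by (simp add: \<epsilon>_def)
      finally show ?case by (simp add: dist_real_def abs_divide)
    qed
  qed
  then show ?thesis by (simp add: has_field_derivative_iff)
qed

text \<open>\<open>W l\<close> stands for the \<open>l\<close>-th space derivative of the rescaled solution
  \<open>U\<close>. The uniform bounds and the continuity in time with weight \<open>1 / (1 + x\<^sup>2)\<close>
  are what continuity with values in the Schwartz space provides.\<close>

locale flow =
  fixes \<sigma> T :: real and W :: "nat \<Rightarrow> real \<Rightarrow> real \<Rightarrow> real" and K :: real
  assumes \<sigma>: "\<sigma> \<in> {1, -1}" and K: "0 < K"
    and space_deriv: "\<And>t l x. t \<in> {0..T} \<Longrightarrow> l < 3 \<Longrightarrow>
        (W l t has_real_derivative W (Suc l) t x) (at x)"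
    and cont3: "\<And>t. t \<in> {0..T} \<Longrightarrow> continuous_on UNIV (W 3 t)"
    and W_bound: "\<And>t l x. t \<in> {0..T} \<Longrightarrow> l \<le> 3 \<Longrightarrow>
        \<bar>W l t x\<bar> \<le> K / (1 + x\<^sup>2)"
    and W_cont: "\<And>t0 \<epsilon>. t0 \<in> {0..T} \<Longrightarrow> 0 < \<epsilon> \<Longrightarrow>
      \<forall>\<^sub>F t in at t0 within {0..T}. \<forall>l\<le>3. \<forall>x. \<bar>W l t x
          - W l t0 x\<bar> \<le> \<epsilon> / (1 + x\<^sup>2)"
    and time_deriv: "\<And>t x. t \<in> {0..T} \<Longrightarrow>
      ((\<lambda>\<tau>. W 0 \<tau> x) has_real_derivative - W 3 t x
          - 3/2 * \<sigma> * (W 0 t x)\<^sup>2 * W 1 t x) (at t within {0..T})"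
begin

definition "ut t x = - W 3 t x - 3/2 * \<sigma> * (W 0 t x)\<^sup>2 * W 1 t x"

lemma decW: "t \<in> {0..T} \<Longrightarrow> l \<le> 3 \<Longrightarrow> decaying (W l t)"
proof (rule decayingI[of _ K])
  assume t: "t \<in> {0..T}" and l: "l \<le> 3"
  show "continuous_on UNIV (W l t)"
  proof (cases "l = 3")
    case True then show ?thesis using cont3[OF t] by simp
  next
    case False then show ?thesis using l by (intro DERIV_continuous_on_UNIV[OF space_deriv[OF t]]) auto
  qed
qed (rule W_bound)

lemma W_bound': "t \<in> {0..T} \<Longrightarrow> l \<le> 3 \<Longrightarrow> \<bar>W l t x\<bar> \<le> K"
  using order_trans[OF W_bound quotient_one_plus_square_le] K by simp

lemma dW: "t \<in> {0..T} \<Longrightarrow> (W 0 t has_real_derivative W 1 t x) (at x)"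
  "t \<in> {0..T} \<Longrightarrow> (W 1 t has_real_derivative W 2 t x) (at x)"
  "t \<in> {0..T} \<Longrightarrow> (W 2 t has_real_derivative W 3 t x) (at x)"
  using space_deriv[of t 0 x] space_deriv[of t 1 x] space_deriv[of t 2 x]
  by (simp_all add: eval_nat_numeral)

lemma ut_cont:
  assumes t0: "t0 \<in> {0..T}" and \<epsilon>: "0 < \<epsilon>"
  shows "\<forall>\<^sub>F t in at t0 within {0..T}. \<forall>x. \<bar>ut t x - ut t0 x\<bar>
      \<le> \<epsilon> / (1 + x\<^sup>2)"
proof -
  define \<delta> where "\<delta> = \<epsilon> / (1 + 9 * K\<^sup>2)"
  have pos: "0 < 1 + 9 * K\<^sup>2" by (intro add_pos_nonneg) auto
  have \<delta>: "0 < \<delta>" using \<epsilon> pos by (simp add: \<delta>_def)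
  have "\<forall>\<^sub>F t in at t0 within {0..T}. t \<in> {0..T}" by (auto simp: eventually_at_filter)
  with W_cont[OF t0 \<delta>] show ?thesis
  proof eventually_elim
    case (elim t)
    show ?case
    proof
      fix x
      define D where "D = \<delta> / (1 + x\<^sup>2)"
      have d: "\<bar>W 0 t x - W 0 t0 x\<bar> \<le> D" "\<bar>W 1 t x - W 1 t0 x\<bar>
          \<le> D" "\<bar>W 3 t x - W 3 t0 x\<bar> \<le> D"
        using elim(1) by (auto simp: D_def)
      have b: "\<bar>W 0 t x\<bar> \<le> K" "\<bar>W 0 t0 x\<bar> \<le> K" "\<bar>W 1 t0 x\<bar> \<le> K"
        using W_bound'[OF elim(2)] W_bound'[OF t0] by auto
      have d0: "0 \<le> D" using \<delta> by (simp add: D_def)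
      have "(W 0 t x)\<^sup>2 * W 1 t x - (W 0 t0 x)\<^sup>2 * W 1 t0 x
        = (W 0 t x)\<^sup>2 * (W 1 t x - W 1 t0 x) + (W 0 t x - W 0 t0 x) * ((W 0 t x + W 0 t0 x) * W 1 t0 x)"
        by (simp add: power2_eq_square algebra_simps)
      also have "\<bar>\<dots>\<bar> \<le> K\<^sup>2 * D + D * ((K + K) * K)"
      proof (rule order_trans[OF abs_triangle_ineq add_mono])
        show "\<bar>(W 0 t x)\<^sup>2 * (W 1 t x - W 1 t0 x)\<bar> \<le> K\<^sup>2 * D"
          unfolding abs_mult using b d d0 K by (intro mult_mono) (auto intro: square_le_of_abs_le)
        have "\<bar>W 0 t x + W 0 t0 x\<bar> \<le> K + K" using b by linarith
        then show "\<bar>(W 0 t x - W 0 t0 x) * ((W 0 t x + W 0 t0 x) * W 1 t0 x)\<bar> \<le> D * ((K + K) * K)"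
          unfolding abs_mult using b d d0 K by (intro mult_mono) auto
      qed
      finally have cube: "\<bar>(W 0 t x)\<^sup>2 * W 1 t x - (W 0 t0 x)\<^sup>2 * W 1 t0 x\<bar>
          \<le> 3 * K\<^sup>2 * D"
        by (simp add: power2_eq_square algebra_simps)
      have "ut t x - ut t0 x = - (W 3 t x - W 3 t0 x) - 3/2 * \<sigma> * ((W 0 t x)\<^sup>2 * W 1 t x
          - (W 0 t0 x)\<^sup>2 * W 1 t0 x)"
        by (simp add: ut_def algebra_simps)
      also have "\<bar>\<dots>\<bar> \<le> \<bar>W 3 t x - W 3 t0 x\<bar>
          + 3/2 * \<bar>(W 0 t x)\<^sup>2 * W 1 t x - (W 0 t0 x)\<^sup>2 * W 1 t0 x\<bar>"
        by (rule abs_diff_sign_le[OF \<sigma>])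
      also have "\<dots> \<le> D + 3/2 * (3 * K\<^sup>2 * D)" by (intro add_mono mult_left_mono d cube) auto
      also have "\<dots> \<le> D * (1 + 9 * K\<^sup>2)" using mult_nonneg_nonneg[OF d0 zero_le_power2[of K]]
          by (simp add: algebra_simps)
      also have "\<dots> = \<epsilon> / (1 + x\<^sup>2)" using pos by (simp add: D_def \<delta>_def)
      finally show "\<bar>ut t x - ut t0 x\<bar> \<le> \<epsilon> / (1 + x\<^sup>2)" .
    qed
  qed
qed

lemma ut_bound:
  assumes "t \<in> {0..T}"
  shows "\<bar>ut t x\<bar> \<le> (K + 3/2 * K ^ 3) / (1 + x\<^sup>2)"
proof -
  have "\<bar>(W 0 t x)\<^sup>2 * W 1 t x\<bar> \<le> K\<^sup>2 * (K / (1 + x\<^sup>2))"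
    unfolding abs_mult using W_bound'[OF assms, of 0 x] W_bound[OF assms, of 1 x] K
    by (intro mult_mono) (auto intro: square_le_of_abs_le)
  moreover have "\<bar>W 3 t x\<bar> \<le> K / (1 + x\<^sup>2)" using W_bound[OF assms, of 3 x] by simp
  moreover have "\<bar>ut t x\<bar> \<le> \<bar>W 3 t x\<bar> + 3/2 * \<bar>(W 0 t x)\<^sup>2 * W 1 t x\<bar>"
    using abs_diff_sign_le[OF \<sigma>, of "W 3 t x" "(W 0 t x)\<^sup>2 * W 1 t x"]
        by (simp add: ut_def mult.assoc)
  ultimately have "\<bar>ut t x\<bar> \<le> K / (1 + x\<^sup>2) + 3/2 * (K\<^sup>2 * (K / (1 + x\<^sup>2)))"
    by (elim order_trans) (intro add_mono mult_left_mono; simp)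
  also have "\<dots> = (K + 3/2 * K ^ 3) / (1 + x\<^sup>2)"
      by (simp add: power2_eq_square power3_eq_cube add_divide_distrib)
  finally show ?thesis .
qed

definition "Lip = K + 3/2 * K ^ 3 + 1"

text \<open>The mean value theorem in time, applied at each \<open>x\<close>, together with
  \<open>ut_cont\<close>.\<close>

lemma increment:
  assumes t0: "t0 \<in> {0..T}" and \<epsilon>: "0 < \<epsilon>"
  shows "\<forall>\<^sub>F t in at t0 within {0..T}. \<forall>x. \<bar>W 0 t x - W 0 t0 x - (t
      - t0) * ut t0 x\<bar> \<le> \<epsilon> * \<bar>t - t0\<bar> / (1 + x\<^sup>2)
    \<and> \<bar>W 0 t x - W 0 t0 x\<bar> \<le> Lip * \<bar>t - t0\<bar> / (1 + x\<^sup>2)"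
proof -
  define \<delta> where "\<delta> = min \<epsilon> 1"
  have \<delta>: "0 < \<delta>" "\<delta> \<le> \<epsilon>" "\<delta> \<le> 1" using \<epsilon>
      by (auto simp: \<delta>_def)
  obtain d where d: "0 < d" "\<And>t x. t \<in> {0..T} \<Longrightarrow> t \<noteq> t0 \<Longrightarrow>
      dist t t0 < d \<Longrightarrow> \<bar>ut t x - ut t0 x\<bar> \<le> \<delta> / (1 + x\<^sup>2)"
    using ut_cont[OF t0 \<delta>(1)] unfolding eventually_at by blast
  let ?S = "{0..T} \<inter> ball t0 d"
  have P: "\<bar>ut t x - ut t0 x\<bar> \<le> \<delta> / (1 + x\<^sup>2)" if "t \<in> ?S" for t x
    using d(2)[of t x] that \<delta> by (cases "t = t0") (auto simp: dist_commute)
  have "\<forall>x. \<bar>W 0 t x - W 0 t0 x - (t - t0) * ut t0 x\<bar>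
      \<le> \<epsilon> * \<bar>t - t0\<bar> / (1 + x\<^sup>2)
    \<and> \<bar>W 0 t x - W 0 t0 x\<bar> \<le> Lip * \<bar>t - t0\<bar> / (1
        + x\<^sup>2)" if t: "t \<in> ?S" for t
  proof
    fix x
    have "norm ((W 0 t x - t * ut t0 x) - (W 0 t0 x - t0 * ut t0 x))
        \<le> \<delta> / (1 + x\<^sup>2) * norm (t - t0)"
    proof (rule field_differentiable_bound[of ?S])
      show "convex ?S" by (intro convex_Int convex_real_interval convex_ball)
      show "((\<lambda>\<tau>. W 0 \<tau> x - \<tau> * ut t0 x) has_field_derivative ut z x - ut t0 x)
          (at z within ?S)" if "z \<in> ?S" for z
      proof -
        have "((\<lambda>\<tau>. W 0 \<tau> x) has_real_derivative ut z x) (at z within ?S)"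
          using time_deriv[of z x] that by (auto simp: ut_def intro: DERIV_subset)
        from DERIV_diff[OF this DERIV_cmult_right[OF DERIV_ident, of "ut t0 x"]] show ?thesis by simp
      qed
      show "norm (ut z x - ut t0 x) \<le> \<delta> / (1 + x\<^sup>2)" if "z \<in> ?S" for z using P[OF that]
          by simp
    qed (use t t0 d in auto)
    then have *: "\<bar>W 0 t x - W 0 t0 x - (t - t0) * ut t0 x\<bar>
        \<le> \<delta> * \<bar>t - t0\<bar> / (1 + x\<^sup>2)"
      by (simp add: algebra_simps)
    have "\<delta> * \<bar>t - t0\<bar> / (1 + x\<^sup>2)
        \<le> \<epsilon> * \<bar>t - t0\<bar> / (1 + x\<^sup>2)"
      using \<delta> by (intro divide_right_mono mult_right_mono) auto
    moreover have "\<delta> * \<bar>t - t0\<bar> / (1 + x\<^sup>2)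
        \<le> 1 * \<bar>t - t0\<bar> / (1 + x\<^sup>2)"
      using \<delta> by (intro divide_right_mono mult_right_mono) auto
    moreover have "\<bar>(t - t0) * ut t0 x\<bar> \<le> (K + 3/2 * K ^ 3) * \<bar>t - t0\<bar> / (1
        + x\<^sup>2)"
      using mult_left_mono[OF ut_bound[OF t0, of x], of "\<bar>t - t0\<bar>"]
          by (simp add: abs_mult mult.commute)
    moreover have "Lip * \<bar>t - t0\<bar> / (1 + x\<^sup>2)
        = (K + 3/2 * K ^ 3) * \<bar>t - t0\<bar> / (1 + x\<^sup>2) + 1 * \<bar>t - t0\<bar> / (1 + x\<^sup>2)"
      by (simp add: Lip_def distrib_right add_divide_distrib)
    ultimately show "\<bar>W 0 t x - W 0 t0 x - (t - t0) * ut t0 x\<bar>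
        \<le> \<epsilon> * \<bar>t - t0\<bar> / (1 + x\<^sup>2)
      \<and> \<bar>W 0 t x - W 0 t0 x\<bar> \<le> Lip * \<bar>t - t0\<bar> / (1 + x\<^sup>2)" using *
          by linarith
  qed
  then show ?thesis unfolding eventually_at using d(1) by (intro exI[of _ d]) (auto simp: dist_commute)
qed

lemma small_time:
  assumes "0 < \<epsilon>" "0 \<le> c"
  shows "\<forall>\<^sub>F t in at t0 within S. c * (t - t0)\<^sup>2
      \<le> \<epsilon> * \<bar>t - (t0::real)\<bar>"
proof -
  have "\<forall>\<^sub>F t in at t0 within S. \<bar>t - t0\<bar> < \<epsilon> / (c + 1)"
    unfolding eventually_at using assms by (intro exI[of _ "\<epsilon> / (c + 1)"]) (auto simp: dist_real_def)
  then show ?thesis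
  proof eventually_elim
    case (elim t)
    have "c * \<bar>t - t0\<bar> \<le> (c + 1) * \<bar>t - t0\<bar>" by (intro mult_right_mono) auto
    also have "\<dots> \<le> \<epsilon>" using elim assms by (simp add: field_simps)
    finally have "c * \<bar>t - t0\<bar> * \<bar>t - t0\<bar> \<le> \<epsilon> * \<bar>t - t0\<bar>"
        by (intro mult_right_mono) auto
    then show ?case by (simp add: power2_eq_square mult.assoc abs_mult_self_eq)
  qed
qed

lemma square_quotient_le:
  assumes "\<bar>a\<bar> \<le> c / (1 + (x::real)\<^sup>2)"
  shows "a\<^sup>2 \<le> c\<^sup>2 / (1 + x\<^sup>2)"
proof -
  have c: "0 \<le> c"
    using order_trans[OF abs_ge_zero assms] divide_neg_pos[OF _ one_plus_square_pos[of x], of c] by linarith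
  have "a\<^sup>2 = \<bar>a\<bar> * \<bar>a\<bar>" by (simp add: power2_eq_square)
  also have "\<dots> \<le> c * (c / (1 + x\<^sup>2))"
    using assms order_trans[OF assms quotient_one_plus_square_le[OF c]] c by (intro mult_mono) auto
  finally show ?thesis by (simp add: power2_eq_square)
qed

theorem mass_conserved:
  assumes "t \<in> {0..T}"
  shows "L2sq (W 0 t) = (LINT x|lborel. (W 0 0 x)\<^sup>2)"
proof -
  have "((\<lambda>t. LINT x|lborel. (W 0 t x)\<^sup>2) has_real_derivative 0)
      (at t0 within {0..T})" if t0: "t0 \<in> {0..T}" for t0
  proof (rule DERIV_zero_of_flux[OF t0])
    let ?U = "W 0 t0"
    show "decaying (\<lambda>x. (W 0 t x)\<^sup>2)" if "t \<in> {0..T}" for t using decW[OF that]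
        by (intro decaying_power) auto
    show "((\<lambda>x. - 2 * (W 2 t0 x * ?U x) + (W 1 t0 x)\<^sup>2
        - 3/4 * \<sigma> * (?U x) ^ 4) has_real_derivative 2 * (ut t0 x * ?U x)) (at x)" for x
      by (rule derivative_eq_intros dW[OF t0] refl)+ (simp add: ut_def algebra_simps eval_nat_numeral)
    have d: "decaying (W 0 t0)" "decaying (W 1 t0)" "decaying (W 2 t0)" "decaying (W 3 t0)"
      using decW[OF t0] by simp_all
    have dP: "decaying (ut t0)"
    proof -
      have "decaying (\<lambda>x. - W 3 t0 x - (3/2 * \<sigma>) * ((?U x)\<^sup>2 * W 1 t0 x))"
        by (intro decaying_diff decaying_minus decaying_cmult d decaying_mult[OF d(2) decaying_power[OF
            d(1)]]) simp_all
      then show ?thesis unfolding ut_def[abs_def] by (simp only: mult.assoc)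
    qed
    show "decaying (\<lambda>x. - 2 * (W 2 t0 x * ?U x) + (W 1 t0 x)\<^sup>2 - 3/4 * \<sigma> * (?U x) ^ 4)"
      by (intro decaying_diff decaying_add decaying_cmult decaying_mult[OF d(1) d(3)] decaying_power d) simp_all
    show "decaying (\<lambda>x. 2 * (ut t0 x * ?U x))"
      by (intro decaying_cmult decaying_mult[OF d(1) dP])
    fix \<epsilon> :: real assume \<epsilon>: "0 < \<epsilon>"
    (* Half of \<epsilon> is for the quadratic term of the increment, half for the linear one. *)
    define \<delta> where "\<delta> = \<epsilon> / (4 * K)"
    have \<delta>: "0 < \<delta>" using \<epsilon> K by (simp add: \<delta>_def)
    have "0 < \<epsilon> / 2" using \<epsilon> by simp
    from increment[OF t0 \<delta>] small_time[OF this zero_le_power2[of Lip], of t0 "{0..T}"]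
    show "\<forall>\<^sub>F t in at t0 within {0..T}. \<forall>x. \<bar>(W 0 t x)\<^sup>2 - (?U x)\<^sup>2
        - (t - t0) * (2 * (ut t0 x * ?U x))\<bar> \<le> \<epsilon> * \<bar>t - t0\<bar> / (1 + x\<^sup>2)"
    proof eventually_elim
      case (elim t)
      show ?case
      proof
        fix x
        let ?D = "W 0 t x - ?U x"
        have 1: "\<bar>?D - (t - t0) * ut t0 x\<bar> \<le> \<delta> * \<bar>t - t0\<bar> / (1
            + x\<^sup>2)" and 2: "\<bar>?D\<bar> \<le> Lip * \<bar>t - t0\<bar> / (1 + x\<^sup>2)"
          using elim(1) by auto
        have "?D\<^sup>2 \<le> (Lip * \<bar>t - t0\<bar>)\<^sup>2 / (1 + x\<^sup>2)"
            by (rule square_quotient_le[OF 2])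
        also have "\<dots> \<le> (\<epsilon> / 2 * \<bar>t - t0\<bar>) / (1 + x\<^sup>2)"
          using elim(2) by (intro divide_right_mono) (auto simp: power_mult_distrib)
        finally have a: "?D\<^sup>2 \<le> (\<epsilon> / 2 * \<bar>t - t0\<bar>) / (1 + x\<^sup>2)" .
        have "\<bar>2 * ?U x * (?D - (t - t0) * ut t0 x)\<bar>
            \<le> (2 * K) * (\<delta> * \<bar>t - t0\<bar> / (1 + x\<^sup>2))"
          unfolding abs_mult using 1 W_bound'[OF t0, of 0 x] K by (intro mult_mono) auto
        also have "\<dots> = (2 * K * \<delta>) * \<bar>t - t0\<bar> / (1 + x\<^sup>2)"
            by (simp only: times_divide_eq_right mult.assoc)
        also have "2 * K * \<delta> = \<epsilon> / 2" using K by (simp add: \<delta>_def)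
        finally have b: "\<bar>2 * ?U x * (?D - (t - t0) * ut t0 x)\<bar>
            \<le> (\<epsilon> / 2 * \<bar>t - t0\<bar>) / (1 + x\<^sup>2)" .
        have "(W 0 t x)\<^sup>2 - (?U x)\<^sup>2 - (t - t0) * (2 * (ut t0 x * ?U x))
            = ?D\<^sup>2 + 2 * ?U x * (?D - (t - t0) * ut t0 x)"
          by (simp add: power2_eq_square algebra_simps)
        moreover have "\<epsilon> * \<bar>t - t0\<bar> / (1 + x\<^sup>2)
            = (\<epsilon> / 2 * \<bar>t - t0\<bar>) / (1 + x\<^sup>2)
            + (\<epsilon> / 2 * \<bar>t - t0\<bar>) / (1 + x\<^sup>2)"
          by (simp only: add_divide_distrib[symmetric]) simp
        ultimately show "\<bar>(W 0 t x)\<^sup>2 - (?U x)\<^sup>2 - (t - t0) * (2 * (ut t0 x * ?U x))\<bar>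
            \<le> \<epsilon> * \<bar>t - t0\<bar> / (1 + x\<^sup>2)"
          using a b zero_le_power2[of ?D] by linarith
      qed
    qed
  qed
  then obtain c where "\<forall>t\<in>{0..T}. L2sq (W 0 t) = c"
    using has_field_derivative_zero_constant[of "{0..T}" "\<lambda>t. LINT x|lborel. (W 0 t x)\<^sup>2"] by auto
  then show ?thesis using assms by auto
qed

text \<open>The time derivative of the angle has to be \<open>q\<close> (in the proof), which comes from the
  time component of the Lax pair: it solves the linearised angle equation \<open>q_x = 2\<kappa> cs \<sigma>
  \<phi> q - U_t\<close>. That the angle is differentiable in time is not known beforehand. But for \<open>D =
  \<phi> t - \<phi> t0\<close> and \<open>h = t - t0\<close> the function \<open>D - h q\<close> solves the same
  linear equation with an inhomogeneity of order \<open>h\<^sup>2\<close> plus the Taylor remainder of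
  \<open>U\<close>, so \<open>bounded_solution_decay\<close> shows that it is of smaller order than
  \<open>h\<close>. Finally \<open>sn \<sigma> \<phi> * q\<close> is the derivative of the flux displayed in the
  proof.\<close>

theorem charge_conserved:
  assumes \<kappa>: "2 \<le> \<kappa>" and \<phi>: "\<And>t. t \<in> {0..T} \<Longrightarrow>
      is_angle \<sigma> \<kappa> (W 0 t) (\<phi> t)" and t: "t \<in> {0..T}"
  shows "charge \<sigma> (\<phi> t) = charge \<sigma> (\<phi> 0)"
proof -
  have "((\<lambda>t. LINT x|lborel. vers \<sigma> (\<phi> t x)) has_real_derivative 0)
      (at t0 within {0..T})" if t0: "t0 \<in> {0..T}" for t0
  proof (rule DERIV_zero_of_flux[OF t0])
    let ?U = "W 0 t0" and ?S = "\<lambda>x. sn \<sigma> (\<phi> t0 x)" and ?C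
        = "\<lambda>x. cs \<sigma> (\<phi> t0 x)"
    have b: "\<bar>\<phi> t x\<bar> \<le> 1/2" if "t \<in> {0..T}" for t x
        using is_angle_bound[OF \<phi>[OF that]] .
    have dec: "decaying (\<phi> t)" if "t \<in> {0..T}" for t
        using is_angle_decaying[OF \<kappa> \<phi>[OF that] decW[OF that]] by simp
    show "decaying (\<lambda>x. vers \<sigma> (\<phi> t x))" if "t \<in> {0..T}" for t
      using \<sigma> dec[OF that] b[OF that] by (rule decaying_vers)
    have D\<phi>: "(\<phi> t0 has_real_derivative 2 * \<kappa> * ?S x - ?U x) (at x)" for x
      by (rule is_angle_DERIV[OF \<phi>[OF t0]])
    define q where "q x = 4 * \<kappa>\<^sup>2 * ?U x + W 2 t0 x + \<sigma> / 2 * (?U x) ^ 3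
        + 2 * \<kappa> * (?C x * W 1 t0 x)
      - (8 * \<kappa> ^ 3 * ?S x + \<sigma> * \<kappa> * (?S x * (?U x)\<^sup>2))" for x
    have d: "decaying (W 0 t0)" "decaying (W 1 t0)" "decaying (W 2 t0)" "decaying (W 3 t0)"
      using decW[OF t0] by simp_all
    have dS: "decaying ?S" using dec[OF t0] b[OF t0] by (rule decaying_sn)
    have Cb: "\<bar>?C x\<bar> \<le> 2" "3/4 \<le> ?C x" for x
        using abs_cs_minus_1_le[OF b[OF t0], of \<sigma> x] by linarith+
    have Cc: "continuous_on UNIV ?C" by (intro continuous_on_cs decaying_continuous dec t0)
    have dU2: "decaying (\<lambda>x. (?U x)\<^sup>2)" by (rule decaying_power[OF d(1)]) simp
    have dC: "decaying (\<lambda>x. ?C x * W 1 t0 x)" "decaying (\<lambda>x. ?C x * (?U x)\<^sup>2)"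
      by (rule decaying_mult_bounded[OF d(2) Cc Cb(1)], rule decaying_mult_bounded[OF dU2 Cc Cb(1)])
    have dq: "decaying q"
      unfolding q_def[abs_def]
      by (intro decaying_diff decaying_add decaying_cmult decaying_power d dC dS decaying_mult[OF dU2 dS]) simp
    have CS: "(?C x)\<^sup>2 = 1 - \<sigma> * (?S x)\<^sup>2" for x by (rule cs_sn_squared[OF \<sigma>])
    have Dq: "(q has_real_derivative 2 * \<kappa> * ?C x * q x - ut t0 x) (at x)" for x
    proof -
      have "(q has_real_derivative
        4 * \<kappa>\<^sup>2 * W 1 t0 x + W 3 t0 x + 3/2 * \<sigma> * (?U x)\<^sup>2 * W 1 t0 x
        + 2 * \<kappa> * (?C x * W 2 t0 x - \<sigma> * ?S x * (2 * \<kappa> * ?S x - ?U x) * W 1 t0 x)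
        - (8 * \<kappa> ^ 3 * (?C x * (2 * \<kappa> * ?S x - ?U x))
           + \<sigma> * \<kappa> * (?C x * (2 * \<kappa> * ?S x - ?U x) * (?U x)\<^sup>2
               + 2 * ?S x * ?U x * W 1 t0 x))) (at x)"
        unfolding q_def[abs_def]
        by (rule derivative_eq_intros \<sigma> D\<phi> dW[OF t0] refl)+ (simp add: algebra_simps
            power2_eq_square)
      moreover have "4 * \<kappa>\<^sup>2 * W 1 t0 x + W 3 t0 x + 3/2 * \<sigma> * (?U x)\<^sup>2 * W 1 t0 x
        + 2 * \<kappa> * (?C x * W 2 t0 x - \<sigma> * ?S x * (2 * \<kappa> * ?S x - ?U x) * W 1 t0 x)
        - (8 * \<kappa> ^ 3 * (?C x * (2 * \<kappa> * ?S x - ?U x))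
           + \<sigma> * \<kappa> * (?C x * (2 * \<kappa> * ?S x - ?U x) * (?U x)\<^sup>2
               + 2 * ?S x * ?U x * W 1 t0 x))
        = 2 * \<kappa> * ?C x * q x - ut t0 x + 4 * \<kappa>\<^sup>2 * W 1 t0 x * (1
            - \<sigma> * (?S x)\<^sup>2 - (?C x)\<^sup>2)"
        unfolding q_def ut_def by (simp add: algebra_simps power2_eq_square power3_eq_cube)
      ultimately show ?thesis using CS[of x] by simp
    qed
    show "((\<lambda>x. ?S x * W 1 t0 x + 1/2 * (?C x * (?U x)\<^sup>2)
        - 4 * \<kappa>\<^sup>2 * vers \<sigma> (\<phi> t0 x)) has_real_derivative ?S x * q x) (at x)" for x
      by (rule derivative_eq_intros \<sigma> D\<phi> dW[OF t0] refl)+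
        (simp add: q_def algebra_simps power2_eq_square power3_eq_cube)
    show "decaying (\<lambda>x. ?S x * W 1 t0 x + 1/2 * (?C x * (?U x)\<^sup>2)
        - 4 * \<kappa>\<^sup>2 * vers \<sigma> (\<phi> t0 x))"
      by (intro decaying_diff decaying_add decaying_cmult dC decaying_mult[OF d(2) dS] decaying_vers
          \<sigma> dec[OF t0] b[OF t0])
    show "decaying (\<lambda>x. ?S x * q x)" by (rule decaying_mult[OF dq dS])
    fix \<epsilon> :: real assume \<epsilon>: "0 < \<epsilon>"
    then have \<epsilon>2: "0 < \<epsilon> / 2" by simp
    define c where "c = (4 * \<kappa> + 2) * Lip\<^sup>2"
    have c: "0 \<le> c" using \<kappa> by (simp add: c_def)
    have ev: "\<forall>\<^sub>F t in at t0 within {0..T}. t \<in> {0..T}" by (auto simp: eventually_at_filter)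
    from increment[OF t0 \<epsilon>2] small_time[OF \<epsilon>2 c, of t0 "{0..T}"] ev
    show "\<forall>\<^sub>F t in at t0 within {0..T}. \<forall>x. \<bar>vers \<sigma> (\<phi> t x)
        - vers \<sigma> (\<phi> t0 x) - (t - t0) * (?S x * q x)\<bar>
        \<le> \<epsilon> * \<bar>t - t0\<bar> / (1 + x\<^sup>2)"
    proof eventually_elim
      case (elim t)
      let ?h = "t - t0" and ?D = "\<lambda>x. \<phi> t x - \<phi> t0 x"
      have t: "t \<in> {0..T}" using elim(3) .
      have DD: "(?D has_real_derivative 2 * \<kappa> * (sn \<sigma> (\<phi> t x) - ?S x) - (W 0 t x - ?U x))
          (at x)" for x
        using DERIV_diff[OF is_angle_DERIV[OF \<phi>[OF t]] D\<phi>, of x] by (simp add: algebra_simps)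
      have "\<exists>m. 3/4 \<le> m \<and> sn \<sigma> (\<phi> t x) - ?S x = m * ?D x" for x
      proof -
        obtain z where z: "\<bar>z\<bar> \<le> 1/2" "sn \<sigma> (\<phi> t x) - ?S x = cs \<sigma> z * ?D x"
          using sn_mvt[OF b[OF t] b[OF t0]] by blast
        have "3/4 \<le> cs \<sigma> z" using abs_cs_minus_1_le[OF z(1), of \<sigma>] by linarith
        with z(2) show ?thesis by (intro exI[of _ "cs \<sigma> z"] conjI)
      qed
      then obtain m where m: "\<And>x. 3/4 \<le> m x" "\<And>x. sn \<sigma> (\<phi> t x) - ?S x
          = m x * ?D x" by metis
      (* The mean value theorem makes the equation for the difference of two angles linear. *)
      have D: "\<bar>?D x\<bar> \<le> Lip * \<bar>?h\<bar> / (1 + x\<^sup>2)" for x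
      proof (rule bounded_solution_decay[where d="?D" and c="\<lambda>x. 2 * \<kappa> * m x", OF DD])
        show "\<bar>?D x\<bar> \<le> 1" for x using b[OF t, of x] b[OF t0, of x] by linarith
        show "2 \<le> 2 * \<kappa> * m x" for x
          using mult_mono[of 2 \<kappa> "3/4" "m x"] \<kappa> m(1)[of x] by simp
        show "\<bar>2 * \<kappa> * (sn \<sigma> (\<phi> t x) - ?S x) - (W 0 t x - ?U x)
            - 2 * \<kappa> * m x * ?D x\<bar> \<le> Lip * \<bar>?h\<bar> / (1 + x\<^sup>2)" for x
        proof -
          have "2 * \<kappa> * (sn \<sigma> (\<phi> t x) - ?S x) - (W 0 t x - ?U x)
              - 2 * \<kappa> * m x * ?D x = - (W 0 t x - ?U x)"
            unfolding m(2) by simp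
          then show ?thesis unfolding abs_minus_cancel using elim(1) by (simp only: abs_minus_cancel)
        qed
      qed
      have Lip_cs: "\<bar>cs \<sigma> x - cs \<sigma> y\<bar> \<le> 1 * \<bar>x - y\<bar>"
          if "\<bar>x\<bar> \<le> 1/2" "\<bar>y\<bar> \<le> 1/2" for x y
      proof -
        have "norm (cs \<sigma> x - cs \<sigma> y) \<le> 1 * norm (x - y)"
        proof (rule field_differentiable_bound[of "{-1/2..1/2}"])
          show "(cs \<sigma> has_field_derivative - \<sigma> * sn \<sigma> z) (at z within {-1/2..1/2})" for z
            using DERIV_cs[OF \<sigma> DERIV_ident] by simp
          show "norm (- \<sigma> * sn \<sigma> z) \<le> 1" if "z \<in> {-1/2..1/2}" for z
          proof -
            have z: "\<bar>z\<bar> \<le> 1/2" using that by auto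
            have "\<bar>sn \<sigma> z\<bar> \<le> 1" using abs_sn_le(1)[OF z, of \<sigma>] z by linarith
            then show ?thesis using \<sigma> by (auto simp: abs_mult)
          qed
        qed (use that in auto)
        then show ?thesis by simp
      qed
      have Lip_sn: "\<bar>sn \<sigma> x - sn \<sigma> y\<bar>
          \<le> 2 * \<bar>x - y\<bar>" if xy: "\<bar>x\<bar> \<le> 1/2" "\<bar>y\<bar> \<le> 1/2" for x y
      proof -
        obtain z where z: "\<bar>z\<bar> \<le> 1/2" "sn \<sigma> x - sn \<sigma> y
            = cs \<sigma> z * (x - y)" using sn_mvt[OF xy] by blast
        have "\<bar>cs \<sigma> z\<bar> \<le> 2" using abs_cs_minus_1_le[OF z(1), of \<sigma>] by linarith
        then show ?thesis unfolding z(2) abs_mult by (intro mult_right_mono) auto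
      qed
      have D2: "(?D x)\<^sup>2 \<le> Lip\<^sup>2 * ?h\<^sup>2 / (1 + x\<^sup>2)" for x
        using square_quotient_le[OF D[of x]] by (simp add: power_mult_distrib)
      have R1: "\<bar>sn \<sigma> (\<phi> t x) - ?S x - ?C x * ?D x\<bar> \<le> (?D x)\<^sup>2" for x
        using quadratic_remainder[of "sn \<sigma>" "cs \<sigma>" "1/2" 1, OF _ Lip_cs _ b[OF t,
            of x] b[OF t0, of x]] DERIV_sn[OF DERIV_ident]
        by simp
      have R2: "\<bar>vers \<sigma> (\<phi> t x) - vers \<sigma> (\<phi> t0 x) - ?S x * ?D x\<bar>
          \<le> 2 * (?D x)\<^sup>2" for x
        using quadratic_remainder[of "vers \<sigma>" "sn \<sigma>" "1/2" 2, OF _ Lip_sn _ b[OF t,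
            of x] b[OF t0, of x]] DERIV_vers[OF \<sigma> DERIV_ident]
        by simp
      obtain Kq where Kq: "\<And>x. \<bar>q x\<bar> \<le> Kq" using dq decayingE by blast
      (* q is the linear part of the difference: the remainder solves the linearised equation. *)
      have d: "\<bar>?D x - ?h * q x\<bar> \<le> (2 * \<kappa> * (Lip\<^sup>2 * ?h\<^sup>2)
          + \<epsilon> / 2 * \<bar>?h\<bar>) / (1 + x\<^sup>2)" for x
      proof (rule bounded_solution_decay[where c="\<lambda>x. 2 * \<kappa> * ?C x" and d="\<lambda>x. ?D x
          - ?h * q x"])
        show "((\<lambda>x. ?D x - ?h * q x) has_real_derivative 2 * \<kappa> * (sn \<sigma> (\<phi> t x)
            - ?S x) - (W 0 t x - ?U x)
            - ?h * (2 * \<kappa> * ?C x * q x - ut t0 x)) (at x)" for x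
          by (intro DERIV_diff DD DERIV_cmult Dq)
        show "\<bar>?D x - ?h * q x\<bar> \<le> 1 + \<bar>?h\<bar> * Kq" for x
        proof -
          have "\<bar>?h * q x\<bar> \<le> \<bar>?h\<bar> * Kq" unfolding abs_mult using Kq
              by (intro mult_left_mono) auto
          then show ?thesis using b[OF t, of x] b[OF t0, of x] by linarith
        qed
        show "2 \<le> 2 * \<kappa> * ?C x" for x
          using mult_mono[of 2 \<kappa> "3/4" "?C x"] \<kappa> Cb(2)[of x] by simp
        show "\<bar>2 * \<kappa> * (sn \<sigma> (\<phi> t x) - ?S x) - (W 0 t x - ?U x)
            - ?h * (2 * \<kappa> * ?C x * q x - ut t0 x)
            - 2 * \<kappa> * ?C x * (?D x - ?h * q x)\<bar>
                \<le> (2 * \<kappa> * (Lip\<^sup>2 * ?h\<^sup>2) + \<epsilon> / 2 * \<bar>?h\<bar>) / (1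
                + x\<^sup>2)" for x
        proof -
          have "2 * \<kappa> * (sn \<sigma> (\<phi> t x) - ?S x) - (W 0 t x - ?U x)
              - ?h * (2 * \<kappa> * ?C x * q x - ut t0 x)
            - 2 * \<kappa> * ?C x * (?D x - ?h * q x)
            = 2 * \<kappa> * (sn \<sigma> (\<phi> t x) - ?S x - ?C x * ?D x) - (W 0 t x - ?U x - ?h * ut t0 x)"
            by (simp add: algebra_simps)
          moreover have "\<bar>2 * \<kappa> * (sn \<sigma> (\<phi> t x) - ?S x - ?C x * ?D x)\<bar>
              \<le> 2 * \<kappa> * (Lip\<^sup>2 * ?h\<^sup>2 / (1 + x\<^sup>2))"
            unfolding abs_mult using order_trans[OF R1 D2, of x] \<kappa> by (intro mult_mono) auto
          moreover have "\<bar>W 0 t x - ?U x - ?h * ut t0 x\<bar>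
              \<le> \<epsilon> / 2 * \<bar>?h\<bar> / (1 + x\<^sup>2)" using elim(1) by auto
          moreover have "(2 * \<kappa> * (Lip\<^sup>2 * ?h\<^sup>2) + \<epsilon> / 2 * \<bar>?h\<bar>) / (1
              + x\<^sup>2)
             = 2 * \<kappa> * (Lip\<^sup>2 * ?h\<^sup>2 / (1 + x\<^sup>2))
                 + \<epsilon> / 2 * \<bar>?h\<bar> / (1 + x\<^sup>2)" by (simp add: add_divide_distrib)
          ultimately show ?thesis by linarith
        qed
      qed
      show ?case
      proof
        fix x
        have S1: "\<bar>?S x\<bar> \<le> 1" using abs_sn_le(1)[OF b[OF t0], of \<sigma> x] b[OF t0, of x]
            by linarith
        have "\<bar>?S x * (?D x - ?h * q x)\<bar> \<le> 1 * ((2 * \<kappa> * (Lip\<^sup>2 * ?h\<^sup>2)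
            + \<epsilon> / 2 * \<bar>?h\<bar>) / (1 + x\<^sup>2))"
          unfolding abs_mult using S1 d[of x] by (intro mult_mono) auto
        moreover have "vers \<sigma> (\<phi> t x) - vers \<sigma> (\<phi> t0 x) - ?h * (?S x * q x)
          = (vers \<sigma> (\<phi> t x) - vers \<sigma> (\<phi> t0 x) - ?S x * ?D x) + ?S x * (?D x - ?h * q x)"
          by (simp add: algebra_simps)
        moreover have "2 * (?D x)\<^sup>2 \<le> 2 * (Lip\<^sup>2 * ?h\<^sup>2 / (1 + x\<^sup>2))"
            using D2[of x] by simp
        ultimately have "\<bar>vers \<sigma> (\<phi> t x) - vers \<sigma> (\<phi> t0 x)
            - ?h * (?S x * q x)\<bar>
          \<le> 2 * (Lip\<^sup>2 * ?h\<^sup>2 / (1 + x\<^sup>2))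
              + (2 * \<kappa> * (Lip\<^sup>2 * ?h\<^sup>2) + \<epsilon> / 2 * \<bar>?h\<bar>) / (1 + x\<^sup>2)"
          using R2[of x] by linarith
        also have "\<dots> = ((2 * \<kappa> + 2) * Lip\<^sup>2 * ?h\<^sup>2
            + \<epsilon> / 2 * \<bar>?h\<bar>) / (1 + x\<^sup>2)"
          by (simp add: add_divide_distrib algebra_simps)
        also have "\<dots> \<le> (\<epsilon> / 2 * \<bar>?h\<bar> + \<epsilon> / 2 * \<bar>?h\<bar>) / (1
            + x\<^sup>2)"
        proof (intro divide_right_mono add_right_mono)
          have "(2 * \<kappa> + 2) * (Lip\<^sup>2 * ?h\<^sup>2)
              \<le> (4 * \<kappa> + 2) * (Lip\<^sup>2 * ?h\<^sup>2)" using \<kappa>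
              by (intro mult_right_mono) auto
          then show "(2 * \<kappa> + 2) * Lip\<^sup>2 * ?h\<^sup>2 \<le> \<epsilon> / 2 * \<bar>?h\<bar>"
              using elim(2) by (simp add: c_def mult.assoc)
        qed simp
        finally show "\<bar>vers \<sigma> (\<phi> t x) - vers \<sigma> (\<phi> t0 x)
            - ?h * (?S x * q x)\<bar> \<le> \<epsilon> * \<bar>?h\<bar> / (1 + x\<^sup>2)" by simp
      qed
    qed
  qed
  then obtain c where "\<forall>t\<in>{0..T}. (LINT x|lborel. vers \<sigma> (\<phi> t x)) = c"
    using has_field_derivative_zero_constant[of "{0..T}" "\<lambda>t. LINT x|lborel.
        vers \<sigma> (\<phi> t x)"] by auto
  then show ?thesis using t by (auto simp: charge_def)
qed

end

section \<open>Weighted norms at two times\<close>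

lemma subordinated_comparison_real:
  fixes f g m :: "real \<Rightarrow> real"
  assumes f: "integrable lborel f" "\<And>\<xi>. 0 \<le> f \<xi>" and g: "integrable lborel g" "\<And>\<xi>.
      0 \<le> g \<xi>"
    and m [measurable]: "m \<in> borel_measurable borel" and m1: "\<And>\<xi>. 1 \<le> m \<xi>"
    and b: "0 < b" and r: "-1 < r" "r < 0" and CE: "0 \<le> C" "0 \<le> E"
    and le: "\<And>\<tau>. 0 < \<tau> \<Longrightarrow>
        (LINT \<xi>|lborel. f \<xi> / (4 * \<tau> + m \<xi>))
        \<le> C * (LINT \<xi>|lborel. g \<xi> / (4 * \<tau> + m \<xi>)) + E / (4 * \<tau> + b)"
  shows "(LINT \<xi>|lborel. f \<xi> * m \<xi> powr r) \<le> C * (LINT \<xi>|lborel.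
      g \<xi> * m \<xi> powr r) + E * b powr r"
proof -
  have m0: "0 < m \<xi>" for \<xi> using m1[of \<xi>] by linarith
  have scaled: "(\<integral>\<^sup>+\<xi>. ennreal (h \<xi>) * ennreal (w \<xi>) \<partial>lborel)
      = ennreal (LINT \<xi>|lborel. h \<xi> * w \<xi>)"
    if h: "integrable lborel h" "\<And>\<xi>. 0 \<le> h \<xi>" and [measurable]: "w \<in> borel_measurable
        borel"
      and w: "\<And>\<xi>. 0 \<le> w \<xi>" "\<And>\<xi>. w \<xi> \<le> 1" for h w :: "real \<Rightarrow> real"
  proof -
    have [measurable]: "h \<in> borel_measurable borel" using borel_measurable_integrable[OF h(1)] by simp
    have "integrable lborel (\<lambda>\<xi>. h \<xi> * w \<xi>)"
      by (rule Bochner_Integration.integrable_bound[OF h(1)])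
        (use h w in \<open>auto simp: abs_mult intro!: AE_I2 mult_left_le\<close>)
    then show ?thesis
      using h w by (subst nn_integral_eq_integral[symmetric]) (auto simp: ennreal_mult)
  qed
  have w1: "1 / (4 * \<tau> + m \<xi>) \<le> 1" "0 \<le> 1 / (4 * \<tau> + m \<xi>)"
      if "0 < \<tau>" for \<tau> \<xi>
    using m1[of \<xi>] that by auto
  have w2: "m \<xi> powr r \<le> 1" for \<xi>
    using powr_mono[of r 0 "m \<xi>"] r m1[of \<xi>] by simp
  have fb: "(\<lambda>\<xi>. ennreal (f \<xi>)) \<in> borel_measurable borel" "(\<lambda>\<xi>.
      ennreal (g \<xi>)) \<in> borel_measurable borel"
    using borel_measurable_integrable[OF f(1)] borel_measurable_integrable[OF g(1)] by simp_all
  have "(\<integral>\<^sup>+\<xi>. ennreal (f \<xi>) * ennreal (m \<xi> powr r) \<partial>lborel)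
      \<le> ennreal C * (\<integral>\<^sup>+\<xi>. ennreal (g \<xi>) * ennreal (m \<xi> powr r)
          \<partial>lborel) + ennreal E * ennreal (b powr r)"
  proof (rule subordinated_comparison[OF fb m m0 b r])
    fix \<tau> :: real assume \<tau>: "0 < \<tau>"
    have "(\<integral>\<^sup>+\<xi>. ennreal (f \<xi>) * ennreal (1 / (4 * \<tau>
        + m \<xi>)) \<partial>lborel) = ennreal (LINT \<xi>|lborel. f \<xi> / (4 * \<tau> + m \<xi>))"
      using scaled[OF f, of "\<lambda>\<xi>. 1 / (4 * \<tau> + m \<xi>)"] w1[OF \<tau>] by simp
    also have "\<dots> \<le> ennreal (C * (LINT \<xi>|lborel. g \<xi> / (4 * \<tau> + m \<xi>))
        + E / (4 * \<tau> + b))"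
      by (rule ennreal_leI[OF le[OF \<tau>]])
    also have "\<dots> = ennreal C * ennreal (LINT \<xi>|lborel. g \<xi> / (4 * \<tau> + m \<xi>))
        + ennreal E * ennreal (1 / (4 * \<tau> + b))"
    proof -
      have "0 \<le> (LINT \<xi>|lborel. g \<xi> / (4 * \<tau> + m \<xi>))"
      proof (rule Bochner_Integration.integral_nonneg)
        show "0 \<le> g \<xi> / (4 * \<tau> + m \<xi>)" for \<xi> using g(2)[of \<xi>] m0[of \<xi>] \<tau>
            by simp
      qed
      then show ?thesis
        using CE \<tau> b by (simp add: ennreal_mult[symmetric])
    qed
    also have "ennreal (LINT \<xi>|lborel. g \<xi> / (4 * \<tau> + m \<xi>))
        = (\<integral>\<^sup>+\<xi>. ennreal (g \<xi>) * ennreal (1 / (4 * \<tau> + m \<xi>)) \<partial>lborel)"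
      using scaled[OF g, of "\<lambda>\<xi>. 1 / (4 * \<tau> + m \<xi>)"] w1[OF \<tau>] by simp
    finally show "(\<integral>\<^sup>+\<xi>. ennreal (f \<xi>) * ennreal (1 / (4 * \<tau>
        + m \<xi>)) \<partial>lborel)
      \<le> ennreal C * (\<integral>\<^sup>+\<xi>. ennreal (g \<xi>) * ennreal (1 / (4 * \<tau>
          + m \<xi>)) \<partial>lborel) + ennreal E * ennreal (1 / (4 * \<tau> + b))" .
  qed
  also have "(\<integral>\<^sup>+\<xi>. ennreal (f \<xi>) * ennreal (m \<xi> powr r) \<partial>lborel)
      = ennreal (LINT \<xi>|lborel. f \<xi> * m \<xi> powr r)"
    using scaled[OF f, of "\<lambda>\<xi>. m \<xi> powr r"] w2 by simp
  also have "(\<integral>\<^sup>+\<xi>. ennreal (g \<xi>) * ennreal (m \<xi> powr r) \<partial>lborel)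
      = ennreal (LINT \<xi>|lborel. g \<xi> * m \<xi> powr r)"
    using scaled[OF g, of "\<lambda>\<xi>. m \<xi> powr r"] w2 by simp
  also have "ennreal C * ennreal (LINT \<xi>|lborel. g \<xi> * m \<xi> powr r) + ennreal E * ennreal (b powr r)
    = ennreal (C * (LINT \<xi>|lborel. g \<xi> * m \<xi> powr r) + E * b powr r)"
    using CE g(2) by (simp add: ennreal_mult[symmetric])
  finally show ?thesis
    using CE g(2) by (subst (asm) ennreal_le_iff) auto
qed

context flow
begin

lemma potential: "t \<in> {0..T} \<Longrightarrow> potential (W 0 t) (W 1 t) (W 2 t)"
  using dW decW by unfold_locales auto

text \<open>Starting the weight at \<open>4\<kappa>0\<^sup>2\<close> instead of 1 means that its powers are
  superpositions of resolvents with parameter at least \<open>\<kappa>0\<close>: if \<open>\<kappa>\<^sup>2 =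
  \<kappa>0\<^sup>2 + \<tau>\<close> then \<open>4\<tau> + weight \<kappa>0 \<xi> = 4\<kappa>\<^sup>2 +
  \<xi>\<^sup>2\<close>.\<close>

definition "weight \<kappa>0 \<xi> = 4 * \<kappa>0\<^sup>2 + (\<xi>::real)\<^sup>2"

definition "energy s \<kappa>0 t = (LINT \<xi>|lborel. weight \<kappa>0 \<xi> powr s * spectrum (W 0 t) \<xi>)"

lemma angle_exists_at:
  assumes t: "t \<in> {0..T}" and s: "- (1/8) < s" "s \<le> 0" and \<kappa>: "2 \<le> \<kappa>0" "\<kappa>0
      \<le> \<kappa>"
    and B: "energy s \<kappa>0 t \<le> B" "0 \<le> B" "(B + 1) * bracket_mass \<le> \<kappa>0 powr (1/4)"
  shows "\<exists>v \<phi>. angle \<sigma> \<kappa> (W 0 t) (W 1 t) v \<phi>"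
proof -
  interpret potential "W 0 t" "W 1 t" "W 2 t" by (rule potential[OF t])
  obtain KU where KU: "\<And>x. \<bar>W 0 t x\<bar> \<le> KU" using decU(1) decayingE by blast
  have "0 < 2 * \<kappa>" using \<kappa> by simp
  from bounded_solution_exists[OF this decaying_continuous[OF decU(1)] KU]
  obtain v where v: "\<And>x. (v has_real_derivative 2 * \<kappa> * v x - W 0 t x)
      (at x)" "\<And>x. \<bar>v x\<bar> \<le> KU / (2 * \<kappa>)"
    by blast
  have dv: "decaying v" using \<kappa> by (intro decaying_resolvent[OF _ v decU(1)]) simp
  have "\<bar>v x\<bar> \<le> 1/4" for x
    using \<kappa> s B by (intro resolvent_small[OF _ v(1) dv s]) (auto simp: energy_def weight_def)
  from angle_exists[OF _ v(1) this] obtain \<phi> where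
    "\<And>x. (\<phi> has_real_derivative 2 * \<kappa> * sn \<sigma> (\<phi> x) - W 0 t x)
        (at x)" "\<And>x. \<bar>\<phi> x\<bar> \<le> 1/2"
    using \<kappa> by (metis order_trans)
  then have "angle \<sigma> \<kappa> (W 0 t) (W 1 t) v \<phi>"
    using \<sigma> \<kappa> decU dU v(1) dv by unfold_locales (auto simp: is_angle_def)
  then show ?thesis by blast
qed

text \<open>With \<open>v\<close> and \<open>\<phi>\<close> at the times \<open>t\<close> and 0, the conserved
  charge gives the chain \<open>\<integral>v\<^sup>2(t) \<le> 3\<integral>\<phi>\<^sup>2(t) \<le> 8 charge \<le>
  5\<integral>\<phi>\<^sup>2(0) \<le> 15\<integral>v\<^sup>2(0)\<close>. The second estimate uses \<open>mass -
  8\<kappa>\<^sup>2 charge\<close> in place of the charge; its last term is the cubic error in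
  \<open>higher_charge_bounds\<close>.\<close>

lemma resolvent_comparison:
  assumes t: "t \<in> {0..T}" and \<kappa>: "2 \<le> \<kappa>"
    and ex: "\<And>t. t \<in> {0..T} \<Longrightarrow> \<exists>v \<phi>. angle \<sigma> \<kappa> (W 0 t)
        (W 1 t) v \<phi>"
  shows "low_energy \<kappa> (W 0 t)
      \<le> 15 * low_energy \<kappa> (W 0 0)" (is ?one)
    and "high_energy \<kappa> (W 0 t)
      \<le> 27 * high_energy \<kappa> (W 0 0)
        + 768 * pi * L2sq (W 0 0) ^ 3 / \<kappa>\<^sup>2" (is ?two)
proof -
  have 0: "0 \<in> {0..T}" using t by auto
  obtain v \<phi> where ang: "\<And>t. t \<in> {0..T} \<Longrightarrow>
      angle \<sigma> \<kappa> (W 0 t) (W 1 t) (v t) (\<phi> t)"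
    using ex by metis
  have isa: "is_angle \<sigma> \<kappa> (W 0 t) (\<phi> t)" if "t \<in> {0..T}" for t
    using ang[OF that] by (simp add: angle_def)
  have ch: "charge \<sigma> (\<phi> t) = charge \<sigma> (\<phi> 0)"
    by (rule charge_conserved[OF \<kappa> isa t])
  have M: "L2sq (W 0 t) = (LINT x|lborel. (W 0 0 x)\<^sup>2)"
    by (rule mass_conserved[OF t])
  interpret at: angle \<sigma> \<kappa> "W 0 t" "W 1 t" "v t" "\<phi> t" by (rule ang[OF t])
  interpret a0: angle \<sigma> \<kappa> "W 0 0" "W 1 0" "v 0" "\<phi> 0" by (rule ang[OF 0])
  interpret pt: potential "W 0 t" "W 1 t" "W 2 t" by (rule potential[OF t])
  interpret p0: potential "W 0 0" "W 1 0" "W 2 0" by (rule potential[OF 0])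
  have \<kappa>1: "1 \<le> \<kappa>" using \<kappa> by simp
  have "(LINT x|lborel. (v t x)\<^sup>2) \<le> 15 * (LINT x|lborel. (v 0 x)\<^sup>2)"
    using at.L2_angle_linear(2) at.charge_bounds(1) ch a0.charge_bounds(2) a0.L2_angle_linear(1) by linarith
  from mult_left_mono[OF this, of "2 * pi"]
  show ?one
    unfolding pt.resolvent_L2_fourier[OF \<kappa>1 at.v,
        symmetric] p0.resolvent_L2_fourier[OF \<kappa>1 a0.v, symmetric]
    by (simp add: mult.left_commute)
  define Mk where "Mk = a0.mass ^ 3 / \<kappa>\<^sup>2"
  have mass: "at.mass = a0.mass" using M by (simp add: at.mass_def a0.mass_def)
  have "L2sq at.vx \<le> 27 * L2sq a0.vx + 384 * Mk"
    using at.L2_angle_linear_derivative(2) at.higher_charge_bounds(1) a0.higher_charge_bounds(2)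
        a0.L2_angle_linear_derivative(1)
    unfolding mass ch Mk_def by argo
  from mult_left_mono[OF this, of "2 * pi"]
  have "2 * pi * L2sq at.vx \<le> 27 * (2 * pi * L2sq a0.vx) + 768 * pi * Mk"
    by (simp add: algebra_simps)
  then show ?two
    unfolding at.vx_def a0.vx_def pt.resolvent_derivative_L2_fourier[OF \<kappa>1 at.v]
        p0.resolvent_derivative_L2_fourier[OF \<kappa>1 a0.v]
    by (simp add: Mk_def a0.mass_def)
qed

lemma weight_ge_1: "2 \<le> \<kappa>0 \<Longrightarrow> 1 \<le> weight \<kappa>0 \<xi>"
proof -
  assume "2 \<le> \<kappa>0"
  then have "1 \<le> \<kappa>0\<^sup>2" by (simp add: one_le_power)
  then show "1 \<le> weight \<kappa>0 \<xi>" using zero_le_power2[of \<xi>] unfolding weight_def by linarith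
qed

lemma weight_measurable [measurable]: "weight \<kappa>0 \<in> borel_measurable borel"
  unfolding weight_def by measurable

lemma weight_le: "2 \<le> \<kappa>0 \<Longrightarrow> weight \<kappa>0 \<xi>
    \<le> 4 * \<kappa>0\<^sup>2 * (1 + \<xi>\<^sup>2)"
proof -
  assume "2 \<le> \<kappa>0"
  then have "1 \<le> 4 * \<kappa>0\<^sup>2" using one_le_power[of \<kappa>0 2] by linarith
  then have "1 * \<xi>\<^sup>2 \<le> 4 * \<kappa>0\<^sup>2 * \<xi>\<^sup>2" by (intro mult_right_mono) auto
  then show "weight \<kappa>0 \<xi> \<le> 4 * \<kappa>0\<^sup>2 * (1 + \<xi>\<^sup>2)"
      by (simp add: weight_def distrib_left)
qed

lemma norm_preserved_negative:
  assumes t: "t \<in> {0..T}" and s: "- (1/8) < s" "s < 0" and \<kappa>0: "2 \<le> \<kappa>0"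
    and B: "\<And>t. t \<in> {0..T} \<Longrightarrow> energy s \<kappa>0 t \<le> B" "0
        \<le> B" "(B + 1) * bracket_mass \<le> \<kappa>0 powr (1/4)"
  shows "energy s \<kappa>0 t \<le> 15 * energy s \<kappa>0 0"
proof -
  have 0: "0 \<in> {0..T}" using t by auto
  let ?g = "\<lambda>t \<xi>. spectrum (W 0 t) \<xi>"
  have gi: "integrable lborel (?g t)" if "t \<in> {0..T}" for t
    using potential.weighted_integrable[OF potential[OF that], of "\<lambda>_. 1" 1] by simp
  have "(LINT \<xi>|lborel. ?g t \<xi> * weight \<kappa>0 \<xi> powr s)
      \<le> 15 * (LINT \<xi>|lborel. ?g 0 \<xi> * weight \<kappa>0 \<xi> powr s) + 0 * 1 powr s"
  proof (rule subordinated_comparison_real[OF gi[OF t] _ gi[OF 0] _ weight_measurable weight_ge_1[OF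
      \<kappa>0]])
    fix \<tau> :: real assume \<tau>: "0 < \<tau>"
    define \<kappa> where "\<kappa> = sqrt (\<kappa>0\<^sup>2 + \<tau>)"
    have k2: "\<kappa>\<^sup>2 = \<kappa>0\<^sup>2 + \<tau>" using \<tau> by (simp add: \<kappa>_def)
    have k: "\<kappa>0 \<le> \<kappa>" unfolding \<kappa>_def using \<tau> by (intro real_le_rsqrt) simp
    have eq: "4 * \<tau> + weight \<kappa>0 \<xi> = 4 * \<kappa>\<^sup>2 + \<xi>\<^sup>2" for \<xi>
        by (simp add: k2 weight_def)
    have ex: "\<exists>v \<phi>. angle \<sigma> \<kappa> (W 0 t) (W 1 t) v \<phi>" if "t \<in> {0..T}" for t
      using s by (intro angle_exists_at[OF that s(1) _ \<kappa>0 k B(1)[OF that] B(2,3)]) simp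
    have "2 \<le> \<kappa>" using k \<kappa>0 by simp
    from resolvent_comparison(1)[OF t this ex]
    show "(LINT \<xi>|lborel. ?g t \<xi> / (4 * \<tau> + weight \<kappa>0 \<xi>))
        \<le> 15 * (LINT \<xi>|lborel. ?g 0 \<xi> / (4 * \<tau> + weight \<kappa>0 \<xi>)) + 0 / (4 * \<tau>
        + 1)"
      unfolding eq by simp
  qed (use s in auto)
  then show ?thesis by (simp add: energy_def mult.commute)
qed

text \<open>Write \<open>weight powr s\<close> as \<open>weight * weight powr (s - 1)\<close>. The quotient of
  the weight and \<open>4\<kappa>\<^sup>2 + \<xi>\<^sup>2\<close> splits into the two weights
  \<open>4\<kappa>0\<^sup>2 / (4\<kappa>\<^sup>2 + \<xi>\<^sup>2)\<close> and \<open>\<xi>\<^sup>2 /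
  (4\<kappa>\<^sup>2 + \<xi>\<^sup>2)\<close> that \<open>resolvent_comparison\<close> treats.\<close>

lemma norm_preserved_positive:
  assumes t: "t \<in> {0..T}" and s: "0 < s" "s < 1" and \<kappa>0: "2 \<le> \<kappa>0"
    and B: "energy 0 \<kappa>0 0 \<le> B" "0 \<le> B" "(B + 1) * bracket_mass \<le> \<kappa>0 powr (1/4)"
  shows "energy s \<kappa>0 t \<le> 27 * energy s \<kappa>0 0 + 3072 * pi * L2sq (W 0 0) ^ 3"
proof -
  have 0: "0 \<in> {0..T}" using t by auto
  let ?g = "\<lambda>t \<xi>. weight \<kappa>0 \<xi> * spectrum (W 0 t) \<xi>"
  define M where "M = (LINT x|lborel. (W 0 0 x)\<^sup>2)"
  have M: "0 \<le> M" by (simp add: M_def)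
  have m0: "0 < weight \<kappa>0 \<xi>" for \<xi> using weight_ge_1[OF \<kappa>0, of \<xi>] by linarith
  have gi: "integrable lborel (?g t)" if "t \<in> {0..T}" for t
    using weight_le[OF \<kappa>0] m0 by (intro potential.weighted_integrable[OF potential[OF that],
        of _ "4 * \<kappa>0\<^sup>2"]) (auto simp: less_imp_le)
  have gi1: "integrable lborel (\<lambda>\<xi>. spectrum (W 0 t) \<xi> / (4 * \<kappa>\<^sup>2
      + \<xi>\<^sup>2))"
     "integrable lborel (\<lambda>\<xi>. \<xi>\<^sup>2 * spectrum (W 0 t) \<xi> / (4 * \<kappa>\<^sup>2
         + \<xi>\<^sup>2))" if "t \<in> {0..T}" "2 \<le> \<kappa>" for t \<kappa>
  proof -
    have d: "1 \<le> 4 * \<kappa>\<^sup>2 + \<xi>\<^sup>2" for \<xi> using weight_ge_1[OF that(2)]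
        by (simp add: weight_def)
    have d1: "1 / (4 * \<kappa>\<^sup>2 + \<xi>\<^sup>2) \<le> 1" for \<xi> using d[of \<xi>] by simp
    show "integrable lborel (\<lambda>\<xi>. spectrum (W 0 t) \<xi> / (4 * \<kappa>\<^sup>2 + \<xi>\<^sup>2))"
      using potential.weighted_integrable[OF potential[OF that(1)],
          of "\<lambda>\<xi>. 1 / (4 * \<kappa>\<^sup>2 + \<xi>\<^sup>2)" 1]
        order_trans[OF d1, of "1 + _"] by (simp add: abs_of_nonneg)
    have "\<bar>\<xi>\<^sup>2 / (4 * \<kappa>\<^sup>2 + \<xi>\<^sup>2)\<bar>
        \<le> 1 * (1 + \<xi>\<^sup>2)" for \<xi>
    proof -
      have "\<xi>\<^sup>2 / (4 * \<kappa>\<^sup>2 + \<xi>\<^sup>2) \<le> 1" using d[of \<xi>]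
          by (subst divide_le_eq) auto
      then show ?thesis using d[of \<xi>] by (simp add: add_increasing2)
    qed
    from potential.weighted_integrable[OF potential[OF that(1)] _ this]
    show "integrable lborel (\<lambda>\<xi>. \<xi>\<^sup>2 * spectrum (W 0 t) \<xi> / (4 * \<kappa>\<^sup>2
        + \<xi>\<^sup>2))"
      by simp
  qed
  have N0: "energy 0 \<kappa>0 t = 2 * pi * (LINT x|lborel. (W 0 t x)\<^sup>2)" if "t \<in> {0..T}" for t
    using potential.mass_fourier[OF potential[OF that]] m0 by (simp add: energy_def less_imp_neq[symmetric])
  have N00: "energy 0 \<kappa>0 t \<le> B" if "t \<in> {0..T}" for t
    using B(1) N0[OF that] N0[OF 0] mass_conserved[OF that] by simp
  have "(LINT \<xi>|lborel. ?g t \<xi> * weight \<kappa>0 \<xi> powr (s - 1))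
    \<le> 27 * (LINT \<xi>|lborel. ?g 0 \<xi> * weight \<kappa>0 \<xi> powr (s - 1))
        + (3072 * pi * M ^ 3) * (4 * \<kappa>0\<^sup>2) powr (s - 1)"
  proof (rule subordinated_comparison_real[OF gi[OF t] _ gi[OF 0] _ weight_measurable weight_ge_1[OF
      \<kappa>0]])
    fix \<tau> :: real assume \<tau>: "0 < \<tau>"
    define \<kappa> where "\<kappa> = sqrt (\<kappa>0\<^sup>2 + \<tau>)"
    have k2: "\<kappa>\<^sup>2 = \<kappa>0\<^sup>2 + \<tau>" using \<tau> by (simp add: \<kappa>_def)
    have k: "\<kappa>0 \<le> \<kappa>" unfolding \<kappa>_def using \<tau> by (intro real_le_rsqrt) simp
    have eq: "4 * \<tau> + weight \<kappa>0 \<xi> = 4 * \<kappa>\<^sup>2 + \<xi>\<^sup>2" for \<xi>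
        by (simp add: k2 weight_def)
    have ex: "\<exists>v \<phi>. angle \<sigma> \<kappa> (W 0 t) (W 1 t) v \<phi>" if "t \<in> {0..T}" for t
      by (rule angle_exists_at[OF that _ _ \<kappa>0 k N00[OF that] B(2,3)]) auto
    have \<kappa>: "2 \<le> \<kappa>" using k \<kappa>0 by simp
    define P where "P t = low_energy \<kappa> (W 0 t)" for t
    define Q where "Q t = high_energy \<kappa> (W 0 t)" for t
    have split: "(LINT \<xi>|lborel. ?g t \<xi> / (4 * \<tau> + weight \<kappa>0 \<xi>))
        = 4 * \<kappa>0\<^sup>2 * P t + Q t" if "t \<in> {0..T}" for t
    proof -
      have "(LINT \<xi>|lborel. ?g t \<xi> / (4 * \<tau> + weight \<kappa>0 \<xi>))
          = (LINT \<xi>|lborel. 4 * \<kappa>0\<^sup>2 * (spectrum (W 0 t) \<xi> / (4 * \<kappa>\<^sup>2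
          + \<xi>\<^sup>2))
        + \<xi>\<^sup>2 * spectrum (W 0 t) \<xi> / (4 * \<kappa>\<^sup>2 + \<xi>\<^sup>2))"
        unfolding eq by (intro Bochner_Integration.integral_cong refl)
            (simp add: weight_def add_divide_distrib[symmetric] distrib_right)
      also have "\<dots> = 4 * \<kappa>0\<^sup>2 * P t + Q t"
        using gi1[OF that \<kappa>] unfolding P_def Q_def
        by (subst Bochner_Integration.integral_add) (auto simp only: integral_mult_right_zero intro!:
            integrable_mult_right)
      finally show ?thesis .
    qed
    have P0: "0 \<le> P 0" unfolding P_def by (intro Bochner_Integration.integral_nonneg
        divide_nonneg_nonneg) auto
    have PP: "P t \<le> 15 * P 0" and QQ: "Q t \<le> 27 * Q 0 + 768 * pi * M ^ 3 / \<kappa>\<^sup>2"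
      using resolvent_comparison[OF t \<kappa> ex] by (simp_all add: P_def Q_def M_def)
    have "4 * \<kappa>0\<^sup>2 * P t \<le> 4 * \<kappa>0\<^sup>2 * (27 * P 0)"
      using PP P0 by (intro mult_left_mono) auto
    moreover have "768 * pi * M ^ 3 / \<kappa>\<^sup>2 = 3072 * pi * M ^ 3 / (4 * \<tau>
        + 4 * \<kappa>0\<^sup>2)"
    proof -
      have "4 * \<tau> + 4 * \<kappa>0\<^sup>2 = 4 * \<kappa>\<^sup>2" by (simp add: k2)
      then show ?thesis by simp
    qed
    ultimately show "(LINT \<xi>|lborel. ?g t \<xi> / (4 * \<tau> + weight \<kappa>0 \<xi>))
      \<le> 27 * (LINT \<xi>|lborel. ?g 0 \<xi> / (4 * \<tau> + weight \<kappa>0 \<xi>))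
          + 3072 * pi * M ^ 3 / (4 * \<tau> + 4 * \<kappa>0\<^sup>2)"
      unfolding split[OF t] split[OF 0] using QQ by argo
  qed (use s M \<kappa>0 m0 in \<open>auto intro!: mult_nonneg_nonneg simp: less_imp_le\<close>)
  moreover have N: "(LINT \<xi>|lborel. ?g t \<xi> * weight \<kappa>0 \<xi> powr (s - 1))
      = energy s \<kappa>0 t" for t
  proof -
    have "weight \<kappa>0 \<xi> * weight \<kappa>0 \<xi> powr (s - 1)
        = weight \<kappa>0 \<xi> powr s" for \<xi> using m0[of \<xi>] by (simp add: powr_diff)
    then show ?thesis unfolding energy_def
      by (intro Bochner_Integration.integral_cong refl) (metis mult.assoc mult.commute)
  qed
  moreover have "(3072 * pi * M ^ 3) * (4 * \<kappa>0\<^sup>2) powr (s - 1) \<le> (3072 * pi * M ^ 3) * 1"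
  proof (rule mult_left_mono)
    have "1 \<le> 4 * \<kappa>0\<^sup>2" using weight_ge_1[OF \<kappa>0, of 0] by (simp add: weight_def)
    then show "(4 * \<kappa>0\<^sup>2) powr (s - 1) \<le> 1"
        using powr_mono[of "s - 1" 0 "4 * \<kappa>0\<^sup>2"] s \<kappa>0 by simp
  qed (use M in simp)
  ultimately show ?thesis unfolding N M_def by linarith
qed

lemma fourier_W_bound:
  "t \<in> {0..T} \<Longrightarrow> norm (fourier (W 0 t) \<xi>) \<le> (2 * pi * K) / (1 + \<xi>\<^sup>2)"
  using potential.fourier_quadratic_bound[OF potential W_bound W_bound] by simp

lemma fourier_W_cont:
  assumes t0: "t0 \<in> {0..T}" and \<epsilon>: "0 < \<epsilon>"
  shows "\<forall>\<^sub>F t in at t0 within {0..T}. \<forall>\<xi>. norm (fourier (W 0 t) \<xi>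
      - fourier (W 0 t0) \<xi>) \<le> (2 * pi * \<epsilon>) / (1 + \<xi>\<^sup>2)"
proof -
  have "\<forall>\<^sub>F t in at t0 within {0..T}. t \<in> {0..T}" by (auto simp: eventually_at_filter)
  with W_cont[OF t0 \<epsilon>] show ?thesis
  proof eventually_elim
    case (elim t)
    interpret p: potential "W 0 t" "W 1 t" "W 2 t" by (rule potential[OF elim(2)])
    interpret p0: potential "W 0 t0" "W 1 t0" "W 2 t0" by (rule potential[OF t0])
    let ?D = "\<lambda>l x. W l t x - W l t0 x"
    have D: "potential (?D 0) (?D 1) (?D 2)"
      by unfold_locales (intro DERIV_diff decaying_diff p.dU p0.dU p.decU p0.decU)+
    have "\<bar>?D 0 x\<bar> \<le> \<epsilon> / (1 + x\<^sup>2)" "\<bar>?D 2 x\<bar>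
        \<le> \<epsilon> / (1 + x\<^sup>2)" for x using elim(1) by auto
    from potential.fourier_quadratic_bound[OF D this]
    have "norm (fourier (?D 0) \<xi>) \<le> (2 * pi * \<epsilon>) / (1 + \<xi>\<^sup>2)" for \<xi> .
    moreover have "fourier (?D 0) \<xi> = fourier (W 0 t) \<xi> - fourier (W 0 t0) \<xi>" for \<xi>
      using fourier_lincomb[OF decaying_integrable[OF p.decU(1)] decaying_integrable[OF p0.decU(1)],
          of 1 1 \<xi>] by simp
    ultimately show ?case by simp
  qed
qed

text \<open>Needed twice: for the continuity argument in \<open>norm_preserved_bootstrap\<close> and for the
  measurability of the Sobolev norm in time.\<close>

lemma weighted_norm_continuous:
  assumes [measurable]: "w \<in> borel_measurable borel" and w: "\<And>\<xi>. \<bar>w \<xi>\<bar>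
      \<le> c * (1 + \<xi>\<^sup>2)"
  shows "continuous_on {0..T} (\<lambda>t. LINT \<xi>|lborel. w \<xi> * spectrum (W 0 t) \<xi>)"
  unfolding continuous_on_def
proof (intro ballI tendstoI)
  fix t0 e :: real assume t0: "t0 \<in> {0..T}" and e: "0 < e"
  let ?I = "\<lambda>t. LINT \<xi>|lborel. w \<xi> * spectrum (W 0 t) \<xi>"
  have c: "0 \<le> c" using w[of 0] by simp
  have A: "0 < c * (8 * pi ^ 3 * K) + 1" using c K by (intro add_nonneg_pos mult_nonneg_nonneg) auto
  define \<epsilon> where "\<epsilon> = e / (c * (8 * pi ^ 3 * K) + 1)"
  have \<epsilon>: "0 < \<epsilon>" using e A by (simp add: \<epsilon>_def)
  have "\<forall>\<^sub>F t in at t0 within {0..T}. t \<in> {0..T}" by (auto simp: eventually_at_filter)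
  with fourier_W_cont[OF t0 \<epsilon>] show "\<forall>\<^sub>F t in at t0 within {0..T}. dist (?I t)
      (?I t0) < e"
  proof eventually_elim
    case (elim t)
    note i = potential.weighted_integrable[OF potential[OF elim(2)] assms] potential.weighted_integrable[OF
        potential[OF t0] assms]
    have pw: "\<bar>w \<xi> * spectrum (W 0 t) \<xi> - w \<xi> * spectrum (W 0 t0) \<xi>\<bar>
        \<le> (c * (8 * pi\<^sup>2 * K * \<epsilon>)) / (1 + \<xi>\<^sup>2)" for \<xi>
    proof -
      let ?a = "norm (fourier (W 0 t) \<xi>)" and ?b = "norm (fourier (W 0 t0) \<xi>)"
      have p: "1 + \<xi>\<^sup>2 \<noteq> 0" using one_plus_square_pos[of \<xi>] by linarith
      have "w \<xi> * ?a\<^sup>2 - w \<xi> * ?b\<^sup>2 = w \<xi> * ((?a - ?b) * (?a + ?b))"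
          by (simp add: power2_eq_square algebra_simps)
      also have "\<bar>\<dots>\<bar> = \<bar>w \<xi>\<bar> * (\<bar>?a - ?b\<bar> * (?a + ?b))"
          by (simp add: abs_mult)
      also have "\<dots> \<le> (c * (1 + \<xi>\<^sup>2)) * ((2 * pi * \<epsilon>) / (1
          + \<xi>\<^sup>2) * ((2 * pi * K) / (1 + \<xi>\<^sup>2) + (2 * pi * K) / (1 + \<xi>\<^sup>2)))"
        using w[of \<xi>] c \<epsilon> fourier_W_bound[OF elim(2), of \<xi>] fourier_W_bound[OF t0, of \<xi>]
          order_trans[OF norm_triangle_ineq3 elim(1)[rule_format, of \<xi>]]
        by (intro mult_mono add_mono mult_nonneg_nonneg) auto
      also have "\<dots> = (c * (8 * pi\<^sup>2 * K * \<epsilon>)) / (1 + \<xi>\<^sup>2)"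
        using p by (simp add: add_divide_distrib[symmetric]) (simp add: power2_eq_square)
      finally show ?thesis .
    qed
    have "\<bar>?I t - ?I t0\<bar> = \<bar>LINT \<xi>|lborel. w \<xi> * spectrum (W 0 t) \<xi>
        - w \<xi> * spectrum (W 0 t0) \<xi>\<bar>"
      using i by simp
    also have "\<dots> \<le> (LINT \<xi>|lborel. (c * (8 * pi\<^sup>2 * K * \<epsilon>)) / (1 + \<xi>\<^sup>2))"
      using i pw by (intro order_trans[OF integral_abs_bound] integral_mono integrable_one_plus_square
          integrable_abs
            Bochner_Integration.integrable_diff) auto
    also have "\<dots> = (c * (8 * pi ^ 3 * K)) * \<epsilon>"
      unfolding integral_one_plus_square by (simp add: power2_eq_square power3_eq_cube)
    also have "\<dots> < (c * (8 * pi ^ 3 * K) + 1) * \<epsilon>" using \<epsilon> by simp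
    also have "\<dots> = e" using A by (simp add: \<epsilon>_def)
    finally show ?case by (simp add: dist_real_def)
  qed
qed

lemma restrict_time: "T' \<le> T \<Longrightarrow> flow \<sigma> T' W K"
proof unfold_locales
  assume T': "T' \<le> T"
  then have sub: "{0..T'} \<subseteq> {0..T}" by auto
  fix t0 \<epsilon> :: real assume "t0 \<in> {0..T'}" "0 < \<epsilon>"
  then show "\<forall>\<^sub>F t in at t0 within {0..T'}. \<forall>l\<le>3. \<forall>x. \<bar>W l t x
      - W l t0 x\<bar> \<le> \<epsilon> / (1 + x\<^sup>2)"
    using W_cont[of t0 \<epsilon>] sub filter_leD[OF at_le[OF sub]] by blast
next
  fix t x assume T': "T' \<le> T" and "t \<in> {0..T'}"
  then show "((\<lambda>\<tau>. W 0 \<tau> x) has_real_derivative - W 3 t x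
      - 3 / 2 * \<sigma> * (W 0 t x)\<^sup>2 * W 1 t x) (at t within {0..T'})"
    using time_deriv[of t x] by (auto intro: DERIV_subset)
qed (use \<sigma> K space_deriv cont3 W_bound in auto)

text \<open>At the first time when the energy reaches \<open>B\<close> it has been at most \<open>B\<close> all
  along, so \<open>norm_preserved_negative\<close> applies up to that time and bounds the energy by \<open>15 *
  energy s \<kappa>0 0 < B\<close>.\<close>

lemma norm_preserved_bootstrap:
  assumes t: "t \<in> {0..T}" and s: "- (1/8) < s" "s < 0" and \<kappa>0: "2 \<le> \<kappa>0"
    and B: "15 * energy s \<kappa>0 0 < B" "(B + 1) * bracket_mass \<le> \<kappa>0 powr (1/4)"
  shows "energy s \<kappa>0 t \<le> 15 * energy s \<kappa>0 0"
proof -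
  have 0: "0 \<in> {0..T}" using t by auto
  have N0: "0 \<le> energy s \<kappa>0 t" for t unfolding energy_def
      by (intro Bochner_Integration.integral_nonneg) auto
  have B0: "0 \<le> B" using B(1) N0[of 0] by linarith
  have step: "energy s \<kappa>0 t \<le> 15 * energy s \<kappa>0 0" if t: "t \<in> {0..T}" and le:
      "\<And>\<tau>. \<tau> \<in> {0..t} \<Longrightarrow> energy s \<kappa>0 \<tau> \<le> B" for t
  proof -
    interpret r: flow \<sigma> t W K using t by (intro restrict_time) auto
    have "r.energy = energy" unfolding r.energy_def[abs_def] energy_def[abs_def] r.weight_def[abs_def]
        weight_def[abs_def] ..
    then show ?thesis using r.norm_preserved_negative[OF _ s \<kappa>0 _ B0 B(2), of t] le t by auto
  qed
  have cont: "continuous_on {0..T} (energy s \<kappa>0)"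
    unfolding energy_def[abs_def]
  proof (rule weighted_norm_continuous[where c = 1])
    show "\<bar>weight \<kappa>0 \<xi> powr s\<bar> \<le> 1 * (1 + \<xi>\<^sup>2)" for \<xi>
    proof -
      have "weight \<kappa>0 \<xi> powr s \<le> weight \<kappa>0 \<xi> powr 0"
          using s weight_ge_1[OF \<kappa>0] by (intro powr_mono) auto
      then show ?thesis using weight_ge_1[OF \<kappa>0, of \<xi>] by (simp add: add_increasing2)
    qed
  qed measurable
  have "energy s \<kappa>0 t < B" if t: "t \<in> {0..T}" for t
  proof (rule ccontr)
    assume nb: "\<not> energy s \<kappa>0 t < B"
    define A where "A = {0..T} \<inter> energy s \<kappa>0 -` {B..}"
    have "closed A" unfolding A_def by (rule continuous_closed_preimage[OF cont]) auto
    moreover have "t \<in> A" using nb t by (simp add: A_def)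
    moreover have bA: "bdd_below A" by (auto simp: A_def intro: bdd_below.I[of _ 0])
    ultimately have i: "Inf A \<in> A" using closed_contains_Inf by blast
    then have iT: "Inf A \<in> {0..T}" and iB: "B \<le> energy s \<kappa>0 (Inf A)" by (auto simp: A_def)
    have below: "energy s \<kappa>0 \<tau> < B" if "\<tau> \<in> {0..<Inf A}" for \<tau>
    proof (rule ccontr)
      assume "\<not> energy s \<kappa>0 \<tau> < B"
      then have "\<tau> \<in> A" using that iT by (auto simp: A_def)
      then have "Inf A \<le> \<tau>" using bA cInf_lower by blast
      then show False using that by simp
    qed
    have "Inf A \<noteq> 0" using iB B(1) N0[of 0] by auto
    then have pos: "0 < Inf A" using iT by auto
    have "energy s \<kappa>0 (Inf A) \<le> B"
    proof (rule tendsto_upperbound)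
      have "(energy s \<kappa>0 \<longlongrightarrow> energy s \<kappa>0 (Inf A)) (at (Inf A) within {0..T})"
        using cont iT by (simp add: continuous_on_def)
      then show "(energy s \<kappa>0 \<longlongrightarrow> energy s \<kappa>0 (Inf A))
          (at (Inf A) within {0..<Inf A})"
        by (rule tendsto_within_subset) (use iT in auto)
      show "\<forall>\<^sub>F \<tau> in at (Inf A) within {0..<Inf A}. energy s \<kappa>0 \<tau> \<le> B"
        using below by (auto simp: eventually_at_filter less_imp_le)
      show "at (Inf A) within {0..<Inf A} \<noteq> bot"
        using pos by (simp add: trivial_limit_within islimpt_Ico)
    qed
    then have "energy s \<kappa>0 \<tau> \<le> B" if "\<tau> \<in> {0..Inf A}" for \<tau>
      using below[of \<tau>] that by (cases "\<tau> = Inf A") auto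
    from step[OF iT this] show False using iB B(1) by linarith
  qed
  then show ?thesis using t by (intro step[OF t]) (auto intro: less_imp_le)
qed

end

section \<open>From Schwartz solutions to Sobolev bounds\<close>

lemma schwartz_deriv:
  assumes "schwartz f"
  shows "((deriv ^^ l) f has_real_derivative (deriv ^^ Suc l) f x) (at x)"
  using assms DERIV_deriv_iff_real_differentiable[of "(deriv ^^ l) f" x] by (simp add: schwartz_def)

lemma schwartz_seminorm_upper:
  assumes "schwartz f"
  shows "\<bar>x ^ k * (deriv ^^ l) f x\<bar> \<le> schwartz_seminorm k l f"
proof -
  have "bounded (range (\<lambda>x. x ^ k * (deriv ^^ l) f x))" using assms by (simp add: schwartz_def)
  then obtain B where "\<And>x. \<bar>x ^ k * (deriv ^^ l) f x\<bar> \<le> B"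
    unfolding bounded_iff by auto
  then have "bdd_above (range (\<lambda>x. \<bar>x ^ k * (deriv ^^ l) f x\<bar>))"
      by (intro bdd_aboveI[of _ B]) auto
  then show ?thesis unfolding schwartz_seminorm_def by (rule cSUP_upper[rotated]) simp
qed

lemma iterated_deriv_diff:
  assumes "schwartz f" "schwartz g"
  shows "(deriv ^^ l) (\<lambda>x. f x - g x) = (\<lambda>x. (deriv ^^ l) f x - (deriv ^^ l) g x)"
proof (induction l)
  case (Suc l)
  show ?case
  proof
    fix x
    have "(deriv ^^ Suc l) (\<lambda>x. f x - g x) x = deriv (\<lambda>x. (deriv ^^ l) f x
        - (deriv ^^ l) g x) x"
      using Suc by simp
    also have "\<dots> = (deriv ^^ Suc l) f x - (deriv ^^ Suc l) g x"
      by (intro DERIV_imp_deriv DERIV_diff schwartz_deriv assms)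
    finally show "(deriv ^^ Suc l) (\<lambda>x. f x - g x) x = (deriv ^^ Suc l) f x - (deriv ^^ Suc l) g x" .
  qed
qed simp

lemma schwartz_diff:
  assumes f: "schwartz f" and g: "schwartz g"
  shows "schwartz (\<lambda>x. f x - g x)"
  unfolding schwartz_def iterated_deriv_diff[OF f g]
proof (intro conjI allI)
  show "(\<lambda>x. (deriv ^^ l) f x - (deriv ^^ l) g x) differentiable at x" for l x
    using f g by (intro differentiable_diff) (auto simp: schwartz_def)
  show "bounded (range (\<lambda>x. x ^ k * ((deriv ^^ l) f x - (deriv ^^ l) g x)))" for k l
  proof -
    have "\<bar>x ^ k * ((deriv ^^ l) f x - (deriv ^^ l) g x)\<bar>
        \<le> schwartz_seminorm k l f + schwartz_seminorm k l g" for x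
      using schwartz_seminorm_upper[OF f, of x k l] schwartz_seminorm_upper[OF g, of x k l]
      by (simp add: right_diff_distrib)
    then show ?thesis unfolding bounded_iff by auto
  qed
qed

lemma schwartz_seminorm_triangle:
  assumes f: "schwartz f" and g: "schwartz g"
  shows "schwartz_seminorm k l f \<le> schwartz_seminorm k l g + schwartz_seminorm k l (\<lambda>x. f x - g x)"
proof -
  have "\<bar>x ^ k * (deriv ^^ l) f x\<bar> \<le> schwartz_seminorm k l g
      + schwartz_seminorm k l (\<lambda>x. f x - g x)" for x
    using schwartz_seminorm_upper[OF g, of x k l] schwartz_seminorm_upper[OF schwartz_diff[OF f g], of x k l]
    unfolding iterated_deriv_diff[OF f g] right_diff_distrib by linarith
  then show ?thesis unfolding schwartz_seminorm_def[of k l f] by (intro cSUP_least) auto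
qed

lemma schwartz_seminorm_minus_commute:
  assumes f: "schwartz f" and g: "schwartz g"
  shows "schwartz_seminorm k l (\<lambda>x. f x - g x) = schwartz_seminorm k l (\<lambda>x. g x - f x)"
  unfolding schwartz_seminorm_def iterated_deriv_diff[OF f g] iterated_deriv_diff[OF g f]
  by (simp add: abs_mult abs_minus_commute)

lemma schwartz_quotient_bound:
  assumes "schwartz f"
  shows "\<bar>(deriv ^^ l) f x\<bar> \<le> (schwartz_seminorm 0 l f + schwartz_seminorm 2 l f) / (1
      + x\<^sup>2)"
proof -
  have "\<bar>(deriv ^^ l) f x\<bar> * (1 + x\<^sup>2) = \<bar>x ^ 0 * (deriv ^^ l) f x\<bar>
      + \<bar>x ^ 2 * (deriv ^^ l) f x\<bar>"
    by (simp add: abs_mult algebra_simps)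
  also have "\<dots> \<le> schwartz_seminorm 0 l f + schwartz_seminorm 2 l f"
    by (intro add_mono schwartz_seminorm_upper assms)
  finally show ?thesis by (simp add: pos_le_divide_eq)
qed

lemma schwartz_seminorm_continuous:
  assumes "continuous_into_schwartz I u"
  shows "continuous_on I (\<lambda>t. schwartz_seminorm k l (u t))"
  unfolding continuous_on_def
proof
  fix t0 assume t0: "t0 \<in> I"
  have sch: "schwartz (u t)" if "t \<in> I" for t using assms that by (simp add: continuous_into_schwartz_def)
  have "((\<lambda>t. schwartz_seminorm k l (\<lambda>x. u t x - u t0 x)) \<longlongrightarrow> 0)
      (at t0 within I)"
    using assms t0 by (simp add: continuous_into_schwartz_def)
  moreover have "\<forall>\<^sub>F t in at t0 within I. norm (schwartz_seminorm k l (u t)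
      - schwartz_seminorm k l (u t0))
    \<le> schwartz_seminorm k l (\<lambda>x. u t x - u t0 x)"
  proof -
    have "norm (schwartz_seminorm k l (u t) - schwartz_seminorm k l (u t0))
        \<le> schwartz_seminorm k l (\<lambda>x. u t x - u t0 x)"
      if t: "t \<in> I" for t
      using schwartz_seminorm_triangle[OF sch[OF t] sch[OF t0], of k l]
        schwartz_seminorm_triangle[OF sch[OF t0] sch[OF t], of k l]
        schwartz_seminorm_minus_commute[OF sch[OF t] sch[OF t0], of k l] by simp
    then show ?thesis by (simp add: eventually_at_filter)
  qed
  ultimately have "((\<lambda>t. schwartz_seminorm k l (u t)
      - schwartz_seminorm k l (u t0)) \<longlongrightarrow> 0) (at t0 within I)"
    by (rule Lim_null_comparison[rotated])
  then show "((\<lambda>t. schwartz_seminorm k l (u t)) \<longlongrightarrow> schwartz_seminorm k l (u t0))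
      (at t0 within I)"
    by (rule LIM_zero_cancel)
qed

text \<open>The factor \<open>sqrt 2\<close> turns the nonlinearity \<open>3 \<sigma> u\<^sup>2 u_x\<close> into
  \<open>3/2 \<sigma> U\<^sup>2 U_x\<close>, which makes \<open>U\<close> itself the inhomogeneity of the angle
  equation.\<close>

lemma flow_of_solution:
  assumes sol: "mkdv_solution \<sigma> T u0 u" and \<sigma>: "\<sigma> \<in> {1, -1}"
  shows "\<exists>K. flow \<sigma> T (\<lambda>l t x. sqrt 2 * (deriv ^^ l) (u t) x) K"
proof -
  let ?W = "\<lambda>l t x. sqrt 2 * (deriv ^^ l) (u t) x"
  have cis: "continuous_into_schwartz {0..T} u" using sol by (simp add: mkdv_solution_def)
  have sch: "schwartz (u t)" if "t \<in> {0..T}" for t using cis that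
      by (simp add: continuous_into_schwartz_def)
  let ?p = "\<lambda>l f. schwartz_seminorm 0 l f + schwartz_seminorm 2 l f"
  have "\<exists>B. \<forall>t\<in>{0..T}. ?p l (u t) \<le> B" for l
  proof -
    have "continuous_on {0..T} (\<lambda>t. ?p l (u t))"
      by (intro continuous_on_add schwartz_seminorm_continuous cis)
    then have "bounded ((\<lambda>t. ?p l (u t)) ` {0..T})"
      by (intro compact_imp_bounded compact_continuous_image) auto
    then obtain B where "\<forall>t\<in>{0..T}. \<bar>?p l (u t)\<bar> \<le> B" unfolding bounded_iff
        by (auto simp only: ball_simps real_norm_def)
    then have "\<forall>t\<in>{0..T}. ?p l (u t) \<le> B" using abs_le_D1 by blast
    then show ?thesis ..
  qed
  then obtain B where B: "\<And>l t. t \<in> {0..T} \<Longrightarrow> ?p l (u t) \<le> B l" by metis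
  define K where "K = 2 * (1 + (\<Sum>l\<le>3. \<bar>B l\<bar>))"
  have K: "0 < K" by (simp add: K_def add_pos_nonneg sum_nonneg)
  have s2: "sqrt 2 \<le> 2" using real_sqrt_le_mono[of 2 4] by simp
  have "flow \<sigma> T (\<lambda>l t x. sqrt 2 * (deriv ^^ l) (u t) x) K"
  proof unfold_locales
    show "\<sigma> \<in> {1, -1}" "0 < K" by fact+
    show "((\<lambda>x. ?W l t x) has_real_derivative ?W (Suc l) t x) (at x)"
      if "t \<in> {0..T}" for l t x
      by (intro DERIV_cmult schwartz_deriv sch that)
    show "continuous_on UNIV (\<lambda>x. ?W 3 t x)" if "t \<in> {0..T}" for t
      by (rule DERIV_continuous_on_UNIV[OF DERIV_cmult[OF schwartz_deriv[OF sch[OF that]]]])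
    show "\<bar>?W l t x\<bar> \<le> K / (1 + x\<^sup>2)" if t: "t \<in> {0..T}" and l: "l \<le> 3" for l t x
    proof -
      have "\<bar>B l\<bar> \<le> (\<Sum>l\<le>3. \<bar>B l\<bar>)" using l by (intro member_le_sum) auto
      then have "?p l (u t) \<le> 1 + (\<Sum>l\<le>3. \<bar>B l\<bar>)" using B[OF t, of l] by linarith
      then have "\<bar>(deriv ^^ l) (u t) x\<bar> \<le> (1 + (\<Sum>l\<le>3. \<bar>B l\<bar>)) / (1
          + x\<^sup>2)"
        by (intro order_trans[OF schwartz_quotient_bound[OF sch[OF t]]] divide_right_mono) auto
      then have "sqrt 2 * \<bar>(deriv ^^ l) (u t) x\<bar>
          \<le> 2 * ((1 + (\<Sum>l\<le>3. \<bar>B l\<bar>)) / (1 + x\<^sup>2))"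
        using s2 by (intro mult_mono) auto
      then show ?thesis by (simp add: abs_mult K_def)
    qed
    show "\<forall>\<^sub>F t in at t0 within {0..T}. \<forall>l\<le>3. \<forall>x. \<bar>?W l t x
        - ?W l t0 x\<bar> \<le> \<epsilon> / (1 + x\<^sup>2)"
      if t0: "t0 \<in> {0..T}" and \<epsilon>: "0 < \<epsilon>" for t0 \<epsilon>
    proof -
      have small: "\<forall>\<^sub>F t in at t0 within {0..T}. schwartz_seminorm k l (\<lambda>x. u t x
          - u t0 x) < \<epsilon> / 4" for k l
      proof -
        have "((\<lambda>t. schwartz_seminorm k l (\<lambda>x. u t x - u t0 x)) \<longlongrightarrow> 0)
            (at t0 within {0..T})"
          using cis t0 by (simp add: continuous_into_schwartz_def)
        then show ?thesis by (rule order_tendstoD(2)) (use \<epsilon> in simp)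
      qed
      have each: "\<forall>\<^sub>F t in at t0 within {0..T}. \<forall>x. \<bar>?W l t x - ?W l t0 x\<bar>
          \<le> \<epsilon> / (1 + x\<^sup>2)" for l
      proof -
        have "\<forall>\<^sub>F t in at t0 within {0..T}. t \<in> {0..T}" by (auto simp: eventually_at_filter)
        with small[of 0 l] small[of 2 l] show ?thesis
        proof eventually_elim
          case (elim t)
          note d = schwartz_diff[OF sch[OF elim(3)] sch[OF t0]]
          show ?case
          proof
            fix x
            have "\<bar>(deriv ^^ l) (u t) x - (deriv ^^ l) (u t0) x\<bar>
                \<le> (\<epsilon> / 2) / (1 + x\<^sup>2)"
              using schwartz_quotient_bound[OF d, of l x] elim(1,2)
              unfolding iterated_deriv_diff[OF sch[OF elim(3)] sch[OF t0]]
              by (elim order_trans) (intro divide_right_mono; simp)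
            then have "sqrt 2 * \<bar>(deriv ^^ l) (u t) x - (deriv ^^ l) (u t0) x\<bar>
                \<le> 2 * ((\<epsilon> / 2) / (1 + x\<^sup>2))"
              using s2 by (intro mult_mono) auto
            moreover have "sqrt 2 * \<bar>(deriv ^^ l) (u t) x - (deriv ^^ l) (u t0) x\<bar>
              = \<bar>?W l t x - ?W l t0 x\<bar>"
              by (simp add: abs_mult flip: right_diff_distrib)
            moreover have "2 * ((\<epsilon> / 2) / (1 + x\<^sup>2)) = \<epsilon> / (1 + x\<^sup>2)"
              by (simp only: times_divide_eq_right)
            ultimately show "\<bar>?W l t x - ?W l t0 x\<bar> \<le> \<epsilon> / (1 + x\<^sup>2)" by linarith
          qed
        qed
      qed
      have "\<forall>\<^sub>F t in at t0 within {0..T}. \<forall>l\<in>{..3}. \<forall>x. \<bar>?W l t x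
          - ?W l t0 x\<bar> \<le> \<epsilon> / (1 + x\<^sup>2)"
        by (intro eventually_ball_finite ballI each) simp
      then show ?thesis by (simp add: Ball_def)
    qed
    show "((\<lambda>\<tau>. ?W 0 \<tau> x) has_real_derivative
        - (?W 3 t x) - 3 / 2 * \<sigma> * (?W 0 t x)\<^sup>2 * (?W 1 t x)) (at t within {0..T})"
      if t: "t \<in> {0..T}" for t x
    proof -
      obtain ut where ut: "((\<lambda>\<tau>. u \<tau> x) has_real_derivative ut) (at t within {0..T})"
        "ut + (deriv ^^ 3) (u t) x + \<sigma> * deriv (\<lambda>y. (u t y) ^ 3) x = 0"
        using sol t unfolding mkdv_solution_def by blast
      have "(u t has_real_derivative deriv (u t) x) (at x)" using schwartz_deriv[OF sch[OF t], of 0 x] by simp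
      from DERIV_imp_deriv[OF DERIV_power[OF this, of 3]]
      have "deriv (\<lambda>y. (u t y) ^ 3) x = 3 * (u t x)\<^sup>2 * deriv (u t) x" by (simp add: mult_ac)
      then have "sqrt 2 * ut = - (?W 3 t x) - 3 / 2 * \<sigma> * (?W 0 t x)\<^sup>2 * (?W 1 t x)"
      proof -
        assume "deriv (\<lambda>y. (u t y) ^ 3) x = 3 * (u t x)\<^sup>2 * deriv (u t) x"
        then have "ut = - (deriv ^^ 3) (u t) x - \<sigma> * (3 * (u t x)\<^sup>2 * deriv (u t) x)"
            using ut(2) by simp
        then show ?thesis by (simp only: power_mult_distrib) (simp add: algebra_simps)
      qed
      with DERIV_cmult[OF ut(1), of "sqrt 2"] show ?thesis by simp
    qed
  qed
  then show ?thesis ..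
qed

definition Hs_energy :: "real \<Rightarrow> (real \<Rightarrow> real) \<Rightarrow> real" where
  "Hs_energy s f = (LINT \<xi>|lborel. (1 + \<xi>\<^sup>2) powr s * spectrum f \<xi>)"

lemma Hs_energy_nonneg: "0 \<le> Hs_energy s f"
  unfolding Hs_energy_def by (intro Bochner_Integration.integral_nonneg) auto

lemma Hs_norm_energy: "Hs_norm s f = sqrt (Hs_energy s f)"
proof -
  have "(norm (of_real ((1 + \<bar>\<xi>\<bar>\<^sup>2) powr (s / 2)) * fourier f \<xi>))\<^sup>2
      = (1 + \<xi>\<^sup>2) powr s * spectrum f \<xi>" for \<xi> :: real
  proof -
    have "((1 + \<xi>\<^sup>2) powr (s / 2))\<^sup>2 = (1 + \<xi>\<^sup>2) powr s"
        by (simp add: power2_eq_square flip: powr_add)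
    then show ?thesis by (simp add: norm_mult power_mult_distrib)
  qed
  then show ?thesis by (simp add: Hs_norm_def L2_norm_def Hs_energy_def)
qed

lemma bracket_powr_le: "s \<le> 1 \<Longrightarrow> \<bar>(1 + \<xi>\<^sup>2) powr s\<bar>
    \<le> 1 * (1 + (\<xi>::real)\<^sup>2)"
  using powr_mono[of s 1 "1 + \<xi>\<^sup>2"] by simp

context flow
begin

lemma energy_nonneg: "0 \<le> energy s \<kappa>0 t"
  unfolding energy_def by (intro Bochner_Integration.integral_nonneg) auto

lemma energy_integrable:
  assumes "t \<in> {0..T}" "s \<le> 1"
  shows "integrable lborel (\<lambda>\<xi>. (1 + \<xi>\<^sup>2) powr s * spectrum (W 0 t) \<xi>)"
  by (rule potential.weighted_integrable[OF potential[OF assms(1)] _ bracket_powr_le[OF assms(2)]]) measurable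

lemma shifted_energy_integrable:
  assumes "t \<in> {0..T}" "s \<le> 1" and \<kappa>0: "2 \<le> \<kappa>0"
  shows "integrable lborel (\<lambda>\<xi>. weight \<kappa>0 \<xi> powr s * spectrum (W 0 t) \<xi>)"
proof (rule potential.weighted_integrable[OF potential[OF assms(1)]])
  show "\<bar>weight \<kappa>0 \<xi> powr s\<bar> \<le> (4 * \<kappa>0\<^sup>2) * (1 + \<xi>\<^sup>2)" for \<xi>
    using powr_mono[of s 1 "weight \<kappa>0 \<xi>"] weight_ge_1[OF \<kappa>0,
        of \<xi>] weight_le[OF \<kappa>0, of \<xi>] assms(2) by simp
qed measurable

lemma integral_weight_mono:
  assumes t: "t \<in> {0..T}"
    and i: "integrable lborel (\<lambda>\<xi>. w1 \<xi> * spectrum (W 0 t) \<xi>)" "integrable lborel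
        (\<lambda>\<xi>. w2 \<xi> * spectrum (W 0 t) \<xi>)"
    and le: "\<And>\<xi>. w1 \<xi> \<le> c * w2 \<xi>"
  shows "(LINT \<xi>|lborel. w1 \<xi> * spectrum (W 0 t) \<xi>)
      \<le> c * (LINT \<xi>|lborel. w2 \<xi> * spectrum (W 0 t) \<xi>)"
proof -
  have "(LINT \<xi>|lborel. w1 \<xi> * spectrum (W 0 t) \<xi>)
      \<le> (LINT \<xi>|lborel. c * (w2 \<xi> * spectrum (W 0 t) \<xi>))"
    using i le by (intro integral_mono integrable_mult_right)
        (auto simp: mult.assoc[symmetric] intro!: mult_right_mono)
  then show ?thesis by simp
qed

lemma energy_bound_negative:
  assumes t: "t \<in> {0..T}" and s: "- (1/8) < s" "s < 0" and \<kappa>0: "2 \<le> \<kappa>0"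
    and R: "Hs_energy s (W 0 0) \<le> r" and B: "(15 * r + 2) * bracket_mass \<le> \<kappa>0 powr (1/4)"
  shows "Hs_energy s (W 0 t) \<le> 15 * (4 * \<kappa>0\<^sup>2) powr (- s) * Hs_energy s (W 0 0)"
proof -
  have 0: "0 \<in> {0..T}" using t by auto
  have k: "0 < 4 * \<kappa>0\<^sup>2" using \<kappa>0 by simp
  have N0: "energy s \<kappa>0 0 \<le> 1 * Hs_energy s (W 0 0)"
    unfolding energy_def Hs_energy_def
  proof (rule integral_weight_mono[OF 0])
    show "weight \<kappa>0 \<xi> powr s \<le> 1 * (1 + \<xi>\<^sup>2) powr s" for \<xi>
    proof -
      have "1 + \<xi>\<^sup>2 \<le> weight \<kappa>0 \<xi>" using weight_ge_1[OF \<kappa>0, of 0]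
          by (simp add: weight_def)
      then show ?thesis using s powr_mono2'[of s "1 + \<xi>\<^sup>2" "weight \<kappa>0 \<xi>"] by simp
    qed
  qed (use s in \<open>auto intro!: shifted_energy_integrable energy_integrable 0 \<kappa>0\<close>)
  have Nt: "Hs_energy s (W 0 t) \<le> (4 * \<kappa>0\<^sup>2) powr (- s) * energy s \<kappa>0 t"
    unfolding energy_def Hs_energy_def
  proof (rule integral_weight_mono[OF t])
    show "(1 + \<xi>\<^sup>2) powr s \<le> (4 * \<kappa>0\<^sup>2) powr (- s) * weight \<kappa>0 \<xi> powr
        s" for \<xi>
    proof -
      have m0: "0 < weight \<kappa>0 \<xi>" using weight_ge_1[OF \<kappa>0, of \<xi>] by linarith
      have "(4 * \<kappa>0\<^sup>2 * (1 + \<xi>\<^sup>2)) powr s \<le> weight \<kappa>0 \<xi> powr s"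
        using s weight_le[OF \<kappa>0, of \<xi>] m0 by (intro powr_mono2') auto
      then have "(4 * \<kappa>0\<^sup>2) powr s * (1 + \<xi>\<^sup>2) powr s
          \<le> weight \<kappa>0 \<xi> powr s"
        using k by (simp add: powr_mult)
      then have "(4 * \<kappa>0\<^sup>2) powr (- s) * ((4 * \<kappa>0\<^sup>2) powr s * (1
          + \<xi>\<^sup>2) powr s) \<le> (4 * \<kappa>0\<^sup>2) powr (- s) * weight \<kappa>0 \<xi> powr s"
        by (intro mult_left_mono) auto
      moreover have "(4 * \<kappa>0\<^sup>2) powr (- s) * (4 * \<kappa>0\<^sup>2) powr s = 1"
          using \<kappa>0 by (simp flip: powr_add)
      ultimately show ?thesis by (simp only: mult.assoc[symmetric] mult_1)
    qed
  qed (use s in \<open>auto intro!: shifted_energy_integrable energy_integrable t \<kappa>0\<close>)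
  have "energy s \<kappa>0 t \<le> 15 * energy s \<kappa>0 0"
  proof (rule norm_preserved_bootstrap[OF t s \<kappa>0])
    show "15 * energy s \<kappa>0 0 < 15 * r + 1" using N0 R by linarith
    have "15 * r + 1 + 1 = 15 * r + 2" by simp
    then show "(15 * r + 1 + 1) * bracket_mass \<le> \<kappa>0 powr (1/4)" using B by (simp only:)
  qed
  also have "\<dots> \<le> 15 * Hs_energy s (W 0 0)" using N0 by simp
  finally have "(4 * \<kappa>0\<^sup>2) powr (- s) * energy s \<kappa>0 t
      \<le> (4 * \<kappa>0\<^sup>2) powr (- s) * (15 * Hs_energy s (W 0 0))"
    by (intro mult_left_mono) auto
  with Nt show ?thesis by (simp add: mult_ac)
qed

lemma energy_bound_nonnegative:
  assumes t: "t \<in> {0..T}" and s: "0 \<le> s" "s < 1" and \<kappa>0: "2 \<le> \<kappa>0"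
    and R: "Hs_energy s (W 0 0) \<le> r" and B: "(15 * r + 2) * bracket_mass \<le> \<kappa>0 powr (1/4)"
  shows "Hs_energy s (W 0 t) \<le> (27 * (4 * \<kappa>0\<^sup>2) powr s
      + 3072 * pi * r\<^sup>2) * Hs_energy s (W 0 0)"
proof -
  have 0: "0 \<in> {0..T}" using t by auto
  let ?H = "Hs_energy s (W 0 0)"
  have H0: "0 \<le> ?H" by (rule Hs_energy_nonneg)
  have r0: "0 \<le> r" using H0 R by linarith
  define M where "M = (LINT x|lborel. (W 0 0 x)\<^sup>2)"
  have M0: "0 \<le> M" by (simp add: M_def)
  have m0: "0 < weight \<kappa>0 \<xi>" for \<xi> using weight_ge_1[OF \<kappa>0, of \<xi>] by linarith
  have NM: "energy 0 \<kappa>0 t = 2 * pi * (LINT x|lborel. (W 0 t x)\<^sup>2)" if "t \<in> {0..T}" for t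
    using potential.mass_fourier[OF potential[OF that]] m0 by (simp add: energy_def less_imp_neq[symmetric])
  have up: "Hs_energy s (W 0 t) \<le> 1 * energy s \<kappa>0 t"
    unfolding energy_def Hs_energy_def
  proof (rule integral_weight_mono[OF t])
    show "(1 + \<xi>\<^sup>2) powr s \<le> 1 * weight \<kappa>0 \<xi> powr s" for \<xi>
    proof -
      have "1 + \<xi>\<^sup>2 \<le> weight \<kappa>0 \<xi>" using weight_ge_1[OF \<kappa>0, of 0]
          by (simp add: weight_def)
      then show ?thesis using s powr_mono2[of s "1 + \<xi>\<^sup>2" "weight \<kappa>0 \<xi>"] by simp
    qed
  qed (use s in \<open>auto intro!: shifted_energy_integrable energy_integrable t \<kappa>0\<close>)
  have down: "energy s \<kappa>0 0 \<le> (4 * \<kappa>0\<^sup>2) powr s * ?H"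
    unfolding energy_def Hs_energy_def
  proof (rule integral_weight_mono[OF 0])
    show "weight \<kappa>0 \<xi> powr s \<le> (4 * \<kappa>0\<^sup>2) powr s * (1
        + \<xi>\<^sup>2) powr s" for \<xi>
    proof -
      have "weight \<kappa>0 \<xi> powr s \<le> (4 * \<kappa>0\<^sup>2 * (1 + \<xi>\<^sup>2)) powr s"
        using s weight_le[OF \<kappa>0, of \<xi>] m0[of \<xi>] by (intro powr_mono2) auto
      then show ?thesis by (simp add: powr_mult)
    qed
  qed (use s in \<open>auto intro!: shifted_energy_integrable energy_integrable 0 \<kappa>0\<close>)
  have N00: "energy 0 \<kappa>0 0 \<le> 1 * ?H"
    unfolding energy_def Hs_energy_def
  proof (rule integral_weight_mono[OF 0])
    show "weight \<kappa>0 \<xi> powr 0 \<le> 1 * (1 + \<xi>\<^sup>2) powr s" for \<xi>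
      using m0[of \<xi>] s ge_one_powr_ge_zero[of "1 + \<xi>\<^sup>2" s] by simp
  qed (rule shifted_energy_integrable[OF 0 _ \<kappa>0] energy_integrable[OF 0], use s in simp)+
  have MH: "M \<le> ?H"
  proof -
    have "1 * M \<le> 2 * pi * M" using M0 pi_ge_two by (intro mult_right_mono) auto
    then show ?thesis using N00 NM[OF 0] by (simp add: M_def)
  qed
  have "energy s \<kappa>0 t \<le> 27 * energy s \<kappa>0 0 + 3072 * pi * M ^ 3"
  proof (cases "s = 0")
    case True
    have "energy s \<kappa>0 t = energy s \<kappa>0 0" using NM[OF t] NM[OF 0] mass_conserved[OF t] True by simp
    then show ?thesis using energy_nonneg[of s \<kappa>0 0] M0 by simp
  next
    case False
    show ?thesis unfolding M_def
    proof (rule norm_preserved_positive[OF t _ s(2) \<kappa>0 _ r0])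
      show "energy 0 \<kappa>0 0 \<le> r" using N00 R by simp
      have "0 \<le> bracket_mass" unfolding bracket_mass_def by (intro Bochner_Integration.integral_nonneg) auto
      then have "(r + 1) * bracket_mass \<le> (15 * r + 2) * bracket_mass" using r0
          by (intro mult_right_mono) auto
      then show "(r + 1) * bracket_mass \<le> \<kappa>0 powr (1/4)" using B by simp
    qed (use False s in auto)
  qed
  also have "M ^ 3 \<le> r\<^sup>2 * ?H"
  proof -
    have "M\<^sup>2 * M \<le> r\<^sup>2 * ?H" using MH R M0 by (intro mult_mono power_mono) auto
    then show ?thesis by (simp add: power3_eq_cube power2_eq_square)
  qed
  finally have "energy s \<kappa>0 t \<le> 27 * energy s \<kappa>0 0 + 3072 * pi * (r\<^sup>2 * ?H)" by simp
  then show ?thesis using up down by (simp add: algebra_simps)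
qed

end

theorem theorem1p1:
  fixes s :: real
  assumes "- (1 / 8) < s" and "s < 1 / 4"
  shows "\<forall>R>0. \<forall>T>0. \<exists>C>0. \<forall>u0. schwartz u0 \<longrightarrow> Hs_norm s u0
      \<le> R \<longrightarrow>
           (\<forall>\<sigma>\<in>{1, -1}. \<forall>u. mkdv_solution \<sigma> T u0 u \<longrightarrow>
              Linf_Hs_norm T s u \<le> ereal (C * Hs_norm s u0))"
proof (intro allI impI)
  fix R T :: real assume R: "0 < R" and T: "0 < T"
  define r where "r = 2 * R\<^sup>2"
  define X where "X = (15 * r + 2) * bracket_mass"
  (* Large enough for XX, the smallness condition of both energy bounds. *)
  define \<kappa>0 where "\<kappa>0 = max 2 (X powr 4)"
  define D where "D = 15 * (4 * \<kappa>0\<^sup>2) powr (- s) + 27 * (4 * \<kappa>0\<^sup>2) powr s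
      + 3072 * pi * r\<^sup>2"
  have \<kappa>0: "2 \<le> \<kappa>0" by (simp add: \<kappa>0_def)
  have X0: "0 \<le> X"
    unfolding X_def bracket_mass_def r_def by (intro mult_nonneg_nonneg Bochner_Integration.integral_nonneg)
        auto
  have XX: "X \<le> \<kappa>0 powr (1/4)"
  proof -
    have "X = (X powr 4) powr (1/4)" using X0 unfolding powr_powr by simp
    also have "\<dots> \<le> \<kappa>0 powr (1/4)" by (intro powr_mono2) (auto simp: \<kappa>0_def)
    finally show ?thesis .
  qed
  have D: "0 < D" using \<kappa>0 unfolding D_def by (intro add_pos_nonneg) auto
  have "Linf_Hs_norm T s u \<le> ereal (sqrt D * Hs_norm s u0)"
    if u0: "Hs_norm s u0 \<le> R" and \<sigma>: "\<sigma> \<in> {1,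
        -1}" and sol: "mkdv_solution \<sigma> T u0 u" for \<sigma> u0 u
  proof -
    obtain K where "flow \<sigma> T (\<lambda>l t x. sqrt 2 * (deriv ^^ l) (u t) x) K"
      using flow_of_solution[OF sol \<sigma>] by blast
    then interpret flow \<sigma> T "\<lambda>l t x. sqrt 2 * (deriv ^^ l) (u t) x" K .
    have sch: "schwartz (u t)" if "t \<in> {0..T}" for t
      using sol that by (simp add: mkdv_solution_def continuous_into_schwartz_def)
    have F: "fourier (\<lambda>x. sqrt 2 * u t x) \<xi>
        = of_real (sqrt 2) * fourier (u t) \<xi>" if t: "t \<in> {0..T}" for t \<xi>
    proof -
      have "decaying (\<lambda>x. sqrt 2 * u t x)" using decW[OF t, of 0] by simp
      then have "decaying (\<lambda>x. (1 / sqrt 2) * (sqrt 2 * u t x))" by (rule decaying_cmult)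
      moreover have "(\<lambda>x. (1 / sqrt 2) * (sqrt 2 * u t x)) = u t" by (simp add: fun_eq_iff)
      ultimately have "integrable lborel (u t)" by (intro decaying_integrable) (simp only:)
      from fourier_lincomb[OF this this, of "sqrt 2" 0 \<xi>] show ?thesis by simp
    qed
    have HW: "Hs_energy s (\<lambda>x. sqrt 2 * (deriv ^^ 0) (u t) x) = 2 * Hs_energy s (u t)"
        if "t \<in> {0..T}" for t
      unfolding Hs_energy_def integral_mult_right_zero[symmetric]
      by (intro Bochner_Integration.integral_cong refl) (simp add: F[OF that] norm_mult power_mult_distrib)
    have 0: "0 \<in> {0..T}" using T by simp
    have u00: "u 0 = u0" using sol by (simp add: mkdv_solution_def)
    have HW0: "Hs_energy s (\<lambda>x. sqrt 2 * (deriv ^^ 0) (u 0) x) = 2 * Hs_energy s u0"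
      using HW[OF 0] unfolding u00 .
    have "(Hs_norm s u0)\<^sup>2 \<le> R\<^sup>2" using u0
        by (intro power_mono) (auto simp: Hs_norm_energy Hs_energy_nonneg)
    then have "Hs_energy s u0 \<le> R\<^sup>2" by (simp add: Hs_norm_energy Hs_energy_nonneg)
    then have r: "Hs_energy s (\<lambda>x. sqrt 2 * (deriv ^^ 0) (u 0) x) \<le> r" unfolding HW0
        by (simp add: r_def)
    have bound: "Hs_norm s (u t) \<le> sqrt D * Hs_norm s u0" if t: "t \<in> {0..T}" for t
    proof -
      have "Hs_energy s (\<lambda>x. sqrt 2 * (deriv ^^ 0) (u t) x)
          \<le> D * Hs_energy s (\<lambda>x. sqrt 2 * (deriv ^^ 0) (u 0) x)"
      proof (cases "s < 0")
        case True
        have "15 * (4 * \<kappa>0\<^sup>2) powr (- s) \<le> D" unfolding D_def by simp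
        from mult_right_mono[OF this Hs_energy_nonneg] energy_bound_negative[OF t assms(1) True \<kappa>0 r
            XX[unfolded X_def]]
        show ?thesis by (rule order_trans[rotated])
      next
        case False
        then have s: "0 \<le> s" "s < 1" using assms by auto
        have "27 * (4 * \<kappa>0\<^sup>2) powr s + 3072 * pi * r\<^sup>2 \<le> D" unfolding D_def by simp
        from mult_right_mono[OF this Hs_energy_nonneg] energy_bound_nonnegative[OF t s \<kappa>0 r
            XX[unfolded X_def]]
        show ?thesis by (rule order_trans[rotated])
      qed
      then have "Hs_energy s (u t) \<le> D * Hs_energy s u0" unfolding HW[OF t] HW0 by simp
      then show ?thesis unfolding Hs_norm_energy real_sqrt_mult[symmetric] by (rule real_sqrt_le_mono)
    qed
    have cont: "continuous_on {0..T} (\<lambda>t. Hs_norm s (u t))"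
    proof -
      have "continuous_on {0..T} (\<lambda>t. Hs_energy s (\<lambda>x. sqrt 2 * (deriv ^^ 0) (u t) x))"
        unfolding Hs_energy_def
      proof (rule weighted_norm_continuous[OF _ bracket_powr_le])
        show "s \<le> 1" using assms by simp
      qed measurable
      then have "continuous_on {0..T} (\<lambda>t. sqrt (1/2 * Hs_energy s (\<lambda>x.
          sqrt 2 * (deriv ^^ 0) (u t) x)))"
        by (intro continuous_on_real_sqrt continuous_on_mult continuous_on_const)
      then show ?thesis
        by (rule continuous_on_eq) (subst HW, simp_all add: Hs_norm_energy)
    qed
    (* The essential supremum of a function that is not measurable is infinite by definition. *)
    show ?thesis unfolding Linf_Hs_norm_def
    proof (rule esssup_I)
      have "(\<lambda>t. Hs_norm s (u t)) \<in> borel_measurable (lebesgue_on {0..T})"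
        by (rule continuous_imp_measurable_on_sets_lebesgue[OF cont]) simp
      then show "(\<lambda>t. ereal (Hs_norm s (u t))) \<in> borel_measurable (lebesgue_on {0..T})"
        by (rule borel_measurable_ereal)
      show "AE t in lebesgue_on {0..T}. ereal (Hs_norm s (u t)) \<le> ereal (sqrt D * Hs_norm s u0)"
        using bound by (intro AE_I2) (simp add: space_restrict_space)
    qed
  qed
  then show "\<exists>C>0. \<forall>u0. schwartz u0 \<longrightarrow> Hs_norm s u0 \<le> R \<longrightarrow>
           (\<forall>\<sigma>\<in>{1, -1}. \<forall>u. mkdv_solution \<sigma> T u0 u \<longrightarrow>
               Linf_Hs_norm T s u \<le> ereal (C * Hs_norm s u0))"
    using D by (intro exI[of _ "sqrt D"]) auto
qed

end
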